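(* Let $\mathcal X,\mathcal U$ be Euclidean spaces, $\mathcal M\subset\mathcal X$ a $C^2$-smooth embedded submanifold, $\Omega\subset\mathcal U$ open. Let $f:\mathcal X\times\mathcal U\to\mathbb R$ be $C^2$-smooth and let $g:\mathcal X\times\mathcal U\to\overline{\mathbb R}$ be partly smooth relative to $\mathcal M\times\Omega$, such that for every $u\in\Omega$ the functions $f(\cdot,u)$ and $g(\cdot,u)$ are convex, $f(\cdot,u)$ has an $L$-Lipschitz continuous gradient, and $g(\cdot,u)$ has a simple (easily evaluated) proximal mapping. Put $F:=f+g$. Let $(x^*,u^* )\in\mathcal M\times\Omega$ satisfy the non-degeneracy condition $$0\in\operatorname{ri}\partial_xF(x^*,u^* ).$$ Let $0<\underline\alpha\le\bar\alpha<2/L$, let $\alpha_k\in[\underline\alpha,\bar\alpha]$ with $\alpha_k\to\alpha_*$ and $\beta_k\in[0,1]$ with $\beta_k\to\beta_*$. Let $x^{(k)}(u)$ be generated by $x^{(-1)}(u)=x^{(0)}(u)=x^{(0)}\in\mathcal X$ and $$x^{(k+1)}(u)=\mathcal A_{\alpha_k}\big(x^{(k)}(u)+\beta_k(x^{(k)}(u)-x^{(k-1)}(u)),\,u\big),\qquad k\ge0.$$ Suppose that $x^{(k)}(u^* )\to x^*$, with $x^{(0)}$ sufficiently close to $x^*$. Then the sequence of derivatives $(Dx^{(k)}(u^* ))_{k\in\mathbb N}$ converges to $D\psi(u^* )$, where $\psi$ is the solution map described in the context. Additionally, $(Dx^{(k)}(u^* ))_{k\in\mathbb N}$ converges linearly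 with rate $$\max\Big(q_x,\ \rho\big(D_z\mathcal A_{\alpha_*,\beta_*}(x^*,x^*,u^* )\big)\Big)$$ when $\mathcal M$ is $C^3$-smooth, $\nabla_{\mathcal M}g$, $\nabla_x^2f$, $\nabla^2_{\mathcal M}g$, $D_u\nabla_xf$ and $D_u\nabla_{\mathcal M}g$ are locally Lipschitz continuous near $(x^*,u^* )$, and $(x^{(k)}(u^* ))_k$ converges with rate $q_x<1$.
   Context: $\overline{\mathbb R}=[-\infty,\infty]$; $\rho(\cdot)$ is the spectral radius; $\operatorname{ri}$ is the relative interior; $\partial_xF(x,u)$ is the subdifferential of $F(\cdot,u)$ at $x$. Update maps: for $\alpha>0$, $\mathcal A_\alpha(x,u):=\operatorname{prox}_{\alpha g(\cdot,u)}\big(x-\alpha\nabla_xf(x,u)\big)$, where $\operatorname{prox}_{\alpha g(\cdot,u)}(w)=\operatorname{argmin}_{y}\ \alpha g(y,u)+\tfrac12\|y-w\|^2$ (Euclidean norm; $g$ is proper and lower semicontinuous). For $\beta\in[0,1]$ and $z=(x_1,x_2)\in\mathcal X\times\mathcal X$, $\mathcal A_{\alpha,\beta}(z,u):=\big(\mathcal A_\alpha(x_1+\beta(x_1-x_2),u),\,x_1\big)$; $D_z$ is the derivative in $z$. $Dx^{(k)}(u^* )$ is the derivative at $u^*$ of $u\mapsto x^{(k)}(u)$ with $x^{(0)}$, $\alpha_k$, $\beta_k$ held fixed. Geometry: $T_x\mathcal M$, $N_x\mathcal M$ are the tangent and normal spaces of $\mathcal M$ at $x$. For a function $h(x,u)$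 that is $C^2$ on $\mathcal M\times\Omega$, $\nabla_{\mathcal M}h(x,u)$ and $\nabla^2_{\mathcal M}h(x,u)$ are the Riemannian gradient and Hessian of $h(\cdot,u)|_{\mathcal M}$ at $x\in\mathcal M$ (metric induced from $\mathcal X$), with the Hessian extended by $0$ on $N_x\mathcal M$ to a symmetric operator on $\mathcal X$; $D_u\nabla_{\mathcal M}h$ is the derivative of $u\mapsto\nabla_{\mathcal M}h(x,u)$. Partial smoothness: a function $h:\mathcal Z\to\overline{\mathbb R}$ on a Euclidean space is partly smooth relative to a $C^2$ embedded submanifold $\mathcal N\subset\mathcal Z$ if at every $z\in\mathcal N$: (1) $h|_{\mathcal N}$ is $C^2$ around $z$; (2) at every point of $\mathcal N$ near $z$, $h$ is (Clarke/subdifferentially) regular with nonempty subdifferential; (3) the linear space parallel to the affine hull of $\partial h(z)$ equals $N_z\mathcal N$; (4) the set-valued map $\partial h$ restricted to $\mathcal N$ is continuous at $z$ (Painlevé–Kuratowski). Solution map: $\psi:U\to\mathcal M$ denotes the $C^1$ map on an open neighbourhood $U\subset\Omega$ of $u^*$ with $\psi(u^* )=x^*$ such that, for $u\in U$, $\psi(u)$ is the unique minimizer of $F(\cdot,u)|_{\mathcal M}$; its derivative is $D\psi(u)=-\nabla^2_{\mathcal M}F(\psi(u),u)^\dagger D_u\nabla_{\mathcal M}F(\psi(u),u)$, where $\dagger$ is the pseudoinverse. (The implicit function theorem for partly smooth functions furnishes such a $\psi$ when, besides non-degeneracy, $\nabla^2_{\mathcal M}F(x^*,u^* )$ is positive definite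 on $T_{x^*}\mathcal M$.) Linear rate: a sequence $(z_k)$ with limit $z$ converges linearly with rate $q<1$ if for every $q'\in(q,1)$ one has $\|z_k-z\|=\mathcal O(q'^k)$.
   Formalization: The formal theorem adds the hypothesis ρ(D_z A_{α*,β*}(x*,x*,u* )) < 1 to both claims; without it the first fails, e.g. f=(x−u)²/2, g=0, α_k=1.9, β_k=1, x^(0)=x*=u*=0, where the derivatives diverge. *)

theory Defs
  imports "HOL-Analysis.Analysis" "HOL-Library.Landau_Symbols"
begin

section \<open>Derivatives and smoothness\<close>

(* Only meaningful where the derivative exists: frechet_derivative is unspecified elsewhere. *)
definition deriv_op :: "('a::euclidean_space \<Rightarrow> 'b::euclidean_space) \<Rightarrow> 'a \<Rightarrow> 'a \<Rightarrow>\<^sub>L 'b" where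
  "deriv_op \<phi> a = Blinfun (frechet_derivative \<phi> (at a))"

definition gradient :: "('a::euclidean_space \<Rightarrow> real) \<Rightarrow> 'a \<Rightarrow> 'a" where
  "gradient \<phi> a = (THE D. GDERIV \<phi> a :> D)"

(* Class C^k on an open set S.  Iterated directional derivatives keep the type fixed during the
   recursion; in finite dimension this is the usual notion. *)
primrec Ck_on :: "nat \<Rightarrow> ('a::euclidean_space \<Rightarrow> 'b::euclidean_space) \<Rightarrow> 'a set \<Rightarrow> bool" where
  "Ck_on 0 \<phi> S \<longleftrightarrow> continuous_on S \<phi>"
| "Ck_on (Suc k) \<phi> S \<longleftrightarrow> (\<forall>a\<in>S. \<phi> differentiable (at a)) \<and>
      (\<forall>v. Ck_on k (\<lambda>a. frechet_derivative \<phi> (at a) v) S)"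

definition lipschitz_near :: "'a::metric_space set \<Rightarrow> ('a \<Rightarrow> 'b::metric_space) \<Rightarrow> 'a \<Rightarrow> bool" where
  "lipschitz_near S \<phi> a \<longleftrightarrow> (\<exists>e>0. \<exists>C. C-lipschitz_on (S \<inter> ball a e) \<phi>)"

section \<open>Submanifolds of a Euclidean space\<close>

(* Embedded C^k submanifold of dimension "dim S": local C^k diffeomorphisms of the ambient space
   flatten M onto the linear subspace S. *)
definition Ck_submanifold :: "nat \<Rightarrow> 'a::euclidean_space set \<Rightarrow> bool" where
  "Ck_submanifold k M \<longleftrightarrow> (\<exists>S. subspace S \<and> (\<forall>x\<in>M. \<exists>W V (\<Phi>::'a \<Rightarrow> 'a) \<Psi>.
      open W \<and> x \<in> W \<and> open V \<and> homeomorphism W V \<Phi> \<Psi> \<and>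
      Ck_on k \<Phi> W \<and> Ck_on k \<Psi> V \<and> \<Phi> ` (M \<inter> W) = S \<inter> V))"

definition curve_at :: "'a::euclidean_space set \<Rightarrow> 'a \<Rightarrow> 'a \<Rightarrow> (real \<Rightarrow> 'a) \<Rightarrow> bool" where
  "curve_at M x v \<gamma> \<longleftrightarrow>
     \<gamma> 0 = x \<and> (\<forall>\<^sub>F t in nhds 0. \<gamma> t \<in> M) \<and> (\<gamma> has_vector_derivative v) (at 0)"

definition tangent_space :: "'a::euclidean_space set \<Rightarrow> 'a \<Rightarrow> 'a set" where
  "tangent_space M x = {v. \<exists>\<gamma>. curve_at M x v \<gamma>}"

definition normal_space :: "'a::euclidean_space set \<Rightarrow> 'a \<Rightarrow> 'a set" where
  "normal_space M x = (tangent_space M x)\<^sup>\<bottom>"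

(* The tangent vector representing the differential of the restriction of h to M;
   only the values of h on M matter. *)
definition riem_grad :: "'a::euclidean_space set \<Rightarrow> ('a \<Rightarrow> real) \<Rightarrow> 'a \<Rightarrow> 'a" where
  "riem_grad M h x = (THE \<xi>. \<xi> \<in> tangent_space M x \<and>
     (\<forall>\<gamma> v. curve_at M x v \<gamma> \<longrightarrow> ((\<lambda>t. h (\<gamma> t)) has_real_derivative (\<xi> \<bullet> v)) (at 0)))"

(* Covariant derivative of the Riemannian gradient.  The Levi-Civita connection of the induced
   metric is the tangential part of the ambient derivative: H v is the orthogonal projection of
   d onto the tangent space.  H vanishes on the normal space. *)
definition riem_hess :: "'a::euclidean_space set \<Rightarrow> ('a \<Rightarrow> real) \<Rightarrow> 'a \<Rightarrow> 'a \<Rightarrow>\<^sub>L 'a" where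
  "riem_hess M h x = (THE H. (\<forall>w\<in>normal_space M x. blinfun_apply H w = 0) \<and>
     (\<forall>\<gamma> v. curve_at M x v \<gamma> \<longrightarrow>
        (\<exists>d. ((\<lambda>t. riem_grad M h (\<gamma> t)) has_vector_derivative d) (at 0) \<and>
             blinfun_apply H v \<in> tangent_space M x \<and>
             d - blinfun_apply H v \<in> normal_space M x)))"

(* Parametric versions for extended-real-valued h; they are used where h is finite on M. *)
definition riem_grad_x ::
    "'x::euclidean_space set \<Rightarrow> ('x \<times> 'u::euclidean_space \<Rightarrow> ereal) \<Rightarrow> 'x \<times> 'u \<Rightarrow> 'x" where
  "riem_grad_x M h = (\<lambda>(x, u). riem_grad M (\<lambda>y. real_of_ereal (h (y, u))) x)"

definition riem_hess_x ::
    "'x::euclidean_space set \<Rightarrow> ('x \<times> 'u::euclidean_space \<Rightarrow> ereal) \<Rightarrow> 'x \<times> 'u \<Rightarrow> 'x \<Rightarrow>\<^sub>L 'x" where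
  "riem_hess_x M h = (\<lambda>(x, u). riem_hess M (\<lambda>y. real_of_ereal (h (y, u))) x)"

definition Du_riem_grad_x ::
    "'x::euclidean_space set \<Rightarrow> ('x \<times> 'u::euclidean_space \<Rightarrow> ereal) \<Rightarrow> 'x \<times> 'u \<Rightarrow> 'u \<Rightarrow>\<^sub>L 'x" where
  "Du_riem_grad_x M h = (\<lambda>(x, u). deriv_op (\<lambda>u'. riem_grad_x M h (x, u')) u)"

definition grad_x ::
    "('x::euclidean_space \<times> 'u::euclidean_space \<Rightarrow> real) \<Rightarrow> 'x \<times> 'u \<Rightarrow> 'x" where
  "grad_x f = (\<lambda>(x, u). gradient (\<lambda>y. f (y, u)) x)"

definition hess_x ::
    "('x::euclidean_space \<times> 'u::euclidean_space \<Rightarrow> real) \<Rightarrow> 'x \<times> 'u \<Rightarrow> 'x \<Rightarrow>\<^sub>L 'x" where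
  "hess_x f = (\<lambda>(x, u). deriv_op (\<lambda>y. grad_x f (y, u)) x)"

definition Du_grad_x ::
    "('x::euclidean_space \<times> 'u::euclidean_space \<Rightarrow> real) \<Rightarrow> 'x \<times> 'u \<Rightarrow> 'u \<Rightarrow>\<^sub>L 'x" where
  "Du_grad_x f = (\<lambda>(x, u). deriv_op (\<lambda>u'. grad_x f (x, u')) u)"

section \<open>Variational analysis\<close>

definition epi :: "('a \<Rightarrow> ereal) \<Rightarrow> ('a \<times> real) set" where
  "epi h = {(x, r). h x \<le> ereal r}"

definition convex_fun :: "('a::real_vector \<Rightarrow> ereal) \<Rightarrow> bool" where
  "convex_fun h \<longleftrightarrow> convex (epi h)"

definition proper_fun :: "('a \<Rightarrow> ereal) \<Rightarrow> bool" where
  "proper_fun h \<longleftrightarrow> (\<forall>x. h x \<noteq> -\<infinity>) \<and> (\<exists>x. h x \<noteq> \<infinity>)"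

definition lsc_fun :: "('a::topological_space \<Rightarrow> ereal) \<Rightarrow> bool" where
  "lsc_fun h \<longleftrightarrow> (\<forall>x. h x \<le> Liminf (at x) h)"

(* Frechet (regular) normals, limiting normals, and Clarke regularity of a set. *)
definition regular_normals :: "'a::euclidean_space set \<Rightarrow> 'a \<Rightarrow> 'a set" where
  "regular_normals C x =
     {v. \<forall>e>0. \<forall>\<^sub>F y in at x within C. v \<bullet> (y - x) \<le> e * norm (y - x)}"

definition limiting_normals :: "'a::euclidean_space set \<Rightarrow> 'a \<Rightarrow> 'a set" where
  "limiting_normals C x =
     {v. \<exists>y w. (\<forall>n::nat. y n \<in> C \<and> w n \<in> regular_normals C (y n)) \<and>
               y \<longlonglongrightarrow> x \<and> w \<longlonglongrightarrow> v}"

definition regular_set_at :: "'a::euclidean_space set \<Rightarrow> 'a \<Rightarrow> bool" where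
  "regular_set_at C x \<longleftrightarrow> x \<in> C \<and> (\<exists>e>0. closed (C \<inter> cball x e)) \<and>
     limiting_normals C x = regular_normals C x"

(* The limiting subdifferential, empty where h is not finite.  It is the subdifferential of convex
   analysis for proper convex lsc h, and the Clarke subdifferential wherever h is regular. *)
definition subdiff :: "('a::euclidean_space \<Rightarrow> ereal) \<Rightarrow> 'a \<Rightarrow> 'a set" where
  "subdiff h x =
     {v. \<bar>h x\<bar> \<noteq> \<infinity> \<and> (v, -1) \<in> limiting_normals (epi h) (x, real_of_ereal (h x))}"

definition regular_at :: "('a::euclidean_space \<Rightarrow> ereal) \<Rightarrow> 'a \<Rightarrow> bool" where
  "regular_at h x \<longleftrightarrow> \<bar>h x\<bar> \<noteq> \<infinity> \<and> regular_set_at (epi h) (x, real_of_ereal (h x))"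

definition C2_along :: "'a::euclidean_space set \<Rightarrow> ('a \<Rightarrow> ereal) \<Rightarrow> 'a \<Rightarrow> bool" where
  "C2_along N h z \<longleftrightarrow> (\<exists>W h'. open W \<and> z \<in> W \<and> Ck_on 2 h' W \<and>
     (\<forall>y\<in>N \<inter> W. h y = ereal (h' y)))"

(* Painleve-Kuratowski continuity of G restricted to N, at z: outer and inner semicontinuity. *)
definition PK_continuous_at :: "'a::metric_space set \<Rightarrow> ('a \<Rightarrow> 'b::metric_space set) \<Rightarrow> 'a \<Rightarrow> bool" where
  "PK_continuous_at N G z \<longleftrightarrow>
     (\<forall>(y::nat \<Rightarrow> 'a) w v. (\<forall>n. y n \<in> N \<and> w n \<in> G (y n)) \<and> y \<longlonglongrightarrow> z \<and> w \<longlonglongrightarrow> v \<longrightarrow> v \<in> G z) \<and>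
     (\<forall>v\<in>G z. \<forall>y::nat \<Rightarrow> 'a. (\<forall>n. y n \<in> N) \<and> y \<longlonglongrightarrow> z \<longrightarrow>
        (\<exists>w. (\<forall>\<^sub>F n in sequentially. w n \<in> G (y n)) \<and> w \<longlonglongrightarrow> v))"

definition partly_smooth :: "('a::euclidean_space \<Rightarrow> ereal) \<Rightarrow> 'a set \<Rightarrow> bool" where
  "partly_smooth h N \<longleftrightarrow> Ck_submanifold 2 N \<and>
     (\<forall>z\<in>N. C2_along N h z \<and>
        (\<forall>\<^sub>F y in nhds z. y \<in> N \<longrightarrow> regular_at h y \<and> subdiff h y \<noteq> {}) \<and>
        affine_parallel (affine hull (subdiff h z)) (normal_space N z) \<and>
        PK_continuous_at N (subdiff h) z)"

section \<open>Linear operators\<close>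

(* Moore-Penrose pseudoinverse. *)
definition pinv :: "('a::euclidean_space \<Rightarrow>\<^sub>L 'a) \<Rightarrow> 'a \<Rightarrow>\<^sub>L 'a" where
  "pinv A = (THE B. A o\<^sub>L B o\<^sub>L A = A \<and> B o\<^sub>L A o\<^sub>L B = B \<and>
     (\<forall>v w. blinfun_apply (A o\<^sub>L B) v \<bullet> w = v \<bullet> blinfun_apply (A o\<^sub>L B) w) \<and>
     (\<forall>v w. blinfun_apply (B o\<^sub>L A) v \<bullet> w = v \<bullet> blinfun_apply (B o\<^sub>L A) w))"

(* Eigenvalues, real or not, of a real linear map T: the equation T (v + i w) = c (v + i w) in the
   complexification, split into real and imaginary parts. *)
definition complex_eigenvalue :: "('a::real_vector \<Rightarrow> 'a) \<Rightarrow> complex \<Rightarrow> bool" where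
  "complex_eigenvalue T c \<longleftrightarrow> (\<exists>v w. (v, w) \<noteq> (0, 0) \<and>
     T v = Re c *\<^sub>R v - Im c *\<^sub>R w \<and> T w = Im c *\<^sub>R v + Re c *\<^sub>R w)"

definition spectral_radius :: "('a::euclidean_space \<Rightarrow>\<^sub>L 'a) \<Rightarrow> real" where
  "spectral_radius T = Max (cmod ` {c. complex_eigenvalue (blinfun_apply T) c})"

section \<open>The algorithm, the solution map and linear convergence\<close>

definition prox :: "('a::euclidean_space \<Rightarrow> ereal) \<Rightarrow> 'a \<Rightarrow> 'a" where
  "prox h w = arg_min (\<lambda>y. h y + ereal ((norm (y - w))\<^sup>2 / 2)) (\<lambda>_. True)"

definition prox_grad_step ::
    "('x::euclidean_space \<times> 'u::euclidean_space \<Rightarrow> real) \<Rightarrow> ('x \<times> 'u \<Rightarrow> ereal) \<Rightarrow> real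
      \<Rightarrow> 'x \<Rightarrow> 'u \<Rightarrow> 'x" where
  "prox_grad_step f g \<alpha> x u =
     prox (\<lambda>y. ereal \<alpha> * g (y, u)) (x - \<alpha> *\<^sub>R grad_x f (x, u))"

(* The derivative in z at a fixed point (x, x) may have spectral radius above 1 even for strongly
   convex data: for f (x, u) = (x - u)^2 / 2, g = 0, alpha = 1.9, beta = 1 it has an eigenvalue
   near -2.2, and the u-derivatives of the iterates diverge although x0 = u gives constant
   iterates.  Spectral radius below 1 is therefore a genuine hypothesis; it implies that the
   Riemannian Hessian of F is positive definite on the tangent space at a nondegenerate
   minimizer. *)
definition accel_step ::
    "('x::euclidean_space \<times> 'u::euclidean_space \<Rightarrow> real) \<Rightarrow> ('x \<times> 'u \<Rightarrow> ereal) \<Rightarrow> real \<Rightarrow> real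
      \<Rightarrow> 'x \<times> 'x \<Rightarrow> 'u \<Rightarrow> 'x \<times> 'x" where
  "accel_step f g \<alpha> \<beta> z u =
     (prox_grad_step f g \<alpha> (fst z + \<beta> *\<^sub>R (fst z - snd z)) u, fst z)"

(* The pair of the current and the previous iterate, which agree initially. *)
primrec iterate_pair ::
    "('x::euclidean_space \<times> 'u::euclidean_space \<Rightarrow> real) \<Rightarrow> ('x \<times> 'u \<Rightarrow> ereal)
      \<Rightarrow> (nat \<Rightarrow> real) \<Rightarrow> (nat \<Rightarrow> real) \<Rightarrow> 'x \<Rightarrow> nat \<Rightarrow> 'u \<Rightarrow> 'x \<times> 'x" where
  "iterate_pair f g \<alpha> \<beta> x0 0 u = (x0, x0)"
| "iterate_pair f g \<alpha> \<beta> x0 (Suc k) u = accel_step f g (\<alpha> k) (\<beta> k) (iterate_pair f g \<alpha> \<beta> x0 k u) u"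

definition iterate ::
    "('x::euclidean_space \<times> 'u::euclidean_space \<Rightarrow> real) \<Rightarrow> ('x \<times> 'u \<Rightarrow> ereal)
      \<Rightarrow> (nat \<Rightarrow> real) \<Rightarrow> (nat \<Rightarrow> real) \<Rightarrow> 'x \<Rightarrow> nat \<Rightarrow> 'u \<Rightarrow> 'x" where
  "iterate f g \<alpha> \<beta> x0 k u = fst (iterate_pair f g \<alpha> \<beta> x0 k u)"

definition solution_map ::
    "('x::euclidean_space \<times> 'u::euclidean_space \<Rightarrow> ereal) \<Rightarrow> 'x set \<Rightarrow> 'u set
      \<Rightarrow> 'x \<Rightarrow> 'u \<Rightarrow> 'u set \<Rightarrow> ('u \<Rightarrow> 'x) \<Rightarrow> bool" where
  "solution_map F M \<Omega> xs us U \<psi> \<longleftrightarrow>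
     open U \<and> us \<in> U \<and> U \<subseteq> \<Omega> \<and> Ck_on 1 \<psi> U \<and> \<psi> us = xs \<and>
     (\<forall>u\<in>U. \<psi> u \<in> M \<and> (\<forall>y\<in>M. y \<noteq> \<psi> u \<longrightarrow> F (\<psi> u, u) < F (y, u)) \<and>
        deriv_op \<psi> u = - (pinv (riem_hess_x M F (\<psi> u, u)) o\<^sub>L Du_riem_grad_x M F (\<psi> u, u)))"

definition converges_linearly :: "(nat \<Rightarrow> 'a::real_normed_vector) \<Rightarrow> 'a \<Rightarrow> real \<Rightarrow> bool" where
  "converges_linearly z l q \<longleftrightarrow> 0 \<le> q \<and> q < 1 \<and>
     (\<forall>q'\<in>{q<..<1}. (\<lambda>k. norm (z k - l)) \<in> O(\<lambda>k. q' ^ k))"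

end

theory Submission
  imports Defs "HOL-Computational_Algebra.Fundamental_Theorem_Algebra"
begin

(* Write the iteration on pairs z = (x, x') as z_(k+1)(u) = A(t_k, z_k(u), u) with t_k = (alpha_k, beta_k).
   In a chart phi of M, the point phi(s) with vanishing gradient of
   s |-> alpha g(phi(s), u) + |phi(s) - w|^2 / 2 is given by the implicit function theorem, and
   nondegeneracy together with continuity of the subdifferential along M x Omega shows that it is
   the proximal point of w.  Hence A is C^1 near the limit point, with a locally Lipschitz derivative
   under the additional smoothness assumptions.

   The same argument shows that (psi(u), psi(u)) is a fixed point of A(t, ., u) for every t, so
   D = (D psi, D psi) solves the linearized fixed point equation exactly for all step sizes.  The
   error E_k = D z_k - D therefore satisfies E_(k+1) = B_k E_k + r_k, where B_k tends to D_z A at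
   the limit and r_k is controlled by the distance of z_k to its limit alone; no rate for t_k is needed.  In a norm
   adapted to the spectral radius both the nonlinear iteration and this recursion contract. *)

section \<open>Continuously differentiable maps near a point\<close>

text \<open>Three obstacles shape the argument. Nondegeneracy speaks of subgradients in x alone,
  partial smoothness of joint subgradients in (x, u), and \<open>g\<close> is assumed convex only in
  x. Subgradients of a section are therefore lifted to joint ones before continuity along the
  manifold can be used. The equation for s can be solved because its s-derivative is injective: by
  convexity of g(., u), the quadratic proximal term makes the objective grow quadratically at its
  minimizer. The equation is posed on the whole ambient space, with an added term that pins the
  component orthogonal to the model subspace. A is controlled uniformly only for t close to its
  limit. The finitely many earlier steps are handled by continuity at the common fixed point, which
  is where closeness of the starting point comes from. The spectral radius is defined by
  eigenvalues, so the adapted norm rests on a power bound C q^n for every q above it. This bound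
  comes from an annihilating polynomial split over the complex numbers; Jordan blocks are the reason
  for the strict gap.\<close>

(* The flag selects the regularity class: continuity (False) or Lipschitz continuity (True) near
   the point.  It lets one argument serve the convergence and the rate statement. *)
definition loc_reg :: "bool \<Rightarrow> ('a::metric_space \<Rightarrow> 'b::metric_space) \<Rightarrow> 'a \<Rightarrow> bool" where
  "loc_reg b h a \<longleftrightarrow>
     (\<exists>S. open S \<and> a \<in> S \<and> continuous_on S h \<and> (b \<longrightarrow> (\<exists>C. C-lipschitz_on S h)))"

text \<open>The derivative is a family of bounded operators, so its continuity is in operator norm,
  and only the derivative carries the flag: \<open>C1_near False\<close> means class C^1 near the
  point, \<open>C1_near True\<close> class C^{1,1}. The map itself is locally Lipschitz in both
  cases.\<close>

definition C1_near ::
    "bool \<Rightarrow> ('a::real_normed_vector \<Rightarrow> 'b::real_normed_vector) \<Rightarrow> 'a \<Rightarrow> bool" where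
  "C1_near b \<phi> a \<longleftrightarrow>
     (\<exists>\<phi>'. (\<forall>\<^sub>F x in nhds a. (\<phi> has_derivative blinfun_apply (\<phi>' x)) (at x)) \<and> loc_reg b \<phi>' a)"

lemma loc_regI_lipschitz:
  assumes "open S" "a \<in> S" "C-lipschitz_on S h"
  shows "loc_reg b h a"
  unfolding loc_reg_def using assms lipschitz_on_continuous_on by blast

lemma loc_reg_True_imp: "loc_reg True h a \<Longrightarrow> loc_reg b h a"
  unfolding loc_reg_def by auto

lemma loc_reg_imp_False: "loc_reg b h a \<Longrightarrow> loc_reg False h a"
  unfolding loc_reg_def by auto

lemma loc_reg_isCont: "loc_reg b h a \<Longrightarrow> isCont h a"
  unfolding loc_reg_def by (auto simp: continuous_on_eq_continuous_at)

lemma loc_reg_cong: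
  assumes "loc_reg b h a" and "\<forall>\<^sub>F x in nhds a. h x = k x"
  shows "loc_reg b k a"
proof -
  obtain S where S: "open S" "a \<in> S" "continuous_on S h" "b \<longrightarrow> (\<exists>C. C-lipschitz_on S h)"
    using assms(1) unfolding loc_reg_def by auto
  obtain T where T: "open T" "a \<in> T" "\<And>x. x \<in> T \<Longrightarrow> h x = k x"
    using assms(2) unfolding eventually_nhds by blast
  have "continuous_on (S \<inter> T) k"
    using continuous_on_subset[OF S(3), of "S \<inter> T"] T(3)
    by (subst continuous_on_cong[OF refl, of _ _ h]) auto
  moreover have "\<exists>C. C-lipschitz_on (S \<inter> T) k" if bt: b
  proof -
    obtain C where "C-lipschitz_on S h" using S(4) bt by auto
    then have "C-lipschitz_on (S \<inter> T) h" by (rule lipschitz_on_subset) auto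
    then have "C-lipschitz_on (S \<inter> T) k" by (rule lipschitz_on_transform) (use T(3) in auto)
    then show ?thesis by blast
  qed
  ultimately show ?thesis
    unfolding loc_reg_def using S T by (intro exI[of _ "S \<inter> T"]) auto
qed

lemma loc_reg_const: "loc_reg b (\<lambda>x. c) a"
  using lipschitz_on_constant[of UNIV c] by (intro loc_regI_lipschitz[of UNIV]) auto

lemma loc_reg_compose:
  assumes "loc_reg b h a" "loc_reg b k (h a)"
  shows "loc_reg b (\<lambda>x. k (h x)) a"
proof -
  obtain S where S: "open S" "a \<in> S" "continuous_on S h" "b \<longrightarrow> (\<exists>C. C-lipschitz_on S h)"
    using assms(1) unfolding loc_reg_def by auto
  obtain T where T: "open T" "h a \<in> T" "continuous_on T k" "b \<longrightarrow> (\<exists>C. C-lipschitz_on T k)"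
    using assms(2) unfolding loc_reg_def by auto
  let ?R = "S \<inter> h -` T"
  have 1: "open ?R" using S T continuous_on_open_vimage by (metis Int_commute)
  have 2: "continuous_on ?R (\<lambda>x. k (h x))"
    using continuous_on_compose2[OF T(3) continuous_on_subset[OF S(3)], of ?R] by auto
  have 3: "\<exists>C. C-lipschitz_on ?R (\<lambda>x. k (h x))" if bt: b
  proof -
    obtain C D where "C-lipschitz_on S h" "D-lipschitz_on T k" using S T bt by auto
    then have "C-lipschitz_on ?R h" "D-lipschitz_on (h ` ?R) k"
      by (auto intro: lipschitz_on_subset)
    then show ?thesis using lipschitz_on_compose2 by blast
  qed
  show ?thesis unfolding loc_reg_def using 1 2 3 S T by (intro exI[of _ ?R]) auto
qed

lemma loc_reg_Pair:
  assumes "loc_reg b h a" "loc_reg b k a"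
  shows "loc_reg b (\<lambda>x. (h x, k x)) a"
proof -
  obtain S where S: "open S" "a \<in> S" "continuous_on S h" "b \<longrightarrow> (\<exists>C. C-lipschitz_on S h)"
    using assms(1) unfolding loc_reg_def by auto
  obtain T where T: "open T" "a \<in> T" "continuous_on T k" "b \<longrightarrow> (\<exists>C. C-lipschitz_on T k)"
    using assms(2) unfolding loc_reg_def by auto
  have "\<exists>C. C-lipschitz_on (S \<inter> T) (\<lambda>x. (h x, k x))" if bt: b
    using lipschitz_on_Pair S(4) T(4) bt by (metis inf_le1 inf_le2 lipschitz_on_subset)
  moreover have "continuous_on (S \<inter> T) (\<lambda>x. (h x, k x))"
    using S(3) T(3) by (auto intro!: continuous_on_Pair intro: continuous_on_subset)
  ultimately show ?thesis unfolding loc_reg_def using S T by (intro exI[of _ "S \<inter> T"]) auto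
qed

lemma loc_reg_linear:
  assumes "bounded_linear h"
  shows "loc_reg b h a"
  by (rule bounded_linear.lipschitz_boundE[OF assms])
     (rule loc_regI_lipschitz[of UNIV], auto)

text \<open>Bilinear maps are Lipschitz only on bounded sets, with a constant proportional to the
  bound \<open>B\<close> on the arguments; the radius 1 is arbitrary.\<close>

lemma bilinear_lipschitz_on_ball:
  assumes "bounded_bilinear m"
  shows "\<exists>C. C-lipschitz_on (ball (x0, y0) 1) (\<lambda>(x, y). m x y)"
proof -
  interpret bounded_bilinear m by fact
  obtain K where K: "K \<ge> 0" "\<And>x y. norm (m x y) \<le> norm x * norm y * K"
    using nonneg_bounded by auto
  define B where "B = norm (x0, y0) + 1"
  have B: "norm x \<le> B" "norm y \<le> B" if "(x, y) \<in> ball (x0, y0) 1" for x y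
  proof -
    have "norm (x, y) \<le> B"
      using that norm_triangle_ineq2[of "(x, y)" "(x0, y0)"]
      unfolding B_def by (simp add: dist_norm norm_minus_commute del: diff_Pair)
    then show "norm x \<le> B" "norm y \<le> B"
      using norm_fst_le[of x y] norm_snd_le[of y x] by auto
  qed
  have B0: "B \<ge> 0" unfolding B_def by simp
  have "(2 * B * K)-lipschitz_on (ball (x0, y0) 1) (\<lambda>(x, y). m x y)"
  proof (rule lipschitz_onI, clarify)
    fix x y x' y' assume a: "(x, y) \<in> ball (x0, y0) 1" "(x', y') \<in> ball (x0, y0) 1"
    have n: "norm (x - x') \<le> norm ((x, y) - (x', y'))" "norm (y - y') \<le> norm ((x, y) - (x', y'))"
      using norm_fst_le[of "x - x'" "y - y'"] norm_snd_le[of "y - y'" "x - x'"] by auto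
    have "m x y - m x' y' = m (x - x') y + m x' (y - y')"
      by (simp add: diff_left diff_right)
    then have "norm (m x y - m x' y') \<le> norm (x - x') * norm y * K + norm x' * norm (y - y') * K"
      using K(2)[of "x - x'" y] K(2)[of x' "y - y'"] norm_triangle_ineq[of "m (x - x') y" "m x' (y - y')"]
      by simp
    also have "\<dots> \<le> norm ((x, y) - (x', y')) * B * K + B * norm ((x, y) - (x', y')) * K"
      using n B[OF a(1)] B[OF a(2)] K(1) B0 by (intro add_mono mult_right_mono mult_mono) auto
    finally show "dist (m x y) (m x' y') \<le> 2 * B * K * dist (x, y) (x', y')"
      by (simp add: dist_norm algebra_simps)
  qed (use B0 K in auto)
  then show ?thesis by blast
qed

lemma loc_reg_bilinear:
  assumes "bounded_bilinear m" "loc_reg b h a" "loc_reg b k a"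
  shows "loc_reg b (\<lambda>x. m (h x) (k x)) a"
proof -
  have "loc_reg b (\<lambda>(x, y). m x y) (h a, k a)"
    using bilinear_lipschitz_on_ball[OF assms(1), of "h a" "k a"]
    by (metis centre_in_ball loc_regI_lipschitz open_ball zero_less_one)
  from loc_reg_compose[OF loc_reg_Pair[OF assms(2,3)] this] show ?thesis by simp
qed

lemma loc_reg_sum:
  fixes h :: "'i \<Rightarrow> 'a::metric_space \<Rightarrow> 'b::real_normed_vector"
  assumes "\<And>i. i \<in> I \<Longrightarrow> loc_reg b (h i) a"
  shows "loc_reg b (\<lambda>x. \<Sum>i\<in>I. h i x) a"
  using assms
proof (induction I rule: infinite_finite_induct)
  case (insert i I)
  have "loc_reg b (\<lambda>x. (\<lambda>(u, v). u + v) (h i x, \<Sum>i\<in>I. h i x)) a"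
    by (rule loc_reg_compose[OF loc_reg_Pair])
       (use insert in \<open>auto intro!: loc_reg_linear bounded_linear_intros simp: split_beta\<close>)
  then show ?case using insert by simp
qed (auto intro: loc_reg_const)

lemma loc_reg_add:
  fixes h k :: "'a::metric_space \<Rightarrow> 'b::real_normed_vector"
  assumes "loc_reg b h a" "loc_reg b k a"
  shows "loc_reg b (\<lambda>x. h x + k x) a"
proof -
  have "loc_reg b (\<lambda>p. fst p + snd p) (h a, k a)"
    by (intro loc_reg_linear bounded_linear_intros)
  from loc_reg_compose[OF loc_reg_Pair[OF assms] this] show ?thesis by simp
qed

section \<open>Operators given by their values on a basis\<close>

text \<open>The rank-one operator with value \<open>c\<close> in direction \<open>i\<close>. Summed
  over a basis, these rebuild an operator from its columns, which reduces regularity of an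
  operator-valued map to that of finitely many vector-valued ones.\<close>

definition column_op :: "'a::euclidean_space \<Rightarrow> 'b::real_normed_vector \<Rightarrow> 'a \<Rightarrow>\<^sub>L 'b" where
  "column_op i c = blinfun_scaleR_left c o\<^sub>L blinfun_inner_left i"

lemma column_op_apply [simp]: "blinfun_apply (column_op i c) v = (v \<bullet> i) *\<^sub>R c"
  unfolding column_op_def by (simp add: blinfun_inner_left.rep_eq)

lemma bounded_linear_column_op: "bounded_linear (column_op i)"
  unfolding column_op_def
  by (rule bounded_linear_compose[OF
        bounded_bilinear.bounded_linear_left[OF bounded_bilinear_blinfun_compose]
        bounded_linear_blinfun_scaleR_left])

lemma blinfun_eq_sum_column_op:
  "A = (\<Sum>i\<in>Basis. column_op i (blinfun_apply A i))"
proof (rule blinfun_eqI)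
  fix v :: 'a
  have "blinfun_apply A v = blinfun_apply A (\<Sum>i\<in>Basis. (v \<bullet> i) *\<^sub>R i)"
    by (simp add: euclidean_representation)
  then show "blinfun_apply A v = blinfun_apply (\<Sum>i\<in>Basis. column_op i (blinfun_apply A i)) v"
    by (simp add: blinfun.sum_left blinfun.sum_right blinfun.scaleR_right)
qed

lemma loc_reg_blinfun:
  fixes A :: "'c::metric_space \<Rightarrow> 'a::euclidean_space \<Rightarrow>\<^sub>L 'b::real_normed_vector"
  assumes "\<And>i. i \<in> Basis \<Longrightarrow> loc_reg b (\<lambda>x. blinfun_apply (A x) i) a"
  shows "loc_reg b A a"
proof -
  have "loc_reg b (\<lambda>x. \<Sum>i\<in>Basis. column_op i (blinfun_apply (A x) i)) a"
    by (intro loc_reg_sum loc_reg_compose[OF assms loc_reg_linear] bounded_linear_column_op)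
  then show ?thesis by (simp flip: blinfun_eq_sum_column_op)
qed

section \<open>Closure properties of continuously differentiable maps\<close>

lemma C1_nearE:
  assumes "C1_near b \<phi> a"
  obtains \<phi>' where "\<forall>\<^sub>F x in nhds a. (\<phi> has_derivative blinfun_apply (\<phi>' x)) (at x)"
    and "loc_reg b \<phi>' a"
  using assms unfolding C1_near_def by auto

text \<open>Mean value inequality on a ball where the derivative has norm at most one more than at
  the centre. As a consequence, the inner map of a chain rule never obstructs the Lipschitz flag of
  the derivative.\<close>

lemma C1_near_imp_lipschitz:
  assumes "C1_near b \<phi> a"
  shows "loc_reg True \<phi> a"
proof -
  obtain \<phi>' where d: "\<forall>\<^sub>F x in nhds a. (\<phi> has_derivative blinfun_apply (\<phi>' x)) (at x)"
    and r: "loc_reg b \<phi>' a"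
    using assms by (rule C1_nearE)
  have "(\<phi>' \<longlongrightarrow> \<phi>' a) (nhds a)"
    using loc_reg_isCont[OF r] by (simp add: isCont_def tendsto_at_iff_tendsto_nhds)
  then have "\<forall>\<^sub>F x in nhds a. dist (\<phi>' x) (\<phi>' a) < 1"
    by (rule tendstoD) simp
  with d have "\<forall>\<^sub>F x in nhds a. (\<phi> has_derivative blinfun_apply (\<phi>' x)) (at x) \<and> norm (\<phi>' x) \<le> norm (\<phi>' a) + 1"
  proof eventually_elim
    case (elim x)
    then show ?case using norm_triangle_ineq2[of "\<phi>' x" "\<phi>' a"] by (simp add: dist_norm)
  qed
  then obtain e where e: "e > 0"
    "\<And>x. x \<in> ball a e \<Longrightarrow> (\<phi> has_derivative blinfun_apply (\<phi>' x)) (at x) \<and> norm (\<phi>' x) \<le> norm (\<phi>' a) + 1"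
    unfolding eventually_nhds_metric by (auto simp: dist_commute)
  have "(norm (\<phi>' a) + 1)-lipschitz_on (ball a e) \<phi>"
  proof (rule lipschitz_onI)
    fix x y assume "x \<in> ball a e" "y \<in> ball a e"
    then show "dist (\<phi> x) (\<phi> y) \<le> (norm (\<phi>' a) + 1) * dist x y"
      unfolding dist_norm
      using e(2) by (intro differentiable_bound[of "ball a e" \<phi> "\<lambda>x. blinfun_apply (\<phi>' x)"])
        (auto intro: has_derivative_at_withinI simp: norm_blinfun.rep_eq[symmetric])
  qed simp
  then show ?thesis using e(1) by (intro loc_regI_lipschitz[of "ball a e"]) auto
qed

lemma C1_near_reg: "C1_near b \<phi> a \<Longrightarrow> loc_reg c \<phi> a"
  using C1_near_imp_lipschitz loc_reg_True_imp by blast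

lemma C1_near_True_imp: "C1_near True \<phi> a \<Longrightarrow> C1_near b \<phi> a"
  unfolding C1_near_def using loc_reg_True_imp by blast

lemma C1_near_imp_False: "C1_near b \<phi> a \<Longrightarrow> C1_near False \<phi> a"
  unfolding C1_near_def using loc_reg_imp_False by blast

lemma C1_near_isCont: "C1_near b \<phi> a \<Longrightarrow> isCont \<phi> a"
  using C1_near_reg loc_reg_isCont by blast

lemma C1_near_tendsto: "C1_near b \<phi> a \<Longrightarrow> (\<phi> \<longlongrightarrow> \<phi> a) (nhds a)"
  using C1_near_isCont by (simp add: isCont_def tendsto_at_iff_tendsto_nhds)

lemma C1_near_differentiable: "C1_near b \<phi> a \<Longrightarrow> \<phi> differentiable (at a)"
  unfolding C1_near_def differentiable_def by (metis eventually_nhds_x_imp_x)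

lemma C1_near_cong:
  assumes "C1_near b \<phi> a" "\<forall>\<^sub>F x in nhds a. \<phi> x = \<kappa> x"
  shows "C1_near b \<kappa> a"
proof -
  obtain \<phi>' where d: "\<forall>\<^sub>F x in nhds a. (\<phi> has_derivative blinfun_apply (\<phi>' x)) (at x)"
    and r: "loc_reg b \<phi>' a"
    using assms(1) by (rule C1_nearE)
  have "\<forall>\<^sub>F x in nhds a. \<forall>\<^sub>F y in nhds x. \<phi> y = \<kappa> y"
    using assms(2) by (simp add: eventually_eventually)
  with d have "\<forall>\<^sub>F x in nhds a. (\<kappa> has_derivative blinfun_apply (\<phi>' x)) (at x)"
  proof eventually_elim
    case (elim x)
    have "\<forall>\<^sub>F y in at x. \<phi> y = \<kappa> y"
      using elim(2) by (auto simp: eventually_at_filter elim: eventually_mono)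
    from has_derivative_transform_eventually[OF elim(1) this] eventually_nhds_x_imp_x[OF elim(2)]
    show ?case by simp
  qed
  with r show ?thesis unfolding C1_near_def by blast
qed

lemma C1_near_eventually:
  assumes "C1_near b \<phi> a"
  shows "\<forall>\<^sub>F x in nhds a. C1_near b \<phi> x"
proof -
  obtain \<phi>' where d: "\<forall>\<^sub>F x in nhds a. (\<phi> has_derivative blinfun_apply (\<phi>' x)) (at x)"
    and r: "loc_reg b \<phi>' a"
    using assms by (rule C1_nearE)
  obtain S where S: "open S" "a \<in> S" "continuous_on S \<phi>'" "b \<longrightarrow> (\<exists>C. C-lipschitz_on S \<phi>')"
    using r unfolding loc_reg_def by auto
  have "\<forall>\<^sub>F x in nhds a. x \<in> S" using S by (simp add: eventually_nhds_in_open)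
  moreover have "\<forall>\<^sub>F x in nhds a. \<forall>\<^sub>F y in nhds x. (\<phi> has_derivative blinfun_apply (\<phi>' y)) (at y)"
    using d by (simp add: eventually_eventually)
  ultimately show ?thesis
  proof eventually_elim
    case (elim x)
    then show ?case unfolding C1_near_def loc_reg_def using S by blast
  qed
qed

lemma C1_near_linear:
  assumes "bounded_linear \<phi>"
  shows "C1_near b \<phi> a"
  unfolding C1_near_def
  by (rule exI[of _ "\<lambda>x. Blinfun \<phi>"])
     (use assms in \<open>auto simp: bounded_linear_Blinfun_apply bounded_linear_imp_has_derivative loc_reg_const\<close>)

lemma C1_near_const: "C1_near b (\<lambda>x. c) a"
  unfolding C1_near_def
  by (rule exI[of _ "\<lambda>x. 0"]) (auto simp: loc_reg_const zero_blinfun.rep_eq[abs_def])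

lemma C1_near_compose:
  assumes "C1_near b \<phi> a" "C1_near b \<kappa> (\<phi> a)"
  shows "C1_near b (\<lambda>x. \<kappa> (\<phi> x)) a"
proof -
  obtain \<phi>' where d: "\<forall>\<^sub>F x in nhds a. (\<phi> has_derivative blinfun_apply (\<phi>' x)) (at x)"
    and r: "loc_reg b \<phi>' a"
    using assms(1) by (rule C1_nearE)
  obtain \<kappa>' where d': "\<forall>\<^sub>F x in nhds (\<phi> a). (\<kappa> has_derivative blinfun_apply (\<kappa>' x)) (at x)"
    and r': "loc_reg b \<kappa>' (\<phi> a)"
    using assms(2) by (rule C1_nearE)
  have "\<forall>\<^sub>F x in nhds a. (\<kappa> has_derivative blinfun_apply (\<kappa>' (\<phi> x))) (at (\<phi> x))"
    using C1_near_tendsto[OF assms(1)] d' unfolding filterlim_iff by blast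
  with d have "\<forall>\<^sub>F x in nhds a. ((\<lambda>x. \<kappa> (\<phi> x)) has_derivative blinfun_apply (\<kappa>' (\<phi> x) o\<^sub>L \<phi>' x)) (at x)"
  proof eventually_elim
    case (elim x)
    show ?case using has_derivative_compose[OF elim(1) elim(2)] by (simp add: o_def blinfun_compose.rep_eq)
  qed
  moreover have "loc_reg b (\<lambda>x. \<kappa>' (\<phi> x) o\<^sub>L \<phi>' x) a"
    by (rule loc_reg_bilinear[OF bounded_bilinear_blinfun_compose loc_reg_compose[OF C1_near_reg[OF assms(1)] r'] r])
  ultimately show ?thesis unfolding C1_near_def by (intro exI[of _ "\<lambda>x. \<kappa>' (\<phi> x) o\<^sub>L \<phi>' x"]) simp
qed

definition pair_op :: "('a::real_normed_vector \<Rightarrow>\<^sub>L 'b::real_normed_vector) \<Rightarrow> ('a \<Rightarrow>\<^sub>L 'c::real_normed_vector) \<Rightarrow> 'a \<Rightarrow>\<^sub>L ('b \<times> 'c)" where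
  "pair_op A B = Blinfun (\<lambda>v. (blinfun_apply A v, blinfun_apply B v))"

lemma pair_op_apply [simp]: "blinfun_apply (pair_op A B) v = (blinfun_apply A v, blinfun_apply B v)"
  unfolding pair_op_def
  by (subst bounded_linear_Blinfun_apply) (auto intro!: bounded_linear_Pair blinfun.bounded_linear_right)

lemma bounded_linear_pair_op: "bounded_linear (\<lambda>(A, B). pair_op A B)"
proof (rule bounded_linear_intro)
  fix X Y :: "('a \<Rightarrow>\<^sub>L 'b) \<times> ('a \<Rightarrow>\<^sub>L 'c)" and r :: real
  show "(case X + Y of (A, B) \<Rightarrow> pair_op A B) = (case X of (A, B) \<Rightarrow> pair_op A B) + (case Y of (A, B) \<Rightarrow> pair_op A B)"
    by (auto simp: split_beta blinfun.add_left intro!: blinfun_eqI)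
  show "(case r *\<^sub>R X of (A, B) \<Rightarrow> pair_op A B) = r *\<^sub>R (case X of (A, B) \<Rightarrow> pair_op A B)"
    by (auto simp: split_beta blinfun.scaleR_left intro!: blinfun_eqI)
  show "norm (case X of (A, B) \<Rightarrow> pair_op A B) \<le> norm X * 2"
  proof (clarsimp simp: split_beta, rule norm_blinfun_bound)
    fix v
    have "norm (blinfun_apply (fst X) v, blinfun_apply (snd X) v) \<le> norm (blinfun_apply (fst X) v) + norm (blinfun_apply (snd X) v)"
      by (rule norm_Pair_le)
    also have "\<dots> \<le> norm (fst X) * norm v + norm (snd X) * norm v"
      by (intro add_mono norm_blinfun)
    also have "\<dots> \<le> norm X * norm v + norm X * norm v"
      using norm_fst_le[of "fst X" "snd X"] norm_snd_le[of "snd X" "fst X"]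
      by (intro add_mono mult_right_mono) auto
    finally show "norm (blinfun_apply (pair_op (fst X) (snd X)) v) \<le> norm X * 2 * norm v"
      by (simp add: algebra_simps)
  qed simp
qed

lemma loc_reg_pair_op:
  assumes "loc_reg b A a" "loc_reg b B a"
  shows "loc_reg b (\<lambda>x. pair_op (A x) (B x)) a"
  using loc_reg_compose[OF loc_reg_Pair[OF assms] loc_reg_linear[OF bounded_linear_pair_op]] by simp

lemma C1_near_Pair:
  assumes "C1_near b \<phi> a" "C1_near b \<kappa> a"
  shows "C1_near b (\<lambda>x. (\<phi> x, \<kappa> x)) a"
proof -
  obtain \<phi>' where d: "\<forall>\<^sub>F x in nhds a. (\<phi> has_derivative blinfun_apply (\<phi>' x)) (at x)"
    and r: "loc_reg b \<phi>' a"
    using assms(1) by (rule C1_nearE)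
  obtain \<kappa>' where d': "\<forall>\<^sub>F x in nhds a. (\<kappa> has_derivative blinfun_apply (\<kappa>' x)) (at x)"
    and r': "loc_reg b \<kappa>' a"
    using assms(2) by (rule C1_nearE)
  have "\<forall>\<^sub>F x in nhds a. ((\<lambda>x. (\<phi> x, \<kappa> x)) has_derivative blinfun_apply (pair_op (\<phi>' x) (\<kappa>' x))) (at x)"
    using d d' by eventually_elim (auto intro!: has_derivative_Pair simp: pair_op_apply[abs_def])
  then show ?thesis unfolding C1_near_def using loc_reg_pair_op[OF r r'] by (intro exI[of _ "\<lambda>x. pair_op (\<phi>' x) (\<kappa>' x)"]) simp
qed

text \<open>The derivative of a bilinear map at (x, y) is itself linear in (x, y), hence regular for
  either flag.\<close>

lemma C1_near_bilinear_map:
  assumes "bounded_bilinear m"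
  shows "C1_near b (\<lambda>(x, y). m x y) p"
proof -
  interpret bounded_bilinear m by fact
  define D where "D = (\<lambda>p. (prod_left (snd p) o\<^sub>L fst_blinfun) + (prod_right (fst p) o\<^sub>L snd_blinfun))"
  have "((\<lambda>(x, y). m x y) has_derivative blinfun_apply (D q)) (at q)" for q
  proof -
    have "((\<lambda>p. m (fst p) (snd p)) has_derivative (\<lambda>h. m (fst q) (snd h) + m (fst h) (snd q))) (at q)"
      by (rule FDERIV[of fst fst q UNIV snd snd])
         (auto intro: bounded_linear_imp_has_derivative bounded_linear_fst bounded_linear_snd)
    then show ?thesis
      by (simp add: D_def case_prod_beta' plus_blinfun.rep_eq blinfun_compose.rep_eq prod_left.rep_eq prod_right.rep_eq o_def add.commute)
  qed
  moreover have "loc_reg b D p"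
    unfolding D_def
    by (intro loc_reg_linear bounded_linear_add
        bounded_linear_compose[OF bounded_bilinear.bounded_linear_left[OF bounded_bilinear_blinfun_compose]]
        bounded_linear_compose[OF bounded_linear_prod_left] bounded_linear_compose[OF bounded_linear_prod_right]
        bounded_linear_fst bounded_linear_snd)
  ultimately show ?thesis unfolding C1_near_def by (intro exI[of _ D]) auto
qed

lemma C1_near_bilinear:
  assumes "bounded_bilinear m" "C1_near b \<phi> a" "C1_near b \<kappa> a"
  shows "C1_near b (\<lambda>x. m (\<phi> x) (\<kappa> x)) a"
  using C1_near_compose[OF C1_near_Pair[OF assms(2,3)] C1_near_bilinear_map[OF assms(1)]] by simp

lemma C1_near_lin_compose:
  assumes "bounded_linear h" "C1_near b \<phi> a"
  shows "C1_near b (\<lambda>x. h (\<phi> x)) a"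
  by (rule C1_near_compose[OF assms(2) C1_near_linear[OF assms(1)]])

lemma C1_near_add:
  assumes "C1_near b \<phi> a" "C1_near b \<kappa> a"
  shows "C1_near b (\<lambda>x. \<phi> x + \<kappa> x) a"
proof -
  have "bounded_linear (\<lambda>p::'b \<times> 'b. fst p + snd p)" by (intro bounded_linear_intros)
  from C1_near_lin_compose[OF this C1_near_Pair[OF assms]] show ?thesis by simp
qed

lemma C1_near_diff:
  assumes "C1_near b \<phi> a" "C1_near b \<kappa> a"
  shows "C1_near b (\<lambda>x. \<phi> x - \<kappa> x) a"
proof -
  have "bounded_linear (\<lambda>p::'b \<times> 'b. fst p - snd p)" by (intro bounded_linear_intros)
  from C1_near_lin_compose[OF this C1_near_Pair[OF assms]] show ?thesis by simp
qed

lemma C1_near_sum: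
  assumes "\<And>i. i \<in> I \<Longrightarrow> C1_near b (h i) a"
  shows "C1_near b (\<lambda>x. \<Sum>i\<in>I. h i x) a"
  using assms
proof (induction I rule: infinite_finite_induct)
  case (insert i I)
  then show ?case using C1_near_add[of b "h i" a "\<lambda>x. \<Sum>i\<in>I. h i x"] by simp
qed (auto intro: C1_near_const)

lemma C1_near_blinfun:
  fixes A :: "'c::real_normed_vector \<Rightarrow> 'a::euclidean_space \<Rightarrow>\<^sub>L 'b::real_normed_vector"
  assumes "\<And>i. i \<in> Basis \<Longrightarrow> C1_near b (\<lambda>x. blinfun_apply (A x) i) a"
  shows "C1_near b A a"
proof -
  have "C1_near b (\<lambda>x. \<Sum>i\<in>Basis. column_op i (blinfun_apply (A x) i)) a"
    by (intro C1_near_sum C1_near_lin_compose[OF bounded_linear_column_op] assms)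
  then show ?thesis by (simp flip: blinfun_eq_sum_column_op)
qed

section \<open>Classes C^k\<close>

lemma has_derivative_deriv_op:
  assumes "\<phi> differentiable (at a)"
  shows "(\<phi> has_derivative blinfun_apply (deriv_op \<phi> a)) (at a)"
proof -
  have "(\<phi> has_derivative frechet_derivative \<phi> (at a)) (at a)"
    using assms frechet_derivative_works by blast
  then show ?thesis
    unfolding deriv_op_def using has_derivative_bounded_linear bounded_linear_Blinfun_apply by metis
qed

lemma deriv_op_eq_frechet:
  assumes "\<phi> differentiable (at a)"
  shows "blinfun_apply (deriv_op \<phi> a) = frechet_derivative \<phi> (at a)"
  by (rule frechet_derivative_at[OF has_derivative_deriv_op[OF assms]])

lemma deriv_op_eqI:
  assumes "(\<phi> has_derivative blinfun_apply A) (at a)"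
  shows "deriv_op \<phi> a = A"
  using assms unfolding deriv_op_def
  by (metis blinfun_apply_inverse frechet_derivative_at)

lemma deriv_op_apply:
  assumes "(\<phi> has_derivative D) (at a)"
  shows "blinfun_apply (deriv_op \<phi> a) = D"
  using bounded_linear_Blinfun_apply[OF has_derivative_bounded_linear[OF assms]]
    frechet_derivative_at[OF assms] by (simp add: deriv_op_def)

lemma C1_near_deriv_op:
  fixes \<phi> :: "'a::euclidean_space \<Rightarrow> 'b::euclidean_space"
  assumes "C1_near b \<phi> a"
  shows "\<forall>\<^sub>F x in nhds a. (\<phi> has_derivative blinfun_apply (deriv_op \<phi> x)) (at x)"
    and "loc_reg b (deriv_op \<phi>) a"
proof -
  obtain \<phi>' where d: "\<forall>\<^sub>F x in nhds a. (\<phi> has_derivative blinfun_apply (\<phi>' x)) (at x)"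
    and r: "loc_reg b \<phi>' a"
    using assms by (rule C1_nearE)
  have e: "\<forall>\<^sub>F x in nhds a. \<phi>' x = deriv_op \<phi> x"
    using d by eventually_elim (simp add: deriv_op_eqI)
  from d e show "\<forall>\<^sub>F x in nhds a. (\<phi> has_derivative blinfun_apply (deriv_op \<phi> x)) (at x)"
    by eventually_elim simp
  show "loc_reg b (deriv_op \<phi>) a" by (rule loc_reg_cong[OF r e])
qed

lemma Ck_on_Suc_imp: "Ck_on (Suc k) \<phi> S \<Longrightarrow> Ck_on k \<phi> S"
proof (induction k arbitrary: \<phi>)
  case 0
  then show ?case
    by (auto intro!: continuous_at_imp_continuous_on differentiable_imp_continuous_within)
next
  case (Suc k)
  have 1: "\<forall>a\<in>S. \<phi> differentiable (at a)"
    and 2: "\<And>v. Ck_on (Suc k) (\<lambda>a. frechet_derivative \<phi> (at a) v) S"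
    using Suc.prems by (auto simp only: Ck_on.simps)
  show ?case using 1 Suc.IH[OF 2] by simp
qed

text \<open>\<open>Ck_on\<close> controls one directional derivative at a time; operator-norm
  continuity of the full derivative follows column by column.\<close>

lemma Ck_on_1_imp_C1_near:
  assumes "Ck_on 1 \<phi> S" "open S" "a \<in> S"
  shows "C1_near False \<phi> a"
proof -
  have 1: "\<forall>a\<in>S. \<phi> differentiable (at a)"
    and 2: "\<And>v. continuous_on S (\<lambda>a. frechet_derivative \<phi> (at a) v)"
    using assms(1) by simp_all
  have d: "(\<phi> has_derivative blinfun_apply (deriv_op \<phi> x)) (at x)" if "x \<in> S" for x
    using 1 that by (simp add: has_derivative_deriv_op)
  have "loc_reg False (\<lambda>x. frechet_derivative \<phi> (at x) i) a" for i
    unfolding loc_reg_def using 2 assms by auto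
  then have "loc_reg False (\<lambda>x. blinfun_apply (deriv_op \<phi> x) i) a" for i
    by (rule loc_reg_cong)
       (use eventually_nhds_in_open[OF assms(2,3)] in eventually_elim, simp add: 1 deriv_op_eq_frechet)
  then have "loc_reg False (deriv_op \<phi>) a" by (rule loc_reg_blinfun)
  moreover have "\<forall>\<^sub>F x in nhds a. (\<phi> has_derivative blinfun_apply (deriv_op \<phi> x)) (at x)"
    using eventually_nhds_in_open[OF assms(2,3)] by eventually_elim (rule d)
  ultimately show ?thesis unfolding C1_near_def by blast
qed

text \<open>The second conclusion follows from the first: a derivative of class C^1 is locally
  Lipschitz.\<close>

lemma Ck_on_2_imp_C1_near_deriv_op:
  assumes "Ck_on 2 \<phi> S" "open S" "a \<in> S"
  shows "C1_near False (deriv_op \<phi>) a" and "C1_near True \<phi> a"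
proof -
  have 0: "Ck_on (Suc 1) \<phi> S" using assms(1) by (simp add: numeral_2_eq_2)
  have 1: "\<forall>a\<in>S. \<phi> differentiable (at a)"
    and 2: "\<And>v. Ck_on 1 (\<lambda>a. frechet_derivative \<phi> (at a) v) S"
    using 0 by (auto simp only: Ck_on.simps)
  have d: "(\<phi> has_derivative blinfun_apply (deriv_op \<phi> x)) (at x)" if "x \<in> S" for x
    using 1 that by (simp add: has_derivative_deriv_op)
  have "C1_near False (\<lambda>x. blinfun_apply (deriv_op \<phi> x) i) a" for i
    by (rule C1_near_cong[OF Ck_on_1_imp_C1_near[OF 2 assms(2,3), of i]])
       (use eventually_nhds_in_open[OF assms(2,3)] in eventually_elim, simp add: 1 deriv_op_eq_frechet)
  then show 3: "C1_near False (deriv_op \<phi>) a" by (rule C1_near_blinfun)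
  have "\<forall>\<^sub>F x in nhds a. (\<phi> has_derivative blinfun_apply (deriv_op \<phi> x)) (at x)"
    using eventually_nhds_in_open[OF assms(2,3)] by eventually_elim (rule d)
  with C1_near_imp_lipschitz[OF 3] show "C1_near True \<phi> a" unfolding C1_near_def by blast
qed

lemma Ck_on_3_imp_C1_near_deriv_op:
  assumes "Ck_on 3 \<phi> S" "open S" "a \<in> S"
  shows "C1_near True (deriv_op \<phi>) a"
proof -
  have 0: "Ck_on (Suc 2) \<phi> S" using assms(1) by (simp add: numeral_3_eq_3 numeral_2_eq_2)
  have 1: "\<forall>a\<in>S. \<phi> differentiable (at a)"
    and 2: "\<And>v. Ck_on 2 (\<lambda>a. frechet_derivative \<phi> (at a) v) S"
    using 0 by (auto simp only: Ck_on.simps)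
  have d: "(\<phi> has_derivative blinfun_apply (deriv_op \<phi> x)) (at x)" if "x \<in> S" for x
    using 1 that by (simp add: has_derivative_deriv_op)
  have "C1_near True (\<lambda>x. blinfun_apply (deriv_op \<phi> x) i) a" for i
    by (rule C1_near_cong[OF Ck_on_2_imp_C1_near_deriv_op(2)[OF 2 assms(2,3), of i]])
       (use eventually_nhds_in_open[OF assms(2,3)] in eventually_elim, simp add: 1 deriv_op_eq_frechet)
  then show "C1_near True (deriv_op \<phi>) a" by (rule C1_near_blinfun)
qed


section \<open>The implicit function theorem\<close>

definition op_inv :: "('a::euclidean_space \<Rightarrow>\<^sub>L 'a) \<Rightarrow> 'a \<Rightarrow>\<^sub>L 'a" where
  "op_inv A = Blinfun (inv (blinfun_apply A))"

lemma op_inv_apply: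
  assumes "bij (blinfun_apply A)"
  shows "blinfun_apply (op_inv A) = inv (blinfun_apply A)"
  unfolding op_inv_def
  by (rule bounded_linear_Blinfun_apply)
     (use assms in \<open>simp add: inj_linear_imp_inv_bounded_linear bij_is_inj
        blinfun.bounded_linear_right\<close>)

lemma op_inv_left [simp]: "bij (blinfun_apply A) \<Longrightarrow> blinfun_apply (op_inv A) (blinfun_apply A v) = v"
  by (simp add: op_inv_apply bij_is_inj)

lemma op_inv_right [simp]: "bij (blinfun_apply A) \<Longrightarrow> blinfun_apply A (blinfun_apply (op_inv A) v) = v"
  by (simp add: op_inv_apply bij_is_surj surj_f_inv_f)

lemma blinfun_bijI:
  fixes A :: "'a::euclidean_space \<Rightarrow>\<^sub>L 'a"
  assumes "\<And>v. blinfun_apply A v = 0 \<Longrightarrow> v = 0"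
  shows "bij (blinfun_apply A)"
proof -
  have l: "linear (blinfun_apply A)"
    by (simp add: blinfun.bounded_linear_right bounded_linear.linear)
  then have "inj (blinfun_apply A)"
    using assms by (simp add: linear_injective_0)
  with l show ?thesis
    by (simp add: bij_def linear_injective_imp_surjective)
qed

text \<open>Within distance 1/(2K) of \<open>A0\<close> the lower bound |v| <= 2K |A v| survives the
  perturbation. The identity A^-1 - B^-1 = A^-1 (B - A) B^-1 then gives the Lipschitz constant 4
  K^2.\<close>

lemma loc_reg_op_inv:
  assumes A0: "bij (blinfun_apply A0)"
  shows "loc_reg b op_inv A0"
proof -
  define K where "K = norm (op_inv A0) + 1"
  have K: "K > 0" unfolding K_def by (simp add: add_nonneg_pos)
  define r where "r = 1 / (2 * K)"
  have r: "r > 0" using K by (simp add: r_def)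
  have low: "norm v \<le> 2 * K * norm (blinfun_apply A v)" if A: "A \<in> ball A0 r" for A v
  proof -
    have "norm v \<le> norm (op_inv A0) * norm (blinfun_apply A0 v)"
      using norm_blinfun[of "op_inv A0" "blinfun_apply A0 v"] A0 by simp
    also have "\<dots> \<le> K * norm (blinfun_apply A0 v)"
      unfolding K_def by (intro mult_right_mono) auto
    also have "norm (blinfun_apply A0 v) \<le> norm (blinfun_apply A v) + norm (blinfun_apply (A0 - A) v)"
      using norm_triangle_ineq[of "blinfun_apply A v" "blinfun_apply (A0 - A) v"]
      by (simp add: blinfun.diff_left)
    also have "norm (blinfun_apply (A0 - A) v) \<le> r * norm v"
      using A by (intro order_trans[OF norm_blinfun] mult_right_mono) (auto simp: dist_norm)
    finally have "norm v \<le> K * norm (blinfun_apply A v) + K * r * norm v"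
      using K by (simp add: algebra_simps)
    moreover have "K * r = 1 / 2" using K by (simp add: r_def)
    ultimately show ?thesis by simp
  qed
  have bij: "bij (blinfun_apply A)" if "A \<in> ball A0 r" for A
  proof (rule blinfun_bijI)
    fix v assume "blinfun_apply A v = 0"
    then show "v = 0" using low[OF that, of v] by simp
  qed
  have bound: "norm (blinfun_apply (op_inv A) w) \<le> 2 * K * norm w" if "A \<in> ball A0 r" for A w
    using low[OF that, of "blinfun_apply (op_inv A) w"] bij[OF that] by simp
  have "(4 * K * K)-lipschitz_on (ball A0 r) op_inv"
  proof (rule lipschitz_onI)
    fix A B assume AB: "A \<in> ball A0 r" "B \<in> ball A0 r"
    have "norm (blinfun_apply (op_inv A - op_inv B) w) \<le> 4 * K * K * norm (A - B) * norm w" for w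
    proof -
      let ?z = "blinfun_apply (op_inv B) w"
      have "blinfun_apply (op_inv A - op_inv B) w = blinfun_apply (op_inv A) (blinfun_apply (B - A) ?z)"
        using bij[OF AB(1)] bij[OF AB(2)] by (simp add: blinfun.diff_left blinfun.diff_right)
      then have "norm (blinfun_apply (op_inv A - op_inv B) w) \<le> 2 * K * norm (blinfun_apply (B - A) ?z)"
        using bound[OF AB(1)] by simp
      also have "\<dots> \<le> 2 * K * (norm (B - A) * (2 * K * norm w))"
        using K by (intro mult_left_mono order_trans[OF norm_blinfun[of "B - A"]] bound[OF AB(2)]) auto
      finally show ?thesis by (simp add: norm_minus_commute algebra_simps)
    qed
    then show "dist (op_inv A) (op_inv B) \<le> 4 * K * K * dist A B"
      unfolding dist_norm using K by (intro norm_blinfun_bound) auto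
  qed (use K in auto)
  then show ?thesis by (intro loc_regI_lipschitz[of "ball A0 r"]) (use r in auto)
qed

text \<open>Inverse function theorem for (s, p) |-> (H (s, p), p), whose derivative at the base
  point is injective exactly when the s-part of the derivative of \<open>H\<close> is.
  \<open>inj\<close> quantifies over all derivatives, so a caller need not exhibit one.\<close>

theorem implicit_function:
  fixes H :: "'s::euclidean_space \<times> 'p::euclidean_space \<Rightarrow> 's"
  assumes H: "C1_near b H (s0, p0)" and H0: "H (s0, p0) = 0"
    and inj: "\<And>D v. (H has_derivative D) (at (s0, p0)) \<Longrightarrow> D (v, 0) = 0 \<Longrightarrow> v = 0"
  obtains \<sigma> where "C1_near b \<sigma> p0" "\<sigma> p0 = s0"
    "\<forall>\<^sub>F p in nhds p0. H (\<sigma> p, p) = 0"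
proof -
  obtain H' where d: "\<forall>\<^sub>F x in nhds (s0, p0). (H has_derivative blinfun_apply (H' x)) (at x)"
    and r: "loc_reg b H' (s0, p0)"
    using H by (rule C1_nearE)
  obtain S where S: "open S" "(s0, p0) \<in> S" "continuous_on S H'" "b \<longrightarrow> (\<exists>C. C-lipschitz_on S H')"
    using r unfolding loc_reg_def by auto
  obtain T where T: "open T" "(s0, p0) \<in> T" "\<And>x. x \<in> T \<Longrightarrow> (H has_derivative blinfun_apply (H' x)) (at x)"
    using d unfolding eventually_nhds by blast
  define K where "K = (\<lambda>q. (H q, snd q))"
  define K' where "K' = (\<lambda>q. pair_op (H' q) snd_blinfun)"
  have K': "(K has_derivative blinfun_apply (K' q)) (at q)" if "q \<in> S \<inter> T" for q
    unfolding K_def K'_def using T(3)[of q] that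
    by (auto intro!: has_derivative_Pair bounded_linear_imp_has_derivative bounded_linear_snd
        simp: pair_op_apply[abs_def])
  have rK': "loc_reg b K' (s0, p0)"
    unfolding K'_def by (intro loc_reg_pair_op r loc_reg_const)
  have "continuous_on (S \<inter> T) (\<lambda>q. (H' q, snd_blinfun))"
    using continuous_on_subset[OF S(3), of "S \<inter> T"] by (intro continuous_on_Pair) auto
  then have contK': "continuous_on (S \<inter> T) K'"
    unfolding K'_def
    using continuous_on_compose2[OF linear_continuous_on[OF bounded_linear_pair_op],
        of "S \<inter> T" "\<lambda>q. (H' q, snd_blinfun)" UNIV]
    by auto
  have bij0: "bij (blinfun_apply (K' (s0, p0)))"
  proof (rule blinfun_bijI)
    fix v assume "blinfun_apply (K' (s0, p0)) v = 0"
    then have "blinfun_apply (H' (s0, p0)) v = 0" "snd v = 0"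
      unfolding K'_def by (auto simp: zero_prod_def)
    then show "v = 0"
      using inj[OF T(3)[OF T(2)], of "fst v"] by (metis prod.collapse zero_prod_def)
  qed
  have inv0: "op_inv (K' (s0, p0)) o\<^sub>L K' (s0, p0) = id_blinfun"
    using bij0 by (auto intro!: blinfun_eqI)
  obtain U' V \<kappa> \<kappa>' where U: "open U'" "U' \<subseteq> S \<inter> T" "(s0, p0) \<in> U'" and V: "open V" "K (s0, p0) \<in> V"
    and hom: "homeomorphism U' V K \<kappa>"
    and \<kappa>: "\<And>y. y \<in> V \<Longrightarrow> (\<kappa> has_derivative \<kappa>' y) (at y)"
      "\<And>y. y \<in> V \<Longrightarrow> \<kappa>' y = inv (blinfun_apply (K' (\<kappa> y)))"
      "\<And>y. y \<in> V \<Longrightarrow> bij (blinfun_apply (K' (\<kappa> y)))"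
    by (rule inverse_function_theorem[OF _ K' contK' _ inv0]) (use S T in auto)
  have V0: "(0, p0) \<in> V" using V(2) H0 by (simp add: K_def)
  have \<kappa>0: "\<kappa> (0, p0) = (s0, p0)"
    using homeomorphism_apply1[OF hom U(3)] H0 by (simp add: K_def)
  have \<kappa>d: "(\<kappa> has_derivative blinfun_apply (op_inv (K' (\<kappa> y)))) (at y)" if "y \<in> V" for y
    using \<kappa>[OF that] by (simp add: op_inv_apply)
  have ev: "\<forall>\<^sub>F y in nhds (0, p0). (\<kappa> has_derivative blinfun_apply (op_inv (K' (\<kappa> y)))) (at y)"
    using eventually_nhds_in_open[OF V(1) V0] by eventually_elim (rule \<kappa>d)
  have reg: "loc_reg c (\<lambda>y. op_inv (K' (\<kappa> y))) (0, p0)" if "loc_reg c \<kappa> (0, p0)" "loc_reg c K' (s0, p0)" for c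
  proof (rule loc_reg_compose[of c _ _ op_inv])
    show "loc_reg c (\<lambda>y. K' (\<kappa> y)) (0, p0)"
      by (rule loc_reg_compose[OF that(1)]) (simp add: \<kappa>0 that(2))
    show "loc_reg c op_inv (K' (\<kappa> (0, p0)))"
      by (rule loc_reg_op_inv) (simp add: \<kappa>0 bij0)
  qed
  \<comment> \<open>Bootstrapping: continuity of \<kappa> makes its derivative
    \<open>op_inv (K' (\<kappa> y))\<close> continuous, so \<kappa> is C^1 and hence Lipschitz;
    inserted into the same formula, this gives the derivative the flag \<open>b\<close>.\<close>
  have "loc_reg False \<kappa> (0, p0)"
    unfolding loc_reg_def using V(1) V0 homeomorphism_cont2[OF hom] by auto
  then have "C1_near False \<kappa> (0, p0)"
    unfolding C1_near_def using ev reg[OF _ loc_reg_imp_False[OF rK']]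
    by (intro exI[of _ "\<lambda>y. op_inv (K' (\<kappa> y))"]) simp
  then have "loc_reg b \<kappa> (0, p0)" by (rule C1_near_reg)
  then have \<kappa>C: "C1_near b \<kappa> (0, p0)"
    unfolding C1_near_def using ev reg[OF _ rK']
    by (intro exI[of _ "\<lambda>y. op_inv (K' (\<kappa> y))"]) simp
  define \<sigma> where "\<sigma> = (\<lambda>p. fst (\<kappa> (0, p)))"
  have "C1_near b \<sigma> p0"
    unfolding \<sigma>_def
    by (rule C1_near_lin_compose[OF bounded_linear_fst], rule C1_near_compose[where \<phi> = "\<lambda>p. (0, p)"])
       (intro C1_near_linear bounded_linear_Pair bounded_linear_zero bounded_linear_ident, rule \<kappa>C)
  moreover have "\<sigma> p0 = s0" by (simp add: \<sigma>_def \<kappa>0)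
  moreover have "\<forall>\<^sub>F p in nhds p0. H (\<sigma> p, p) = 0"
  proof -
    have "((\<lambda>p. (0, p)) \<longlongrightarrow> (0, p0)) (nhds p0)"
      by (intro tendsto_Pair tendsto_const) (simp add: filterlim_ident)
    then have "\<forall>\<^sub>F p in nhds p0. (0, p) \<in> V"
      using V(1) V0 by (rule topological_tendstoD)
    then show ?thesis
    proof eventually_elim
      case (elim p)
      from homeomorphism_apply2[OF hom elim] have k: "H (\<kappa> (0, p)) = 0" "snd (\<kappa> (0, p)) = p"
        by (auto simp: K_def)
      then have "\<kappa> (0, p) = (\<sigma> p, p)" by (metis \<sigma>_def prod.collapse)
      with k show ?case by simp
    qed
  qed
  ultimately show thesis by (rule that)
qed

section \<open>Powers of an operator and its complex eigenvalues\<close>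

(* Pairs (v, w) stand for v + i w in the complexification. *)
definition cscale :: "complex \<Rightarrow> 'a::real_inner \<times> 'a \<Rightarrow> 'a \<times> 'a" where
  "cscale c x = (Re c *\<^sub>R fst x - Im c *\<^sub>R snd x, Im c *\<^sub>R fst x + Re c *\<^sub>R snd x)"

definition cmap :: "('a::real_inner \<Rightarrow> 'a) \<Rightarrow> 'a \<times> 'a \<Rightarrow> 'a \<times> 'a" where
  "cmap T x = (T (fst x), T (snd x))"

lemma complex_eigenvalue_iff: "complex_eigenvalue T c \<longleftrightarrow> (\<exists>x. x \<noteq> 0 \<and> cmap T x = cscale c x)"
  unfolding complex_eigenvalue_def cmap_def cscale_def by (auto simp: zero_prod_def)

lemma cscale_add: "cscale c (x + y) = cscale c x + cscale c y"
  and cscale_diff: "cscale c (x - y) = cscale c x - cscale c y"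
  and cscale_add_left: "cscale (c + d) x = cscale c x + cscale d x"
  and cscale_diff_left: "cscale (c - d) x = cscale c x - cscale d x"
  and cscale_uminus_left: "cscale (- c) x = - cscale c x"
  and cscale_mult: "cscale (c * d) x = cscale c (cscale d x)"
  and cscale_0 [simp]: "cscale 0 x = 0"
  and cscale_1 [simp]: "cscale 1 x = x"
  and cscale_zero [simp]: "cscale c 0 = 0"
  by (auto simp: cscale_def algebra_simps zero_prod_def)

lemma cscale_of_real: "cscale (complex_of_real r) x = r *\<^sub>R x"
  by (simp add: cscale_def scaleR_prod_def)

lemma norm_cscale: "norm (cscale c x) = cmod c * norm x"
proof -
  obtain v w where x: "x = (v, w)" by (cases x)
  have "(cmod c)\<^sup>2 = (Re c)\<^sup>2 + (Im c)\<^sup>2" "(norm x)\<^sup>2 = (norm v)\<^sup>2 + (norm w)\<^sup>2"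
    by (simp_all add: cmod_def x norm_Pair)
  then have "(norm (cscale c x))\<^sup>2 = (cmod c * norm x)\<^sup>2"
    unfolding power_mult_distrib
    by (simp add: x cscale_def norm_Pair, simp add: power2_norm_eq_inner inner_diff_left inner_diff_right inner_add_left inner_add_right
        inner_commute[of w v]) (simp add: algebra_simps power2_eq_square)
  then show ?thesis by simp
qed

lemma cscale_eq_0_iff: "cscale c x = 0 \<longleftrightarrow> c = 0 \<or> x = 0"
  using norm_cscale[of c x] by (metis mult_eq_0_iff norm_eq_zero)

text \<open>The product of the commuting operators T - c over the list, acting on the
  complexification: a polynomial in T in factored form.\<close>

primrec deflate :: "('a::real_inner \<Rightarrow> 'a) \<Rightarrow> complex list \<Rightarrow> 'a \<times> 'a \<Rightarrow> 'a \<times> 'a" where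
  "deflate T [] x = x"
| "deflate T (c # cs) x = deflate T cs (cmap T x - cscale c x)"

lemma deflate_append: "deflate T (cs @ ds) x = deflate T ds (deflate T cs x)"
  by (induction cs arbitrary: x) auto

context
  fixes T :: "'a::euclidean_space \<Rightarrow> 'a"
  assumes T: "linear T"
begin

lemma cmap_add: "cmap T (x + y) = cmap T x + cmap T y"
  and cmap_diff: "cmap T (x - y) = cmap T x - cmap T y"
  and cmap_scaleR: "cmap T (r *\<^sub>R x) = r *\<^sub>R cmap T x"
  and cmap_0: "cmap T 0 = 0"
  and cmap_cscale: "cmap T (cscale c x) = cscale c (cmap T x)"
  using T by (auto simp: cmap_def cscale_def linear_add linear_diff linear_cmul linear_0 zero_prod_def)

lemma linear_deflate: "linear (deflate T cs)"
proof (induction cs)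
  case (Cons c cs)
  show ?case
    by (rule linearI)
       (simp_all add: cmap_add cscale_add add_diff_add linear_add[OF Cons] cmap_scaleR
          flip: linear_cmul[OF Cons], simp add: cscale_def algebra_simps)
qed (simp add: linear_iff)

lemma deflate_cmap: "deflate T cs (cmap T x) = cmap T (deflate T cs x)"
proof (induction cs arbitrary: x)
  case (Cons c cs)
  have "deflate T (c # cs) (cmap T x) = deflate T cs (cmap T (cmap T x - cscale c x))"
    by (simp add: cmap_diff cmap_cscale)
  then show ?case by (simp add: Cons)
qed simp

lemma deflate_cscale: "deflate T cs (cscale c x) = cscale c (deflate T cs x)"
proof (induction cs arbitrary: x)
  case (Cons d cs)
  have "deflate T (d # cs) (cscale c x) = deflate T cs (cscale c (cmap T x - cscale d x))"
    by (simp add: cscale_diff cmap_cscale mult.commute flip: cscale_mult)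
  then show ?case by (simp add: Cons)
qed simp

lemma deflate_step: "deflate T cs (cmap T x - cscale c x) = cmap T (deflate T cs x) - cscale c (deflate T cs x)"
  by (simp add: linear_diff[OF linear_deflate] deflate_cmap deflate_cscale)

text \<open>On an eigenvector for c each factor T - d acts as multiplication by c - d, so a
  vanishing product must contain the factor with d = c.\<close>

lemma deflate_eigenvector:
  assumes "cmap T x = cscale c x" "deflate T cs x = 0" "x \<noteq> 0"
  shows "c \<in> set cs"
  using assms(2)
proof (induction cs)
  case (Cons d cs)
  have "deflate T (d # cs) x = cscale (c - d) (deflate T cs x)"
    by (simp add: assms(1) deflate_cscale flip: cscale_diff_left)
  then show ?case using Cons by (auto simp: cscale_eq_0_iff)
qed (use assms(3) in simp)

lemma deflate_eigenvalues:
  "deflate T cs x = 0 \<Longrightarrow> \<exists>ds. (\<forall>d\<in>set ds. complex_eigenvalue T d) \<and> deflate T ds x = 0"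
proof (induction cs arbitrary: x)
  case Nil
  then show ?case by (intro exI[of _ "[]"]) simp
next
  case (Cons c cs)
  show ?case
  proof (cases "complex_eigenvalue T c")
    case True
    obtain ds where "\<forall>d\<in>set ds. complex_eigenvalue T d" "deflate T ds (cmap T x - cscale c x) = 0"
      using Cons.IH[of "cmap T x - cscale c x"] Cons.prems by auto
    then show ?thesis using True by (intro exI[of _ "c # ds"]) simp
  next
    case False
    have "cmap T (deflate T cs x) = cscale c (deflate T cs x)"
      using Cons.prems by (simp add: deflate_step)
    then have "deflate T cs x = 0" using False complex_eigenvalue_iff by blast
    then show ?thesis by (rule Cons.IH)
  qed
qed

text \<open>Jordan blocks are absorbed by induction on the list: y_n = T^n x obeys y_(n+1) = d y_n +
  T^n (T - d) x, and the last term is at most C q^n by induction. \<open>K\<close> is the larger of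
  the initial size and C / (q - |d|), the value at which |d| K + C equals q K.\<close>

lemma power_bound_of_deflate:
  assumes "deflate T ds x = 0" "\<And>d. d \<in> set ds \<Longrightarrow> cmod d < q" "q > 0"
  shows "\<exists>C. \<forall>n. norm ((cmap T ^^ n) x) \<le> C * q ^ n"
  using assms(1,2)
proof (induction ds arbitrary: x)
  case Nil
  have "(cmap T ^^ n) 0 = 0" for n by (induction n) (auto simp: cmap_0)
  then show ?case using Nil by (intro exI[of _ 0]) simp
next
  case (Cons d ds)
  obtain C where C: "\<And>n. norm ((cmap T ^^ n) (cmap T x - cscale d x)) \<le> C * q ^ n"
    using Cons.IH[of "cmap T x - cscale d x"] Cons.prems by auto
  have step: "(cmap T ^^ n) (cmap T x - cscale d x) = (cmap T ^^ Suc n) x - cscale d ((cmap T ^^ n) x)" for n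
  proof (induction n)
    case (Suc n)
    have "(cmap T ^^ Suc n) (cmap T x - cscale d x) = cmap T ((cmap T ^^ n) (cmap T x - cscale d x))" by simp
    also have "\<dots> = (cmap T ^^ Suc (Suc n)) x - cscale d ((cmap T ^^ Suc n) x)"
      unfolding Suc by (simp add: cmap_diff cmap_cscale)
    finally show ?case .
  qed simp
  have dq: "cmod d < q" using Cons.prems by simp
  define K where "K = max (norm x) (C / (q - cmod d))"
  have KC: "C \<le> K * (q - cmod d)"
    unfolding K_def using dq by (simp add: pos_divide_le_eq[symmetric])
  have "norm ((cmap T ^^ n) x) \<le> K * q ^ n" for n
  proof (induction n)
    case (Suc n)
    have "(cmap T ^^ Suc n) x = cscale d ((cmap T ^^ n) x) + (cmap T ^^ n) (cmap T x - cscale d x)"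
      unfolding step by simp
    then have "norm ((cmap T ^^ Suc n) x) \<le> cmod d * norm ((cmap T ^^ n) x) + C * q ^ n"
      using C[of n] norm_triangle_ineq[of "cscale d ((cmap T ^^ n) x)" "(cmap T ^^ n) (cmap T x - cscale d x)"]
      by (simp add: norm_cscale)
    also have "\<dots> \<le> cmod d * (K * q ^ n) + K * (q - cmod d) * q ^ n"
      using Suc KC assms(3) by (intro add_mono mult_left_mono mult_right_mono) auto
    finally show ?case by (simp add: algebra_simps)
  qed (simp add: K_def)
  then show ?case by blast
qed

text \<open>The vector p(T) x, evaluated by Horner's rule.\<close>

definition poly_map :: "complex poly \<Rightarrow> 'a \<times> 'a \<Rightarrow> 'a \<times> 'a" where
  "poly_map p x = fold_coeffs (\<lambda>a y. cscale a x + cmap T y) p 0"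

lemma poly_map_0 [simp]: "poly_map 0 x = 0"
  by (simp add: poly_map_def)

lemma poly_map_pCons: "poly_map (pCons a p) x = cscale a x + cmap T (poly_map p x)"
proof (cases "a = 0 \<and> p = 0")
  case False
  then show ?thesis unfolding poly_map_def by (cases "a = 0") auto
qed (auto simp: cmap_0)

lemma poly_map_add: "poly_map (p + r) x = poly_map p x + poly_map r x"
proof (induction p arbitrary: r)
  case (pCons a p)
  show ?case
  proof (cases r)
    case (pCons b s)
    then show ?thesis using \<open>\<And>r. poly_map (p + r) x = poly_map p x + poly_map r x\<close>
      by (simp add: poly_map_pCons cscale_add_left cmap_add)
  qed
qed simp

lemma poly_map_smult: "poly_map (smult c p) x = cscale c (poly_map p x)"
  by (induction p) (auto simp: poly_map_pCons cscale_mult cscale_add cmap_cscale)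

lemma poly_map_step: "poly_map ([:-c, 1:] * p) x = poly_map p (cmap T x - cscale c x)"
proof (induction p)
  case (pCons a p)
  have "[:-c, 1:] * pCons a p = smult a [:-c, 1:] + pCons 0 ([:-c, 1:] * p)"
    by (metis mult.commute mult_pCons_left)
  then have "poly_map ([:-c, 1:] * pCons a p) x = cscale a (poly_map [:-c, 1:] x) + cmap T (poly_map ([:-c, 1:] * p) x)"
    by (simp only: poly_map_add poly_map_smult poly_map_pCons) simp
  also have "poly_map [:-c, 1:] x = cmap T x - cscale c x"
    by (simp add: poly_map_pCons cmap_0 cscale_uminus_left)
  finally show ?case using pCons by (simp add: poly_map_pCons)
qed simp

lemma poly_map_prod: "poly_map (\<Prod>c\<leftarrow>cs. [:-c, 1:]) x = deflate T cs x"
proof (induction cs arbitrary: x)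
  case Nil
  have "poly_map [:1:] x = x" by (simp add: poly_map_pCons cmap_0)
  then show ?case by (simp add: one_pCons)
next
  case (Cons c cs)
  have "(\<Prod>c\<leftarrow>c # cs. [:-c, 1:]) = [:-c, 1:] * (\<Prod>c\<leftarrow>cs. [:-c, 1:])" by simp
  then show ?case by (simp only: poly_map_step Cons deflate.simps)
qed

lemma poly_map_monom: "poly_map (monom a n) x = cscale a ((cmap T ^^ n) x)"
  by (induction n) (auto simp: monom_0 monom_Suc poly_map_pCons cmap_0 cmap_cscale)

lemma poly_map_sum: "poly_map (\<Sum>i\<in>I. p i) x = (\<Sum>i\<in>I. poly_map (p i) x)"
  by (induction I rule: infinite_finite_induct) (auto simp: poly_map_add)

text \<open>There is one more vector among v, T v, T^2 v, ... than the dimension allows to be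
  independent. Repetitions are treated apart because \<open>dependent\<close> speaks of the set of
  these vectors and does not see them.\<close>

lemma power_dependence:
  fixes v :: 'a
  shows "\<exists>c::nat \<Rightarrow> real. (\<exists>i\<le>DIM('a). c i \<noteq> 0) \<and> (\<Sum>i\<le>DIM('a). c i *\<^sub>R (T ^^ i) v) = 0"
proof (cases "inj_on (\<lambda>i. (T ^^ i) v) {..DIM('a)}")
  case False
  then obtain i j where ij: "i \<le> DIM('a)" "j \<le> DIM('a)" "i \<noteq> j" "(T ^^ i) v = (T ^^ j) v"
    unfolding inj_on_def by auto
  define c where "c = (\<lambda>k. (if k = i then 1 else 0) - (if k = j then 1 else 0) :: real)"
  have "(\<Sum>k\<le>DIM('a). c k *\<^sub>R (T ^^ k) v)
      = (\<Sum>k\<le>DIM('a). if k = i then (T ^^ k) v else 0) - (\<Sum>k\<le>DIM('a). if k = j then (T ^^ k) v else 0)"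
    unfolding sum_subtractf[symmetric] by (rule sum.cong) (auto simp: c_def)
  also have "\<dots> = 0" using ij by simp
  finally show ?thesis using ij by (intro exI[of _ c]) (auto simp: c_def)
next
  case True
  let ?B = "(\<lambda>i. (T ^^ i) v) ` {..DIM('a)}"
  have "card ?B = Suc (DIM('a))" using True by (simp add: card_image)
  then have "dependent ?B"
    using independent_bound[of ?B] by auto
  then obtain u w where uw: "w \<in> ?B" "u w \<noteq> 0" "(\<Sum>w\<in>?B. u w *\<^sub>R w) = 0"
    by (auto simp: real_vector.dependent_finite)
  have "(\<Sum>i\<le>DIM('a). u ((T ^^ i) v) *\<^sub>R (T ^^ i) v) = 0"
    using uw(3) by (simp add: sum.reindex[OF True] o_def)
  then show ?thesis using uw(1,2) by (intro exI[of _ "\<lambda>i. u ((T ^^ i) v)"]) auto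
qed

text \<open>The dependence among the powers is a nonzero polynomial p with p(T) v = 0. It splits
  into linear factors over the complex numbers, and its leading coefficient cancels.\<close>

lemma deflate_vector_exists: "\<exists>cs. deflate T cs (v, 0) = 0"
proof -
  obtain c :: "nat \<Rightarrow> real" and i where c: "i \<le> DIM('a)" "c i \<noteq> 0" "(\<Sum>i\<le>DIM('a). c i *\<^sub>R (T ^^ i) v) = 0"
    using power_dependence[of v] by auto
  define p where "p = (\<Sum>i\<le>DIM('a). monom (complex_of_real (c i)) i)"
  have "coeff p i = of_real (c i)"
    unfolding p_def using c(1) by (simp add: coeff_sum)
  then have p0: "p \<noteq> 0" using c(2) by auto
  have pow: "(cmap T ^^ n) (v, 0) = ((T ^^ n) v, 0)" for n
    by (induction n) (auto simp: cmap_def linear_0[OF T])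
  have "poly_map p (v, 0) = (\<Sum>i\<le>DIM('a). (c i *\<^sub>R (T ^^ i) v, 0))"
    unfolding p_def by (simp add: poly_map_sum poly_map_monom pow cscale_of_real)
  also have "\<dots> = (\<Sum>i\<le>DIM('a). c i *\<^sub>R (T ^^ i) v, 0)"
    by (simp add: sum_prod)
  finally have z: "poly_map p (v, 0) = 0" using c(3) by (simp add: zero_prod_def)
  obtain A where A: "p = smult (lead_coeff p) (\<Prod>x\<in>#A. [:-x, 1:])"
    using alg_closed_imp_factorization[OF p0] by blast
  obtain cs where cs: "mset cs = A" using ex_mset by blast
  have "(\<Prod>x\<in>#A. [:-x, 1:]) = (\<Prod>c\<leftarrow>cs. [:-c, 1:])"
    unfolding cs[symmetric] by (metis mset_map prod_mset_prod_list)
  then have "poly_map p (v, 0) = cscale (lead_coeff p) (deflate T cs (v, 0))"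
    using A by (metis poly_map_prod poly_map_smult)
  then show ?thesis using z p0 by (auto simp: cscale_eq_0_iff)
qed

text \<open>Since the factors commute, concatenating the lists that annihilate the basis vectors
  annihilates every real vector; writing x = v + i w extends this to the complexification.\<close>

lemma deflate_exists: "\<exists>cs. \<forall>x. deflate T cs x = 0"
proof -
  have "\<exists>cs. \<forall>v\<in>B. deflate T cs (v, 0) = 0" if "finite B" for B
    using that
  proof induction
    case (insert v B)
    obtain cs where cs: "\<forall>v\<in>B. deflate T cs (v, 0) = 0" using insert by auto
    obtain ds where ds: "deflate T ds (v, 0) = 0" using deflate_vector_exists by auto
    have comm: "deflate T ds (deflate T cs x) = deflate T cs (deflate T ds x)" for x
      by (induction ds arbitrary: x) (auto simp: deflate_step)
    have "deflate T (cs @ ds) (w, 0) = 0" if "w \<in> insert v B" for w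
    proof (cases "w = v")
      case True
      then show ?thesis using ds by (simp add: deflate_append comm linear_0[OF linear_deflate])
    next
      case False
      then show ?thesis using cs that by (simp add: deflate_append linear_0[OF linear_deflate])
    qed
    then show ?case by blast
  qed auto
  then obtain cs where cs: "\<And>v. v \<in> Basis \<Longrightarrow> deflate T cs (v, 0) = 0"
    using finite_Basis by blast
  have lin: "linear (\<lambda>v. deflate T cs (v, 0))"
    using linear_compose[OF _ linear_deflate, of "\<lambda>v. (v, 0)" cs] by (simp add: o_def linear_iff)
  have v0: "deflate T cs (v, 0) = 0" for v
    using linear_eq_stdbasis[OF lin linear_zero] cs by metis
  have "deflate T cs x = 0" for x
  proof -
    have "x = (fst x, 0) + cscale \<i> (snd x, 0)"
      by (simp add: cscale_def prod_eq_iff)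
    then show ?thesis by (metis v0 linear_add[OF linear_deflate] deflate_cscale cscale_zero add_0)
  qed
  then show ?thesis by blast
qed

text \<open>Finiteness is what gives \<open>Max\<close> in \<open>spectral_radius\<close> its
  meaning.\<close>

lemma finite_complex_eigenvalues: "finite {c. complex_eigenvalue T c}"
proof -
  obtain cs where "\<And>x. deflate T cs x = 0" using deflate_exists by auto
  then have "{c. complex_eigenvalue T c} \<subseteq> set cs"
    using deflate_eigenvector by (auto simp: complex_eigenvalue_iff)
  then show ?thesis using finite_subset by blast
qed

text \<open>Each vector has a power bound with a constant of its own; expansion in the orthonormal
  basis makes the constant uniform.\<close>

lemma power_bound_of_eigenvalues:
  assumes q: "\<And>c. complex_eigenvalue T c \<Longrightarrow> cmod c < q" "q > 0"
  shows "\<exists>C\<ge>1. \<forall>n v. norm ((T ^^ n) v) \<le> C * q ^ n * norm v"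
proof -
  have pow: "(cmap T ^^ n) (v, 0) = ((T ^^ n) v, 0)" for n v
    by (induction n) (auto simp: cmap_def linear_0[OF T])
  have "\<exists>C. \<forall>n. norm ((T ^^ n) v) \<le> C * q ^ n" for v
  proof -
    obtain cs where "deflate T cs (v, 0) = 0" using deflate_exists by auto
    then obtain ds where "\<forall>d\<in>set ds. complex_eigenvalue T d" "deflate T ds (v, 0) = 0"
      using deflate_eigenvalues by blast
    then show ?thesis using power_bound_of_deflate[of ds "(v, 0)" q] q by (auto simp: pow)
  qed
  then obtain C where C: "\<And>v n. norm ((T ^^ n) v) \<le> C v * q ^ n" by metis
  have C0: "C v \<ge> 0" for v
    using C[where v = v and n = 0] norm_ge_zero[of v] by (simp del: norm_ge_zero)
  have linT: "linear (T ^^ n)" for n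
  proof (induction n)
    case (Suc n)
    then show ?case using linear_compose[OF Suc T] by (simp add: o_def)
  qed (simp add: linear_iff)
  define D where "D = 1 + (\<Sum>b\<in>Basis. C b)"
  have "norm ((T ^^ n) v) \<le> D * q ^ n * norm v" for n v
  proof -
    have "(T ^^ n) v = (T ^^ n) (\<Sum>b\<in>Basis. (v \<bullet> b) *\<^sub>R b)" by (simp add: euclidean_representation)
    also have "\<dots> = (\<Sum>b\<in>Basis. (v \<bullet> b) *\<^sub>R (T ^^ n) b)"
      by (simp add: linear_sum[OF linT] linear_cmul[OF linT])
    also have "norm \<dots> \<le> (\<Sum>b\<in>Basis. norm v * (C b * q ^ n))"
      by (rule sum_norm_le) (auto intro!: mult_mono C simp: Basis_le_norm)
    also have "\<dots> = (\<Sum>b\<in>Basis. C b) * q ^ n * norm v"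
      by (simp add: sum_distrib_left sum_distrib_right algebra_simps)
    also have "\<dots> \<le> D * q ^ n * norm v"
      unfolding D_def using q(2) by (intro mult_right_mono) auto
    finally show ?thesis .
  qed
  moreover have "D \<ge> 1" unfolding D_def using C0 by (simp add: sum_nonneg)
  ultimately show ?thesis by blast
qed

end

lemma power_bound_of_spectral_radius:
  fixes T :: "'a::euclidean_space \<Rightarrow>\<^sub>L 'a"
  assumes "spectral_radius T < q" "q > 0"
  shows "\<exists>C\<ge>1. \<forall>n v. norm ((blinfun_apply T ^^ n) v) \<le> C * q ^ n * norm v"
proof (rule power_bound_of_eigenvalues[OF _ _ assms(2)])
  show l: "linear (blinfun_apply T)"
    by (simp add: blinfun.bounded_linear_right bounded_linear.linear)
  fix c assume c: "complex_eigenvalue (blinfun_apply T) c"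
  have "cmod c \<le> spectral_radius T"
    unfolding spectral_radius_def
    by (rule Max_ge) (use finite_complex_eigenvalues[OF l] c in auto)
  with assms(1) show "cmod c < q" by simp
qed

section \<open>Perturbed linear recursions\<close>

text \<open>N x is the sum of |T^n x| / q^n over n < m, with m so large that |T^m x| <= q^m |x|.
  Applying T shifts the sum by one index at the price of a factor q, and the new last term is
  dominated by the first term that drops out.\<close>

lemma adapted_norm:
  fixes T :: "'a::euclidean_space \<Rightarrow>\<^sub>L 'a"
  assumes "spectral_radius T < q" "q > 0"
  obtains N :: "'a \<Rightarrow> real" and C where
    "C \<ge> 1" "\<And>x. norm x \<le> N x" "\<And>x. N x \<le> C * norm x" "\<And>x y. N (x + y) \<le> N x + N y"
    "\<And>x. N (blinfun_apply T x) \<le> q * N x"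
proof -
  \<comment> \<open>An intermediate rate: C q0^m <= q^m for some m requires q0 < q strictly. The
    maximum with 0 makes q0 positive.\<close>
  define q0 where "q0 = (max (spectral_radius T) 0 + q) / 2"
  have q0: "q0 > 0" "spectral_radius T < q0" "q0 < q" using assms unfolding q0_def by auto
  obtain C where C: "C \<ge> 1" "\<And>n v. norm ((blinfun_apply T ^^ n) v) \<le> C * q0 ^ n * norm v"
    using power_bound_of_spectral_radius[OF q0(2,1)] by auto
  have "(\<lambda>n. C * (q0 / q) ^ n) \<longlonglongrightarrow> C * 0"
    by (intro tendsto_mult tendsto_const LIMSEQ_realpow_zero) (use q0 in auto)
  then have "\<forall>\<^sub>F n in sequentially. C * (q0 / q) ^ n < 1"
    by (intro order_tendstoD) auto
  then obtain m where "C * (q0 / q) ^ m < 1"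
    by (meson eventually_sequentially order_refl)
  then have m: "C * q0 ^ m \<le> q ^ m" using assms(2) by (simp add: power_divide field_simps)
  have m0: "m > 0" using \<open>C * (q0 / q) ^ m < 1\<close> C(1) by (cases m) auto
  define t where "t = (\<lambda>n x. norm ((blinfun_apply T ^^ n) x) / q ^ n)"
  define N where "N = (\<lambda>x. \<Sum>n<m. t n x)"
  have t0: "t n x \<ge> 0" for n x unfolding t_def using assms(2) by simp
  have tC: "t n x \<le> C * norm x" for n x
  proof -
    have "t n x \<le> C * q0 ^ n * norm x / q ^ n"
      unfolding t_def using C(2)[of n x] assms(2) by (intro divide_right_mono) auto
    also have "\<dots> = C * norm x * (q0 / q) ^ n" by (simp add: power_divide)
    also have "\<dots> \<le> C * norm x * 1"
      using q0 C(1) by (intro mult_left_mono power_le_one) auto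
    finally show ?thesis by simp
  qed
  have lin: "linear (blinfun_apply T ^^ n)" for n
  proof (induction n)
    case (Suc n)
    then show ?case
      using linear_compose[OF Suc, of "blinfun_apply T"]
      by (simp add: o_def blinfun.bounded_linear_right bounded_linear.linear)
  qed (simp add: linear_iff)
  show thesis
  proof (rule that[of "max 1 (m * C)" N])
    fix x y
    have "t 0 x \<le> N x" unfolding N_def using m0 t0 by (intro member_le_sum) auto
    then show "norm x \<le> N x" by (simp add: t_def)
    have "N x \<le> (\<Sum>n<m. C * norm x)" unfolding N_def by (intro sum_mono tC)
    also have "\<dots> = m * C * norm x" by simp
    also have "\<dots> \<le> max 1 (m * C) * norm x" by (intro mult_right_mono) auto
    finally show "N x \<le> max 1 (m * C) * norm x" .
    show "N (x + y) \<le> N x + N y"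
      unfolding N_def sum.distrib[symmetric] t_def
      by (intro sum_mono)
         (use assms(2) in \<open>simp add: linear_add[OF lin] divide_right_mono norm_triangle_ineq flip: add_divide_distrib\<close>)
    have shift: "t n (blinfun_apply T x) = q * t (Suc n) x" for n
      unfolding t_def using assms(2) by (simp add: funpow_swap1)
    have "t m x \<le> t 0 x"
    proof -
      have "norm ((blinfun_apply T ^^ m) x) \<le> q ^ m * norm x"
        using C(2)[of m x] m mult_right_mono[OF m norm_ge_zero[of x]] by linarith
      then show ?thesis unfolding t_def using assms(2) by (simp add: field_simps)
    qed
    then have "(\<Sum>n<m. t (Suc n) x) \<le> (\<Sum>n<m. t n x)"
      using sum_lessThan_telescope[of "\<lambda>n. t n x" m] by (simp add: sum_subtractf)
    then show "N (blinfun_apply T x) \<le> q * N x"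
      unfolding N_def shift sum_distrib_left[symmetric] using assms(2) by simp
  qed simp
qed

lemma tendsto_zero_of_recursion:
  fixes a r :: "nat \<Rightarrow> real"
  assumes q: "0 \<le> q" "q < 1" and a0: "\<And>k. 0 \<le> a k"
    and rec: "\<forall>\<^sub>F k in sequentially. a (Suc k) \<le> q * a k + r k" and r: "r \<longlonglongrightarrow> 0"
  shows "a \<longlonglongrightarrow> 0"
proof (rule LIMSEQ_I)
  fix e :: real assume e: "e > 0"
  have "\<forall>\<^sub>F k in sequentially. r k < e / 2 * (1 - q)"
    using r e q by (intro order_tendstoD) auto
  with rec have "\<forall>\<^sub>F k in sequentially. a (Suc k) \<le> q * a k + r k \<and> r k < e / 2 * (1 - q)"
    by eventually_elim simp
  then obtain K where K: "\<And>k. k \<ge> K \<Longrightarrow> a (Suc k) \<le> q * a k + e / 2 * (1 - q)"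
    unfolding eventually_sequentially by (meson add_left_mono less_imp_le order_trans)
  \<comment> \<open>With perturbations below e/2 (1 - q), the value e/2 is invariant under a |-> q a
    + e/2 (1 - q), so the excess over it decays like q^n.\<close>
  have b: "a (K + n) \<le> q ^ n * a K + e / 2" for n
  proof (induction n)
    case (Suc n)
    have "a (K + Suc n) \<le> q * a (K + n) + e / 2 * (1 - q)" using K[of "K + n"] by simp
    also have "\<dots> \<le> q * (q ^ n * a K + e / 2) + e / 2 * (1 - q)"
      using Suc q by (intro add_right_mono mult_left_mono) auto
    finally show ?case by (simp add: field_simps)
  qed (use e in simp)
  have "(\<lambda>n. q ^ n * a K) \<longlonglongrightarrow> 0 * a K"
    by (intro tendsto_mult tendsto_const LIMSEQ_realpow_zero) (use q in auto)
  then have "\<forall>\<^sub>F n in sequentially. q ^ n * a K < e / 2"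
    using e by (intro order_tendstoD) auto
  then obtain n0 where n0: "\<And>n. n \<ge> n0 \<Longrightarrow> q ^ n * a K < e / 2"
    unfolding eventually_sequentially by auto
  have "norm (a k - 0) < e" if "k \<ge> K + n0" for k
  proof -
    have "a k \<le> q ^ (k - K) * a K + e / 2" using b[of "k - K"] that by simp
    also have "\<dots> < e" using n0[of "k - K"] that by (simp add: field_simps)
    finally show ?thesis using a0 by simp
  qed
  then show "\<exists>no. \<forall>n\<ge>no. norm (a n - 0) < e" by blast
qed

text \<open>D is chosen with q D + C <= p D, which is possible because q < p is strict; for q = p a
  factor k could appear.\<close>

lemma geometric_bound_of_recursion:
  fixes a :: "nat \<Rightarrow> real"
  assumes q: "0 \<le> q" "q < p"
    and rec: "\<forall>\<^sub>F k in sequentially. a (Suc k) \<le> q * a k + C * p ^ k"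
  shows "\<exists>D. \<forall>\<^sub>F k in sequentially. a k \<le> D * p ^ k"
proof -
  obtain K where K: "\<And>k. k \<ge> K \<Longrightarrow> a (Suc k) \<le> q * a k + C * p ^ k"
    using rec unfolding eventually_sequentially by auto
  have p: "p > 0" using q by simp
  define D where "D = max (a K / p ^ K) (C / (p - q))"
  have CD: "C \<le> D * (p - q)"
    unfolding D_def using q by (simp add: pos_divide_le_eq[symmetric])
  have "a k \<le> D * p ^ k" if "k \<ge> K" for k
    using that
  proof (induction k rule: dec_induct)
    case base
    have "a K / p ^ K \<le> D" unfolding D_def by simp
    then show ?case using p by (simp add: pos_divide_le_eq)
  next
    case (step k)
    have "a (Suc k) \<le> q * a k + C * p ^ k" using K step by simp
    also have "\<dots> \<le> q * (D * p ^ k) + D * (p - q) * p ^ k"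
      using step q p CD by (intro add_mono mult_left_mono mult_right_mono) auto
    finally show ?case by (simp add: algebra_simps)
  qed
  then show ?thesis unfolding eventually_sequentially by blast
qed

text \<open>In the norm adapted to \<open>B\<close> the linear part contracts by some q < p, the
  late errors \<open>Bk k - B\<close> are absorbed into the rate, and scalar recursions for N (e k)
  remain. Both conclusions share this reduction, with p = 1 for the first.\<close>

lemma perturbed_recursion:
  fixes B :: "'a::euclidean_space \<Rightarrow>\<^sub>L 'a" and e r :: "nat \<Rightarrow> 'a"
  assumes Bk: "Bk \<longlonglongrightarrow> B"
    and rec: "\<forall>\<^sub>F k in sequentially. e (Suc k) = blinfun_apply (Bk k) (e k) + r k"
  shows "spectral_radius B < 1 \<Longrightarrow> r \<longlonglongrightarrow> 0 \<Longrightarrow> e \<longlonglongrightarrow> 0"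
    and "spectral_radius B < p \<Longrightarrow> p > 0 \<Longrightarrow> \<forall>\<^sub>F k in sequentially. norm (r k) \<le> C * p ^ k
      \<Longrightarrow> \<exists>D. \<forall>\<^sub>F k in sequentially. norm (e k) \<le> D * p ^ k"
proof -
  have main: "\<exists>q N K. 0 \<le> q \<and> q < p \<and> (\<forall>x::'a. norm x \<le> N x) \<and> K \<ge> 1 \<and>
      (\<forall>\<^sub>F k in sequentially. N (e (Suc k)) \<le> q * N (e k) + K * norm (r k))"
    if p: "spectral_radius B < p" "p > 0" for p
  proof -
    define q where "q = (max (spectral_radius B) 0 + p) / 2"
    have q: "q > 0" "spectral_radius B < q" "q < p" using p unfolding q_def by auto
    obtain N :: "'a \<Rightarrow> real" and K where N: "K \<ge> 1" "\<And>x. norm x \<le> N x" "\<And>x. N x \<le> K * norm x"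
      "\<And>x y. N (x + y) \<le> N x + N y" "\<And>x. N (blinfun_apply B x) \<le> q * N x"
      by (rule adapted_norm[OF q(2,1)], rule that)
    \<comment> \<open>The perturbation enters N multiplied by the equivalence constant K, so this
      choice costs half of the gap p - q.\<close>
    define d where "d = (p - q) / (2 * K)"
    have d: "d > 0" unfolding d_def using q N(1) by simp
    have Kd: "K * d = (p - q) / 2" unfolding d_def using N(1) by simp
    have "\<forall>\<^sub>F k in sequentially. dist (Bk k) B < d"
      using Bk d by (rule tendstoD)
    with rec have "\<forall>\<^sub>F k in sequentially. N (e (Suc k)) \<le> (q + K * d) * N (e k) + K * norm (r k)"
    proof eventually_elim
      case (elim k)
      have "e (Suc k) = blinfun_apply B (e k) + (blinfun_apply (Bk k - B) (e k) + r k)"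
        using elim(1) by (simp add: blinfun.diff_left)
      then have "N (e (Suc k)) \<le> N (blinfun_apply B (e k)) + (N (blinfun_apply (Bk k - B) (e k)) + N (r k))"
        using N(4)[of "blinfun_apply B (e k)" "blinfun_apply (Bk k - B) (e k) + r k"]
          N(4)[of "blinfun_apply (Bk k - B) (e k)" "r k"] by simp
      moreover have "N (blinfun_apply (Bk k - B) (e k)) \<le> K * (d * N (e k))"
      proof -
        have "norm (blinfun_apply (Bk k - B) (e k)) \<le> d * N (e k)"
          using elim(2) N(2)[of "e k"] d
          by (intro order_trans[OF norm_blinfun] mult_mono) (auto simp: dist_norm)
        then show ?thesis using N(1) by (intro order_trans[OF N(3)] mult_left_mono) auto
      qed
      moreover have "N (r k) \<le> K * norm (r k)" by (rule N(3))
      moreover have "N (blinfun_apply B (e k)) \<le> q * N (e k)" by (rule N(5))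
      ultimately show ?case by (simp add: algebra_simps)
    qed
    then show ?thesis
      using N q unfolding Kd by (intro exI[of _ "q + (p - q) / 2"] exI[of _ N] exI[of _ K]) (auto simp: field_simps)
  qed
  show "e \<longlonglongrightarrow> 0" if B1: "spectral_radius B < 1" and r0: "r \<longlonglongrightarrow> 0"
  proof -
    obtain q N K where q: "0 \<le> q" "q < 1" and N: "\<And>x::'a. norm x \<le> N x"
      and rec: "\<forall>\<^sub>F k in sequentially. N (e (Suc k)) \<le> q * N (e k) + K * norm (r k)"
      using main[OF B1] by auto
    have "(\<lambda>k. K * norm (r k)) \<longlonglongrightarrow> 0"
      using tendsto_mult_left[OF tendsto_norm_zero[OF r0], of K] by simp
    then have "(\<lambda>k. N (e k)) \<longlonglongrightarrow> 0"
      using N norm_ge_zero order_trans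
      by (intro tendsto_zero_of_recursion[OF q _ rec]) blast+
    then show ?thesis by (rule Lim_null_comparison[rotated]) (simp add: N)
  qed
  show "\<exists>D. \<forall>\<^sub>F k in sequentially. norm (e k) \<le> D * p ^ k"
    if p: "spectral_radius B < p" "p > 0" and r: "\<forall>\<^sub>F k in sequentially. norm (r k) \<le> C * p ^ k"
  proof -
    obtain q N K where q: "0 \<le> q" "q < p" and N: "\<And>x::'a. norm x \<le> N x" and K: "K \<ge> 1"
      and rec: "\<forall>\<^sub>F k in sequentially. N (e (Suc k)) \<le> q * N (e k) + K * norm (r k)"
      using main[OF p] by auto
    have "\<forall>\<^sub>F k in sequentially. N (e (Suc k)) \<le> q * N (e k) + (K * C) * p ^ k"
      using rec r
    proof eventually_elim
      case (elim k)
      have "K * norm (r k) \<le> K * (C * p ^ k)" using elim(2) K by (intro mult_left_mono) auto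
      then show ?case using elim(1) by simp
    qed
    then obtain D where "\<forall>\<^sub>F k in sequentially. N (e k) \<le> D * p ^ k"
      using geometric_bound_of_recursion[OF q, of "\<lambda>k. N (e k)"] by blast
    then have "\<forall>\<^sub>F k in sequentially. norm (e k) \<le> D * p ^ k"
      by eventually_elim (use N order_trans in blast)
    then show ?thesis by blast
  qed
qed

section \<open>Differentiating a parametric iteration\<close>

lemma has_derivative_slice:
  assumes "(A has_derivative A') (at (t, z, u))"
  shows "((\<lambda>z. A (t, z, u)) has_derivative (\<lambda>v. A' (0, v, 0))) (at z)"
proof -
  have "((\<lambda>z. (t, z, u)) has_derivative (\<lambda>v. (0, v, 0))) (at z)"
    by (auto intro!: derivative_eq_intros)
  from has_derivative_compose[OF this assms] show ?thesis .
qed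

text \<open>The derivatives are taken at one parameter u, so the third coordinate stays frozen and
  only the first two get a radius.\<close>

lemma eventually_nhds_triple:
  fixes a :: "'a::metric_space" and b :: "'b::metric_space" and c :: "'c::metric_space"
  assumes "\<forall>\<^sub>F y in nhds (a, b, c). P y"
  shows "\<exists>e>0. \<forall>x y. dist x a < e \<longrightarrow> dist y b < e \<longrightarrow> P (x, y, c)"
proof -
  obtain d where d: "d > 0" "\<And>y. dist y (a, b, c) < d \<Longrightarrow> P y"
    using assms unfolding eventually_nhds_metric by auto
  show ?thesis
  proof (intro exI[of _ "d / 2"] conjI allI impI)
    fix x y assume "dist x a < d / 2" "dist y b < d / 2"
    then have "dist x a + dist y b < d" by simp
    moreover have "dist (x, y, c) (a, b, c) \<le> dist x a + dist y b"
      unfolding dist_Pair_Pair using sqrt_sum_squares_le_sum[of "dist x a" "dist y b"] by simp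
    ultimately show "P (x, y, c)" by (intro d(2)) simp
  qed (use d in simp)
qed

text \<open>\<open>fp\<close> may hold on neighbourhoods that shrink with k, since only the value
  and the derivative at \<open>us\<close> of this identity are used. \<open>Ak\<close> is separate
  from \<open>A\<close> because early parameters need not be near \<theta>s. The rate p is
  quantified inside the eventuality, so one neighbourhood of starting points serves all
  rates.\<close>

theorem derivative_iteration:
  fixes A :: "'p::euclidean_space \<times> 'z::euclidean_space \<times> 'u::euclidean_space \<Rightarrow> 'z"
    and \<theta> :: "nat \<Rightarrow> 'p"
  assumes \<theta>: "\<theta> \<longlonglongrightarrow> \<theta>s"
    and A: "C1_near b A (\<theta>s, zs, us)"
    and Ak: "\<And>k. C1_near False A (\<theta> k, zs, us)"
    and fp: "\<And>k. \<forall>\<^sub>F u in nhds us. A (\<theta> k, \<psi> u, u) = \<psi> u"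
    and \<psi>: "(\<psi> has_derivative blinfun_apply D) (at us)" "\<psi> us = zs"
    and rad: "spectral_radius (deriv_op (\<lambda>z. A (\<theta>s, z, us)) zs) < 1"
    and Z0: "\<And>z u. Z z 0 u = z" and ZS: "\<And>z k u. Z z (Suc k) u = A (\<theta> k, Z z k u, u)"
  shows "\<forall>\<^sub>F z in nhds zs.
     (\<forall>k. Z z k differentiable (at us)) \<and>
     (\<forall>h. (\<lambda>k. blinfun_apply (deriv_op (Z z k) us) h) \<longlonglongrightarrow> blinfun_apply D h) \<and>
     (b \<longrightarrow> (\<forall>p C. spectral_radius (deriv_op (\<lambda>z. A (\<theta>s, z, us)) zs) < p \<longrightarrow> 0 < p \<longrightarrow>
        (\<forall>\<^sub>F k in sequentially. norm (Z z k us - zs) \<le> C * p ^ k) \<longrightarrow>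
        (\<forall>h. \<exists>E. \<forall>\<^sub>F k in sequentially.
           norm (blinfun_apply (deriv_op (Z z k) us) h - blinfun_apply D h) \<le> E * p ^ k)))"
proof -
  define A' where "A' = deriv_op A"
  define y0 where "y0 = (\<theta>s, zs, us)"
  \<comment> \<open>\<open>J\<close> embeds z as (0, z, 0), so that \<open>B\<close> is the partial
    derivative of \<open>A\<close> in z at the limit.\<close>
  define J :: "'z \<Rightarrow>\<^sub>L ('p \<times> 'z \<times> 'u)" where "J = pair_op 0 (pair_op id_blinfun 0)"
  define B where "B = A' y0 o\<^sub>L J"
  have J: "blinfun_apply J v = (0, v, 0)" for v unfolding J_def by simp
  have d: "\<forall>\<^sub>F y in nhds y0. (A has_derivative blinfun_apply (A' y)) (at y)" and r: "loc_reg b A' y0"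
    using C1_near_deriv_op[OF A] unfolding A'_def y0_def by auto
  have A'c: "(A' \<longlongrightarrow> A' y0) (nhds y0)"
    using loc_reg_isCont[OF r] by (simp add: isCont_def tendsto_at_iff_tendsto_nhds)
  have diffA: "(A has_derivative blinfun_apply (A' y)) (at y)" if "C1_near False A y" for y
    using C1_near_differentiable[OF that] unfolding A'_def by (rule has_derivative_deriv_op)
  have B: "deriv_op (\<lambda>z. A (\<theta>s, z, us)) zs = B"
    using has_derivative_slice[OF eventually_nhds_x_imp_x[OF d, unfolded y0_def]]
    by (intro deriv_op_eqI) (simp add: B_def J y0_def blinfun_compose.rep_eq o_def)
  have rB: "spectral_radius B < 1" using rad B by simp
  have fix0: "A (\<theta> k, zs, us) = zs" for k
    using eventually_nhds_x_imp_x[OF fp[of k]] \<psi>(2) by simp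
  have cont: "((\<lambda>z. Z z k us) \<longlongrightarrow> zs) (nhds zs)" for k
  proof (induction k)
    case 0
    show ?case by (simp add: Z0 filterlim_ident)
  next
    case (Suc k)
    have "((\<lambda>z. (\<theta> k, Z z k us, us)) \<longlongrightarrow> (\<theta> k, zs, us)) (nhds zs)"
      by (intro tendsto_intros Suc)
    from filterlim_compose[OF C1_near_tendsto[OF Ak] this] show ?case
      by (simp add: ZS fix0)
  qed
  have near: "\<forall>\<^sub>F z in nhds zs. C1_near False A (\<theta> k, Z z k us, us)" for k
  proof -
    have "((\<lambda>z. (\<theta> k, Z z k us, us)) \<longlongrightarrow> (\<theta> k, zs, us)) (nhds zs)"
      by (intro tendsto_intros cont)
    with C1_near_eventually[OF Ak] show ?thesis unfolding filterlim_iff by blast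
  qed
  define q where "q = (max (spectral_radius B) 0 + 1) / 2"
  have q: "q > 0" "spectral_radius B < q" "q < 1" using rB unfolding q_def by auto
  obtain N :: "'z \<Rightarrow> real" and K where N: "K \<ge> 1" "\<And>x. norm x \<le> N x" "\<And>x. N x \<le> K * norm x"
    "\<And>x y. N (x + y) \<le> N x + N y" "\<And>x. N (blinfun_apply B x) \<le> q * N x"
    by (rule adapted_norm[OF q(2,1)], rule that)
  \<comment> \<open>Chosen so that q + K \<epsilon> = (1 + q) / 2 stays below 1.\<close>
  define \<epsilon> where "\<epsilon> = (1 - q) / (2 * K)"
  have \<epsilon>: "\<epsilon> > 0" unfolding \<epsilon>_def using q N(1) by simp
  define q2 where "q2 = q + K * \<epsilon>"
  have "K * \<epsilon> = (1 - q) / 2" unfolding \<epsilon>_def using N(1) by simp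
  then have q2: "0 < q2" "q2 < 1" unfolding q2_def using q by auto
  have "\<forall>\<^sub>F y in nhds y0. dist (A' y) (A' y0) < \<epsilon> / (norm J + 1)"
    using \<epsilon> by (intro tendstoD[OF A'c]) (simp add: add_nonneg_pos)
  with d C1_near_eventually[OF A[folded y0_def]]
  have "\<forall>\<^sub>F y in nhds (\<theta>s, zs, us). (A has_derivative blinfun_apply (A' y)) (at y) \<and> C1_near b A y \<and>
      dist (A' y) (A' y0) < \<epsilon> / (norm J + 1)"
    unfolding y0_def by eventually_elim simp
  from eventually_nhds_triple[OF this] obtain \<delta> where \<delta>: "\<delta> > 0"
    "\<And>t z. dist t \<theta>s < \<delta> \<Longrightarrow> dist z zs < \<delta> \<Longrightarrow> (A has_derivative blinfun_apply (A' (t, z, us))) (at (t, z, us))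
        \<and> C1_near b A (t, z, us) \<and> dist (A' (t, z, us)) (A' y0) < \<epsilon> / (norm J + 1)"
    by blast
  \<comment> \<open>Mean value inequality for A (t, ., us) - B on the ball. The bound is uniform in
    t, so parameters that still move do no harm.\<close>
  have lin: "norm (A (t, z, us) - A (t, zs, us) - blinfun_apply B (z - zs)) \<le> \<epsilon> * norm (z - zs)"
    if t: "dist t \<theta>s < \<delta>" and z: "dist z zs < \<delta>" for t z
  proof -
    let ?G = "\<lambda>z. A (t, z, us) - blinfun_apply B z"
    have "norm (?G z - ?G zs) \<le> \<epsilon> * norm (z - zs)"
    proof (rule differentiable_bound[of "ball zs \<delta>" ?G "\<lambda>z. blinfun_apply ((A' (t, z, us) - A' y0) o\<^sub>L J)"])
      fix w assume w: "w \<in> ball zs \<delta>"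
      then have dw: "dist w zs < \<delta>" by (simp add: dist_commute)
      have "(?G has_derivative (\<lambda>v. blinfun_apply (A' (t, w, us)) (0, v, 0) - blinfun_apply B v)) (at w)"
        by (intro has_derivative_diff has_derivative_slice[OF conjunct1[OF \<delta>(2)[OF t dw]]]
            bounded_linear_imp_has_derivative blinfun.bounded_linear_right)
      from has_derivative_at_withinI[OF this]
      show "(?G has_derivative blinfun_apply ((A' (t, w, us) - A' y0) o\<^sub>L J)) (at w within ball zs \<delta>)"
        by (simp add: B_def J blinfun_compose.rep_eq o_def blinfun.diff_left)
      have "norm ((A' (t, w, us) - A' y0) o\<^sub>L J) \<le> norm (A' (t, w, us) - A' y0) * norm J"
        by (rule norm_blinfun_compose)
      also have "\<dots> \<le> \<epsilon> / (norm J + 1) * (norm J + 1)"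
        using \<delta>(2)[OF t dw] \<epsilon> by (intro mult_mono) (auto simp: dist_norm)
      also have "\<dots> = \<epsilon>" using norm_ge_zero[of J] by (simp add: add_nonneg_eq_0_iff)
      finally show "onorm (blinfun_apply ((A' (t, w, us) - A' y0) o\<^sub>L J)) \<le> \<epsilon>"
        by (simp add: norm_blinfun.rep_eq)
    qed (use z \<delta>(1) in \<open>auto simp: dist_commute\<close>)
    then show ?thesis by (simp add: blinfun.diff_right algebra_simps)
  qed
  \<comment> \<open>From k0 on the parameters are in range. The earlier steps are finitely many
    maps, continuous in z and fixing zs, so z close to zs puts iterate k0 where the contraction
    starts and keeps the earlier points where A is C^1.\<close>
  obtain k0 where k0: "\<And>k. k \<ge> k0 \<Longrightarrow> dist (\<theta> k) \<theta>s < \<delta>"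
    using tendstoD[OF \<theta> \<delta>(1)] unfolding eventually_sequentially by auto
  have "((\<lambda>z. K * norm (Z z k0 us - zs)) \<longlongrightarrow> K * norm (zs - zs)) (nhds zs)"
    by (intro tendsto_intros cont)
  then have "\<forall>\<^sub>F z in nhds zs. K * norm (Z z k0 us - zs) < \<delta>"
    using \<delta>(1) by (intro order_tendstoD) auto
  moreover have "\<forall>\<^sub>F z in nhds zs. \<forall>k\<in>{..<k0}. C1_near False A (\<theta> k, Z z k us, us)"
    by (intro eventually_ball_finite ballI near) auto
  ultimately show ?thesis
  proof eventually_elim
    case (elim z)
    define zk where "zk = (\<lambda>k. Z z k us)"
    have zkS: "zk (Suc k) = A (\<theta> k, zk k, us)" for k unfolding zk_def by (rule ZS)
    \<comment> \<open>N never exceeds its value at step k0, which is below \<delta>; since N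
      dominates the norm, the iterates stay where \<open>lin\<close> applies.\<close>
    have contract: "N (zk (k0 + n) - zs) \<le> q2 ^ n * N (zk k0 - zs)" for n
    proof (induction n)
      case (Suc n)
      have N0: "N (zk k0 - zs) < \<delta>" using N(3)[of "zk k0 - zs"] elim(1) unfolding zk_def by linarith
      have "q2 ^ n * N (zk k0 - zs) \<le> 1 * N (zk k0 - zs)"
        using q2 N(2)[of "zk k0 - zs"] norm_ge_zero[of "zk k0 - zs"]
        by (intro mult_right_mono power_le_one) linarith+
      then have dz: "dist (zk (k0 + n)) zs < \<delta>"
        using Suc N0 N(2)[of "zk (k0 + n) - zs"] by (simp add: dist_norm)
      let ?v = "zk (k0 + n) - zs"
      have "norm (zk (Suc (k0 + n)) - zs - blinfun_apply B ?v) \<le> \<epsilon> * norm ?v"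
        unfolding zkS using lin[OF k0 dz, of "k0 + n"] fix0 by simp
      also have "\<dots> \<le> \<epsilon> * N ?v" using \<epsilon> N(2) by simp
      finally have "N (zk (Suc (k0 + n)) - zs - blinfun_apply B ?v) \<le> K * (\<epsilon> * N ?v)"
        using N(1) by (intro order_trans[OF N(3)] mult_left_mono) auto
      then have "N (zk (Suc (k0 + n)) - zs) \<le> q2 * N ?v"
        using N(4)[of "blinfun_apply B ?v" "zk (Suc (k0 + n)) - zs - blinfun_apply B ?v"] N(5)[of ?v]
        by (simp add: q2_def algebra_simps)
      also have "\<dots> \<le> q2 * (q2 ^ n * N (zk k0 - zs))" using Suc q2 by simp
      finally show ?case by simp
    qed simp
    have N0: "0 \<le> N (zk k0 - zs)" "N (zk k0 - zs) < \<delta>"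
      using N(3)[of "zk k0 - zs"] N(2)[of "zk k0 - zs"] norm_ge_zero[of "zk k0 - zs"] elim(1)
      unfolding zk_def by linarith+
    have close: "dist (zk k) zs < \<delta>" if "k \<ge> k0" for k
    proof -
      have "q2 ^ (k - k0) * N (zk k0 - zs) \<le> 1 * N (zk k0 - zs)"
        using q2 N0 by (intro mult_right_mono power_le_one) auto
      then show ?thesis
        using contract[of "k - k0"] that N0 N(2)[of "zk k - zs"] by (simp add: dist_norm)
    qed
    have "(\<lambda>n. q2 ^ n * N (zk k0 - zs)) \<longlonglongrightarrow> 0 * N (zk k0 - zs)"
      by (intro tendsto_mult tendsto_const LIMSEQ_realpow_zero) (use q2 in auto)
    then have "(\<lambda>n. zk (n + k0) - zs) \<longlonglongrightarrow> 0"
      by (intro Lim_null_comparison[OF always_eventually[OF allI[OF order_trans[OF N(2)]]]])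
         (use contract in \<open>simp_all add: add.commute\<close>)
    then have zk: "zk \<longlonglongrightarrow> zs" by (simp add: LIM_zero_iff LIMSEQ_offset)
    have C1: "C1_near False A (\<theta> k, zk k, us)" for k
    proof (cases "k < k0")
      case True
      then show ?thesis using elim(2) by (simp add: zk_def)
    next
      case False
      then show ?thesis using \<delta>(2)[OF k0 close, of k k] C1_near_imp_False by auto
    qed
    define Dk where "Dk = (\<lambda>k. deriv_op (Z z k) us)"
    define Ak' where "Ak' = (\<lambda>k. A' (\<theta> k, zk k, us))"
    define Bk' where "Bk' = (\<lambda>k. A' (\<theta> k, zs, us))"
    have step: "(Z z (Suc k) has_derivative (\<lambda>h. blinfun_apply (Ak' k) (0, D' h, h))) (at us)"
      if "(Z z k has_derivative D') (at us)" for k D'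
    proof -
      have "((\<lambda>u. (\<theta> k, Z z k u, u)) has_derivative (\<lambda>h. (0, D' h, h))) (at us)"
        by (intro has_derivative_Pair has_derivative_const that has_derivative_ident)
      moreover have "(A has_derivative blinfun_apply (Ak' k)) (at (\<theta> k, Z z k us, us))"
        using diffA[OF C1[of k]] by (simp add: Ak'_def zk_def)
      ultimately have "((\<lambda>u. A (\<theta> k, Z z k u, u)) has_derivative (\<lambda>h. blinfun_apply (Ak' k) (0, D' h, h))) (at us)"
        by (rule has_derivative_compose)
      moreover have "Z z (Suc k) = (\<lambda>u. A (\<theta> k, Z z k u, u))" by (rule ext) (rule ZS)
      ultimately show ?thesis by simp
    qed
    have diff: "Z z k differentiable (at us)" for k
    proof (induction k)
      case 0
      have "Z z 0 = (\<lambda>u. z)" by (rule ext) (rule Z0)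
      then show ?case by simp
    next
      case (Suc k)
      then show ?case using step unfolding differentiable_def by blast
    qed
    have Dk: "(Z z k has_derivative blinfun_apply (Dk k)) (at us)" for k
      unfolding Dk_def by (rule has_derivative_deriv_op[OF diff])
    have DkS: "blinfun_apply (Dk (Suc k)) h = blinfun_apply (Ak' k) (0, blinfun_apply (Dk k) h, h)" for k h
      using has_derivative_unique[OF Dk step[OF Dk]] by metis
    have Dfix: "blinfun_apply (Bk' k) (0, blinfun_apply D h, h) = blinfun_apply D h" for k h
    proof -
      have "((\<lambda>u. (\<theta> k, \<psi> u, u)) has_derivative (\<lambda>h. (0, blinfun_apply D h, h))) (at us)"
        by (intro has_derivative_Pair has_derivative_const \<psi>(1) has_derivative_ident)
      moreover have "(A has_derivative blinfun_apply (Bk' k)) (at (\<theta> k, \<psi> us, us))"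
        using diffA[OF Ak[of k]] by (simp add: Bk'_def \<psi>(2))
      ultimately have "((\<lambda>u. A (\<theta> k, \<psi> u, u)) has_derivative (\<lambda>h. blinfun_apply (Bk' k) (0, blinfun_apply D h, h))) (at us)"
        by (rule has_derivative_compose)
      moreover have "\<forall>\<^sub>F u in at us. A (\<theta> k, \<psi> u, u) = \<psi> u"
        using fp[of k] by (auto simp: eventually_at_filter elim: eventually_mono)
      ultimately have "(\<psi> has_derivative (\<lambda>h. blinfun_apply (Bk' k) (0, blinfun_apply D h, h))) (at us)"
        by (rule has_derivative_transform_eventually) (use fix0[of k] \<psi>(2) in auto)
      from has_derivative_unique[OF this \<psi>(1)] show ?thesis by metis
    qed
    have lims: "Ak' \<longlonglongrightarrow> A' y0" "Bk' \<longlonglongrightarrow> A' y0"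
    proof -
      have "(\<lambda>k. (\<theta> k, zk k, us)) \<longlonglongrightarrow> y0" "(\<lambda>k. (\<theta> k, zs, us)) \<longlonglongrightarrow> y0"
        unfolding y0_def by (intro tendsto_intros \<theta> zk)+
      then show "Ak' \<longlonglongrightarrow> A' y0" "Bk' \<longlonglongrightarrow> A' y0"
        unfolding Ak'_def Bk'_def using filterlim_compose[OF A'c] by blast+
    qed
    define e where "e = (\<lambda>h k. blinfun_apply (Dk k) h - blinfun_apply D h)"
    define \<rho> where "\<rho> = (\<lambda>h k. blinfun_apply (Ak' k - Bk' k) (0, blinfun_apply D h, h))"
    have rec: "e h (Suc k) = blinfun_apply (Ak' k o\<^sub>L J) (e h k) + \<rho> h k" for h k
    proof -
      have "(0, blinfun_apply (Dk k) h, h) = blinfun_apply J (e h k) + (0, blinfun_apply D h, h)"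
        by (simp add: J e_def)
      then have "blinfun_apply (Dk (Suc k)) h
          = blinfun_apply (Ak' k) (blinfun_apply J (e h k)) + blinfun_apply (Ak' k) (0, blinfun_apply D h, h)"
        unfolding DkS by (simp only: blinfun.add_right)
      then show ?thesis unfolding e_def \<rho>_def
        by (simp add: blinfun.diff_left Dfix)
    qed
    then have rec': "\<forall>\<^sub>F k in sequentially. e h (Suc k) = blinfun_apply (Ak' k o\<^sub>L J) (e h k) + \<rho> h k" for h
      by simp
    have BkB: "(\<lambda>k. Ak' k o\<^sub>L J) \<longlonglongrightarrow> B"
      unfolding B_def
      by (intro bounded_bilinear.tendsto[OF bounded_bilinear_blinfun_compose] lims tendsto_const)
    have "\<rho> h \<longlonglongrightarrow> blinfun_apply (A' y0 - A' y0) (0, blinfun_apply D h, h)" for h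
      unfolding \<rho>_def by (intro blinfun.tendsto tendsto_diff lims tendsto_const)
    then have \<rho>0: "\<rho> h \<longlonglongrightarrow> 0" for h by simp
    have e0: "e h \<longlonglongrightarrow> 0" for h
      by (rule perturbed_recursion(1)[OF BkB rec' rB \<rho>0])
    have conv: "(\<lambda>k. blinfun_apply (deriv_op (Z z k) us) h) \<longlonglongrightarrow> blinfun_apply D h" for h
      using e0[of h] unfolding e_def Dk_def by (simp add: LIM_zero_iff)
    have rate: "\<exists>E. \<forall>\<^sub>F k in sequentially. norm (e h k) \<le> E * p ^ k"
      if b and p: "spectral_radius B < p" "0 < p"
        and zp: "\<forall>\<^sub>F k in sequentially. norm (zk k - zs) \<le> C * p ^ k" for p C h
    proof -
      obtain S C' where S: "open S" "y0 \<in> S" "C'-lipschitz_on S A'"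
        using r \<open>b\<close> unfolding loc_reg_def by auto
      have C': "C' \<ge> 0" using S(3) by (rule lipschitz_on_nonneg)
      have "(\<lambda>k. (\<theta> k, zk k, us)) \<longlonglongrightarrow> y0" "(\<lambda>k. (\<theta> k, zs, us)) \<longlonglongrightarrow> y0"
        unfolding y0_def by (intro tendsto_intros \<theta> zk)+
      then have "\<forall>\<^sub>F k in sequentially. (\<theta> k, zk k, us) \<in> S" "\<forall>\<^sub>F k in sequentially. (\<theta> k, zs, us) \<in> S"
        using S(1,2) topological_tendstoD by blast+
      with zp have "\<forall>\<^sub>F k in sequentially. norm (\<rho> h k) \<le> (C' * C * norm (0::'p, blinfun_apply D h, h)) * p ^ k"
      proof eventually_elim
        case (elim k)
        \<comment> \<open>Both operators are taken at the same parameter \<theta> k, which therefore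
          drops out of the distance of the two points.\<close>
        have "norm (Ak' k - Bk' k) \<le> C' * dist (\<theta> k, zk k, us) (\<theta> k, zs, us)"
          unfolding Ak'_def Bk'_def using lipschitz_onD[OF S(3) elim(2,3)] by (simp add: dist_norm)
        also have "dist (\<theta> k, zk k, us) (\<theta> k, zs, us) = norm (zk k - zs)"
          by (simp add: dist_Pair_Pair dist_norm)
        also have "C' * norm (zk k - zs) \<le> C' * (C * p ^ k)"
          using elim(1) C' by (intro mult_left_mono) auto
        finally have "norm (Ak' k - Bk' k) \<le> C' * (C * p ^ k)" .
        then have "norm (\<rho> h k) \<le> C' * (C * p ^ k) * norm (0::'p, blinfun_apply D h, h)"
          unfolding \<rho>_def by (intro order_trans[OF norm_blinfun] mult_right_mono) auto
        then show ?case by (simp add: mult_ac)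
      qed
      then show ?thesis by (rule perturbed_recursion(2)[OF BkB rec' p])
    qed
    show ?case
      using diff conv rate unfolding B e_def Dk_def zk_def by blast
  qed
qed

section \<open>Normals and subgradients\<close>

lemma regular_normals_add:
  assumes "v \<in> regular_normals C x" "w \<in> regular_normals C x"
  shows "v + w \<in> regular_normals C x"
  unfolding regular_normals_def
proof clarify
  fix e :: real assume "e > 0"
  then have "\<forall>\<^sub>F y in at x within C. v \<bullet> (y - x) \<le> e / 2 * norm (y - x)"
    and "\<forall>\<^sub>F y in at x within C. w \<bullet> (y - x) \<le> e / 2 * norm (y - x)"
    using assms unfolding regular_normals_def by (auto dest!: spec[of _ "e / 2"])
  then show "\<forall>\<^sub>F y in at x within C. (v + w) \<bullet> (y - x) \<le> e * norm (y - x)"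
    by eventually_elim (simp add: inner_add_left)
qed

lemma regular_normals_scale:
  assumes "v \<in> regular_normals C x" "c > 0"
  shows "c *\<^sub>R v \<in> regular_normals C x"
  unfolding regular_normals_def
proof clarify
  fix e :: real assume "e > 0"
  then have "e / c > 0" using assms(2) by simp
  then have "\<forall>\<^sub>F y in at x within C. v \<bullet> (y - x) \<le> e / c * norm (y - x)"
    using assms(1) unfolding regular_normals_def by blast
  then show "\<forall>\<^sub>F y in at x within C. (c *\<^sub>R v) \<bullet> (y - x) \<le> e * norm (y - x)"
    by eventually_elim (use assms(2) in \<open>simp add: field_simps\<close>)
qed

lemma regular_normals_of_le:
  assumes "\<And>y. y \<in> C \<Longrightarrow> v \<bullet> (y - x) \<le> 0"
  shows "v \<in> regular_normals C x"
  unfolding regular_normals_def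
proof clarify
  fix e :: real assume "e > 0"
  then have "v \<bullet> (y - x) \<le> e * norm (y - x)" if "y \<in> C" for y
    using assms[OF that] by (simp add: order_trans[of _ 0])
  then show "\<forall>\<^sub>F y in at x within C. v \<bullet> (y - x) \<le> e * norm (y - x)"
    by (simp add: eventually_at_filter)
qed

text \<open>Along the segment from x to y both sides of the defining inequality are homogeneous in
  t, so dividing by t turns the infinitesimal condition into a global one; the tolerance is then
  sent to 0.\<close>

lemma regular_normals_convexD:
  assumes C: "convex C" and x: "x \<in> C" and v: "v \<in> regular_normals C x" and y: "y \<in> C"
  shows "v \<bullet> (y - x) \<le> 0"
proof (cases "y = x")
  case False
  have "v \<bullet> (y - x) \<le> 0 + e" if e: "e > 0" for e
  proof -
    define d where "d = e / norm (y - x)"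
    have d: "d > 0" using e False by (simp add: d_def)
    have "\<forall>\<^sub>F z in at x within C. v \<bullet> (z - x) \<le> d * norm (z - x)"
      using v d unfolding regular_normals_def by auto
    then obtain r where r: "r > 0"
      "\<And>z. z \<in> C \<Longrightarrow> z \<noteq> x \<Longrightarrow> dist z x < r \<Longrightarrow> v \<bullet> (z - x) \<le> d * norm (z - x)"
      unfolding eventually_at by auto
    define t where "t = min 1 (r / (2 * norm (y - x)))"
    have t: "0 < t" "t \<le> 1" using r False unfolding t_def by auto
    have tr: "t * norm (y - x) < r"
    proof -
      have "t * norm (y - x) \<le> r / (2 * norm (y - x)) * norm (y - x)"
        unfolding t_def by (intro mult_right_mono) auto
      also have "\<dots> = r / 2" using False by simp
      finally show ?thesis using r(1) by simp
    qed
    have "x + t *\<^sub>R (y - x) \<in> C"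
      using convexD_alt[OF C x y, of t] t by (simp add: algebra_simps)
    then have "v \<bullet> (t *\<^sub>R (y - x)) \<le> d * norm (t *\<^sub>R (y - x))"
      using r(2)[of "x + t *\<^sub>R (y - x)"] t tr False by (simp add: dist_norm)
    then have "t * (v \<bullet> (y - x)) \<le> t * (d * norm (y - x))" using t by (simp add: mult_ac)
    then have "v \<bullet> (y - x) \<le> d * norm (y - x)" using t by simp
    then show ?thesis using False by (simp add: d_def)
  qed
  then show ?thesis by (rule field_le_epsilon)
qed simp

text \<open>Global inequalities survive limits, so for a convex set limiting normals are normals in
  the sense of convex analysis.\<close>

lemma limiting_normals_convexD:
  assumes C: "convex C" and v: "v \<in> limiting_normals C x" and y: "y \<in> C"
  shows "v \<bullet> (y - x) \<le> 0"
proof -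
  obtain z w where z: "\<And>n::nat. z n \<in> C" "\<And>n. w n \<in> regular_normals C (z n)" "z \<longlonglongrightarrow> x" "w \<longlonglongrightarrow> v"
    using v unfolding limiting_normals_def by auto
  have "(\<lambda>n. w n \<bullet> (y - z n)) \<longlonglongrightarrow> v \<bullet> (y - x)"
    by (intro tendsto_intros z)
  then show ?thesis
    by (rule LIMSEQ_le_const2) (use regular_normals_convexD[OF C] z y in blast)
qed

lemma regular_normals_subset_limiting: "x \<in> C \<Longrightarrow> regular_normals C x \<subseteq> limiting_normals C x"
proof
  fix v assume "x \<in> C" "v \<in> regular_normals C x"
  then show "v \<in> limiting_normals C x"
    unfolding limiting_normals_def
    by (intro CollectI exI[of _ "\<lambda>n::nat. x"] exI[of _ "\<lambda>n::nat. v"]) simp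
qed

lemma limiting_normals_scale:
  assumes "v \<in> limiting_normals C x" "c > 0"
  shows "c *\<^sub>R v \<in> limiting_normals C x"
proof -
  obtain z w where z: "\<And>n::nat. z n \<in> C" "\<And>n. w n \<in> regular_normals C (z n)" "z \<longlonglongrightarrow> x" "w \<longlonglongrightarrow> v"
    using assms(1) unfolding limiting_normals_def by auto
  have "(\<lambda>n. c *\<^sub>R w n) \<longlonglongrightarrow> c *\<^sub>R v" by (intro tendsto_intros z)
  then show ?thesis
    unfolding limiting_normals_def
    using z(1,3) regular_normals_scale[OF z(2) assms(2)]
    by (intro CollectI exI[of _ z] exI[of _ "\<lambda>n. c *\<^sub>R w n"]) simp
qed

text \<open>Slopes of global affine minorants that touch h at x; for convex h this is
  \<open>subdiff\<close>. The sections of \<open>g\<close> at fixed u are treated in this form,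
  because proximal points are identified by global inequalities.\<close>

definition convex_subgradients :: "('a::real_inner \<Rightarrow> ereal) \<Rightarrow> 'a \<Rightarrow> 'a set" where
  "convex_subgradients h x = {v. \<bar>h x\<bar> \<noteq> \<infinity> \<and> (\<forall>y. h x + ereal (v \<bullet> (y - x)) \<le> h y)}"

lemma epi_inner_imp_subgradient:
  assumes fin: "\<bar>h x\<bar> \<noteq> \<infinity>"
    and le: "\<And>y r. (y, r) \<in> epi h \<Longrightarrow> (v, -1) \<bullet> ((y, r) - (x, real_of_ereal (h x))) \<le> 0"
  shows "v \<in> convex_subgradients h x"
proof -
  obtain a where a: "h x = ereal a" using fin by (cases "h x") auto
  have "h x + ereal (v \<bullet> (y - x)) \<le> h y" for y
  proof -
    have *: "a + v \<bullet> (y - x) \<le> r" if "h y \<le> ereal r" for r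
      using le[of y r] that a by (simp add: epi_def)
    have "ereal (a + v \<bullet> (y - x)) \<le> h y"
    proof (cases "h y")
      case MInf
      \<comment> \<open>At h y = -\<infinity> the bound \<open>*\<close> would hold for every real
        r; the value one below its left side refutes it.\<close>
      then show ?thesis using *[of "a + v \<bullet> (y - x) - 1"] by simp
    qed (use * in auto)
    then show ?thesis using a by simp
  qed
  then show ?thesis unfolding convex_subgradients_def using fin by simp
qed

lemma subdiff_eq_convex_subgradients:
  assumes "convex_fun h"
  shows "subdiff h x = convex_subgradients h x"
proof
  show "subdiff h x \<subseteq> convex_subgradients h x"
  proof
    fix v assume "v \<in> subdiff h x"
    then have v: "\<bar>h x\<bar> \<noteq> \<infinity>" "(v, -1) \<in> limiting_normals (epi h) (x, real_of_ereal (h x))"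
      unfolding subdiff_def by auto
    have "convex (epi h)" using assms by (simp add: convex_fun_def)
    show "v \<in> convex_subgradients h x"
      by (rule epi_inner_imp_subgradient[where h = h and x = x, OF v(1)]) (rule limiting_normals_convexD[OF \<open>convex (epi h)\<close> v(2)])
  qed
  show "convex_subgradients h x \<subseteq> subdiff h x"
  proof
    fix v assume v: "v \<in> convex_subgradients h x"
    then obtain a where a: "h x = ereal a" unfolding convex_subgradients_def by (cases "h x") auto
    have "(v, -1) \<bullet> ((y, r) - (x, a)) \<le> 0" if yr: "(y, r) \<in> epi h" for y r
    proof -
      have "ereal (a + v \<bullet> (y - x)) \<le> h y" using v a unfolding convex_subgradients_def by auto
      also have "\<dots> \<le> ereal r" using yr by (simp add: epi_def)
      finally show ?thesis by simp
    qed
    then have "(v, -1) \<in> regular_normals (epi h) (x, a)"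
      by (intro regular_normals_of_le) auto
    moreover have "(x, a) \<in> epi h" using a by (simp add: epi_def)
    ultimately show "v \<in> subdiff h x"
      using regular_normals_subset_limiting a unfolding subdiff_def by fastforce
  qed
qed

lemma closed_convex_subgradients: "closed (convex_subgradients h x)"
proof (cases "\<bar>h x\<bar> = \<infinity>")
  case False
  then obtain a where a: "h x = ereal a" by (cases "h x") auto
  have *: "closed {v. h x + ereal (v \<bullet> (y - x)) \<le> h y}" for y
  proof (cases "h y")
    case (real b)
    then have "{v. h x + ereal (v \<bullet> (y - x)) \<le> h y} = {v. a + v \<bullet> (y - x) \<le> b}" using a by simp
    also have "closed \<dots>" by (intro closed_Collect_le continuous_intros)
    finally show ?thesis .
  qed (use a in auto)
  have "convex_subgradients h x = (\<Inter>y. {v. h x + ereal (v \<bullet> (y - x)) \<le> h y})"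
    unfolding convex_subgradients_def using False by auto
  then show ?thesis using * by auto
qed (simp add: convex_subgradients_def)

lemma convex_convex_subgradients: "convex (convex_subgradients h x)"
proof (cases "\<bar>h x\<bar> = \<infinity>")
  case False
  then obtain a where a: "h x = ereal a" by (cases "h x") auto
  have *: "convex {v. h x + ereal (v \<bullet> (y - x)) \<le> h y}" for y
  proof (cases "h y")
    case (real b)
    then have "{v. h x + ereal (v \<bullet> (y - x)) \<le> h y} = {v. (y - x) \<bullet> v \<le> b - a}"
      using a by (auto simp: inner_commute algebra_simps)
    also have "convex \<dots>" by (rule convex_halfspace_le)
    finally show ?thesis .
  qed (use a in auto)
  have "convex_subgradients h x = (\<Inter>y. {v. h x + ereal (v \<bullet> (y - x)) \<le> h y})"
    unfolding convex_subgradients_def using False by auto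
  then show ?thesis using * by (auto intro: convex_INT)
qed (simp add: convex_subgradients_def)

lemma convex_fun_add_real:
  assumes \<phi>: "convex_on UNIV \<phi>" and h: "convex_fun h"
  shows "convex_fun (\<lambda>x. ereal (\<phi> x) + h x)"
proof -
  have iff: "ereal a + t \<le> ereal r \<longleftrightarrow> t \<le> ereal (r - a)" for a r t
    by (cases t) auto
  have epi: "epi (\<lambda>x. ereal (\<phi> x) + h x) = {(x, r). (x, r - \<phi> x) \<in> epi h}"
    unfolding epi_def by (auto simp: iff)
  have "convex {(x, r). (x, r - \<phi> x) \<in> epi h}"
    unfolding convex_def
  proof clarsimp
    fix x r y s and a b :: real
    assume 1: "(x, r - \<phi> x) \<in> epi h" "(y, s - \<phi> y) \<in> epi h" and ab: "0 \<le> a" "0 \<le> b" "a + b = 1"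
    have "a *\<^sub>R (x, r - \<phi> x) + b *\<^sub>R (y, s - \<phi> y) \<in> epi h"
      using h 1 ab unfolding convex_fun_def convex_def by blast
    then have "h (a *\<^sub>R x + b *\<^sub>R y) \<le> ereal (a * (r - \<phi> x) + b * (s - \<phi> y))"
      by (simp add: epi_def)
    also have "\<dots> \<le> ereal (a * r + b * s - \<phi> (a *\<^sub>R x + b *\<^sub>R y))"
    proof -
      have a: "a = 1 - b" using ab by simp
      then have "\<phi> (a *\<^sub>R x + b *\<^sub>R y) \<le> a * \<phi> x + b * \<phi> y"
        unfolding a using convex_onD[OF \<phi>, of b x y] ab by simp
      then show ?thesis by (simp add: algebra_simps)
    qed
    finally show "(a *\<^sub>R x + b *\<^sub>R y, a * r + b * s - \<phi> (a *\<^sub>R x + b *\<^sub>R y)) \<in> epi h"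
      by (simp add: epi_def)
  qed
  then show ?thesis unfolding convex_fun_def epi .
qed

lemma line_difference_quotient:
  fixes \<phi> :: "'a::real_inner \<Rightarrow> real"
  assumes "GDERIV \<phi> x :> d"
  shows "((\<lambda>t. (\<phi> (x + t *\<^sub>R v) - \<phi> x) / t) \<longlongrightarrow> d \<bullet> v) (at_right 0)"
proof -
  have "(\<phi> has_derivative (\<lambda>h. h \<bullet> d)) (at (x + 0 *\<^sub>R v))"
    using assms by (simp add: gderiv_def)
  moreover have "((\<lambda>t. x + t *\<^sub>R v) has_derivative (\<lambda>t. t *\<^sub>R v)) (at 0)"
    by (auto intro!: derivative_eq_intros)
  ultimately have "((\<lambda>t. \<phi> (x + t *\<^sub>R v)) has_derivative (\<lambda>t. (t *\<^sub>R v) \<bullet> d)) (at 0)"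
    by (rule has_derivative_compose[rotated])
  then have "((\<lambda>t. \<phi> (x + t *\<^sub>R v)) has_real_derivative (d \<bullet> v)) (at 0)"
    by (simp add: has_field_derivative_def inner_commute mult_commute_abs)
  then show ?thesis
    using filterlim_at_split by (auto simp: DERIV_def)
qed

text \<open>For the inclusion from left to right, v is tested on the segment from x to y: convexity
  bounds h along it by the chord, and the difference quotient of \<phi> tends to its directional
  derivative as the segment shrinks. The converse adds the tangent inequality of the convex function
  \<phi>.\<close>

lemma convex_subgradients_add_smooth:
  fixes \<phi> :: "'a::real_inner \<Rightarrow> real"
  assumes \<phi>: "convex_on UNIV \<phi>" and d: "GDERIV \<phi> x :> d" and h: "convex_fun h" and hm: "\<And>y. h y \<noteq> - \<infinity>"
  shows "convex_subgradients (\<lambda>x. ereal (\<phi> x) + h x) x = (\<lambda>v. d + v) ` convex_subgradients h x"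
proof -
  have 1: "v - d \<in> convex_subgradients h x"
    if v: "v \<in> convex_subgradients (\<lambda>x. ereal (\<phi> x) + h x) x" for v
  proof -
    obtain a where a: "h x = ereal a" using v unfolding convex_subgradients_def by (cases "h x") auto
    have "ereal (a + (v - d) \<bullet> (y - x)) \<le> h y" for y
    proof (cases "h y")
      case (real b)
      have le: "v \<bullet> (y - x) - (b - a) \<le> (\<phi> (x + t *\<^sub>R (y - x)) - \<phi> x) / t" if t: "0 < t" "t < 1" for t
      proof -
        have "(1 - t) *\<^sub>R (x, a) + t *\<^sub>R (y, b) \<in> epi h"
          using h t a real unfolding convex_fun_def by (intro convexD) (auto simp: epi_def)
        then have "h (x + t *\<^sub>R (y - x)) \<le> ereal (a + t * (b - a))"
          by (simp add: epi_def algebra_simps)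
        then have "ereal (\<phi> (x + t *\<^sub>R (y - x))) + h (x + t *\<^sub>R (y - x)) \<le> ereal (\<phi> (x + t *\<^sub>R (y - x)) + (a + t * (b - a)))"
          by (cases "h (x + t *\<^sub>R (y - x))") auto
        moreover have "ereal (\<phi> x) + h x + ereal (v \<bullet> (x + t *\<^sub>R (y - x) - x))
            \<le> ereal (\<phi> (x + t *\<^sub>R (y - x))) + h (x + t *\<^sub>R (y - x))"
          using v unfolding convex_subgradients_def by blast
        ultimately have "ereal (\<phi> x) + h x + ereal (v \<bullet> (x + t *\<^sub>R (y - x) - x))
            \<le> ereal (\<phi> (x + t *\<^sub>R (y - x)) + (a + t * (b - a)))"
          by (rule order_trans[rotated])
        then have "ereal (\<phi> x + a + t * (v \<bullet> (y - x))) \<le> ereal (\<phi> (x + t *\<^sub>R (y - x)) + (a + t * (b - a)))"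
          unfolding a by simp
        then have "t * (v \<bullet> (y - x) - (b - a)) \<le> \<phi> (x + t *\<^sub>R (y - x)) - \<phi> x"
          by (simp add: algebra_simps)
        then show ?thesis using t by (simp add: pos_le_divide_eq mult.commute)
      qed
      have "\<forall>\<^sub>F t in at_right (0::real). 0 < t \<and> t < 1"
        by (auto simp: eventually_at_right_field intro!: exI[of _ 1])
      then have "\<forall>\<^sub>F t in at_right 0. v \<bullet> (y - x) - (b - a) \<le> (\<phi> (x + t *\<^sub>R (y - x)) - \<phi> x) / t"
        by eventually_elim (use le in blast)
      then have "v \<bullet> (y - x) - (b - a) \<le> d \<bullet> (y - x)"
        by (intro tendsto_lowerbound[OF line_difference_quotient[OF d]]) auto
      then show ?thesis using real by (simp add: inner_diff_left)
    qed (use hm in auto)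
    then show ?thesis using a unfolding convex_subgradients_def by auto
  qed
  have 2: "d + v \<in> convex_subgradients (\<lambda>x. ereal (\<phi> x) + h x) x"
    if v: "v \<in> convex_subgradients h x" for v
  proof -
    obtain a where a: "h x = ereal a" using v unfolding convex_subgradients_def by (cases "h x") auto
    have tangent: "\<phi> x + d \<bullet> (y - x) \<le> \<phi> y" for y
    proof -
      have le: "(\<phi> (x + t *\<^sub>R (y - x)) - \<phi> x) / t \<le> \<phi> y - \<phi> x" if t: "0 < t" "t < 1" for t
      proof -
        have "\<phi> (x + t *\<^sub>R (y - x)) \<le> (1 - t) * \<phi> x + t * \<phi> y"
          using convex_onD[OF \<phi>, of t x y] t by (simp add: algebra_simps)
        then have "\<phi> (x + t *\<^sub>R (y - x)) - \<phi> x \<le> (\<phi> y - \<phi> x) * t" by (simp add: algebra_simps)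
        then show ?thesis using t by (simp add: pos_divide_le_eq)
      qed
      have "\<forall>\<^sub>F t in at_right (0::real). 0 < t \<and> t < 1"
        by (auto simp: eventually_at_right_field intro!: exI[of _ 1])
      then have "\<forall>\<^sub>F t in at_right 0. (\<phi> (x + t *\<^sub>R (y - x)) - \<phi> x) / t \<le> \<phi> y - \<phi> x"
        by eventually_elim (use le in blast)
      then have "d \<bullet> (y - x) \<le> \<phi> y - \<phi> x"
        by (intro tendsto_upperbound[OF line_difference_quotient[OF d]]) auto
      then show ?thesis by simp
    qed
    have "ereal (\<phi> x) + h x + ereal ((d + v) \<bullet> (y - x)) \<le> ereal (\<phi> y) + h y" for y
    proof -
      have "h x + ereal (v \<bullet> (y - x)) \<le> h y" using v unfolding convex_subgradients_def by auto
      then show ?thesis using tangent[of y] a by (cases "h y") (auto simp: inner_add_left)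
    qed
    then show ?thesis using a unfolding convex_subgradients_def by auto
  qed
  show ?thesis
  proof
    show "convex_subgradients (\<lambda>x. ereal (\<phi> x) + h x) x \<subseteq> (\<lambda>v. d + v) ` convex_subgradients h x"
    proof
      fix v assume "v \<in> convex_subgradients (\<lambda>x. ereal (\<phi> x) + h x) x"
      from 1[OF this] show "v \<in> (\<lambda>v. d + v) ` convex_subgradients h x"
        by (intro image_eqI[of _ _ "v - d"]) auto
    qed
    show "(\<lambda>v. d + v) ` convex_subgradients h x \<subseteq> convex_subgradients (\<lambda>x. ereal (\<phi> x) + h x) x"
      using 2 by auto
  qed
qed

section \<open>Semicontinuity and minimizers\<close>

text \<open>\<open>Liminf (at x)\<close> ignores the value at x itself, which the hypothesis
  supplies separately.\<close>

lemma lsc_fun_eventually: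
  assumes "lsc_fun h" "c < h x"
  shows "\<forall>\<^sub>F y in nhds x. c < h y"
proof -
  have "c < Liminf (at x) h"
    using assms unfolding lsc_fun_def by (meson less_le_trans)
  then have "\<forall>\<^sub>F y in at x. c < h y" by (rule less_LiminfD)
  then show ?thesis
    using assms(2) by (auto simp: eventually_at_filter elim: eventually_mono)
qed

lemma lsc_fun_add_continuous:
  fixes h :: "'a::metric_space \<Rightarrow> ereal"
  assumes h: "lsc_fun h" and hm: "\<And>x. h x \<noteq> - \<infinity>" and k: "continuous_on UNIV k"
  shows "lsc_fun (\<lambda>x. h x + ereal (k x))"
  unfolding lsc_fun_def
proof (intro allI le_Liminf_iff[THEN iffD2] impI)
  fix x c assume c: "c < h x + ereal (k x)"
  have "isCont k x" using k by (simp add: continuous_on_eq_continuous_at)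
  then have kx: "(k \<longlongrightarrow> k x) (nhds x)" by (simp add: isCont_def tendsto_at_iff_tendsto_nhds)
  have "\<forall>\<^sub>F y in nhds x. c < h y + ereal (k y)"
  proof (cases c)
    case (real r)
    obtain e where e: "e > 0" "ereal (r - k x + e) < h x"
    proof (cases "h x")
      case (real a)
      then have "r - k x < a" using c \<open>c = ereal r\<close> by auto
      then show ?thesis using that[of "(a - (r - k x)) / 2"] real by (auto simp: field_simps)
    qed (use that[of 1] hm in auto)
    have "\<forall>\<^sub>F y in nhds x. k x - e < k y"
      using kx e(1) by (intro order_tendstoD) auto
    with lsc_fun_eventually[OF h e(2)] show ?thesis
    proof eventually_elim
      case (elim y)
      then show ?case using real by (cases "h y") auto
    qed
  next
    case MInf
    have "c < h y + ereal (k y)" for y using hm[of y] MInf by (cases "h y") auto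
    then show ?thesis by simp
  qed (use c in auto)
  then show "\<forall>\<^sub>F y in at x. c < h y + ereal (k y)"
    by (auto simp: eventually_at_filter elim: eventually_mono)
qed

text \<open>If every value on K exceeded the infimum m, lower semicontinuity would cover K by open
  sets on each of which h stays above some level greater than m; a finite subcover gives one such
  level for all of K.\<close>

lemma lsc_fun_attains_min:
  assumes h: "lsc_fun h" and K: "compact K" "K \<noteq> {}"
  obtains x where "x \<in> K" "\<And>y. y \<in> K \<Longrightarrow> h x \<le> (h y :: ereal)"
proof -
  define m where "m = Inf (h ` K)"
  have "\<exists>x\<in>K. h x \<le> m"
  proof (rule ccontr)
    assume "\<not> ?thesis"
    then have "\<forall>x\<in>K. \<exists>c. m < c \<and> c < h x" using dense by (auto simp: not_le)
    then obtain c where c: "\<And>x. x \<in> K \<Longrightarrow> m < c x" "\<And>x. x \<in> K \<Longrightarrow> c x < h x" by metis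
    have "\<forall>x\<in>K. \<exists>S. open S \<and> x \<in> S \<and> (\<forall>y\<in>S. c x < h y)"
      using lsc_fun_eventually[OF h c(2)] unfolding eventually_nhds by blast
    then obtain S where S: "\<And>x. x \<in> K \<Longrightarrow> open (S x) \<and> x \<in> S x \<and> (\<forall>y\<in>S x. c x < h y)" by metis
    obtain D where D: "D \<subseteq> K" "finite D" "K \<subseteq> (\<Union>x\<in>D. S x)"
      by (rule compactE_image[OF K(1), of K S]) (use S in auto)
    have D0: "D \<noteq> {}" using D K(2) by auto
    define c0 where "c0 = Min (c ` D)"
    have "m < c0" unfolding c0_def using D D0 c(1) by (subst Min_gr_iff) auto
    moreover have "c0 \<le> m"
      unfolding m_def
    proof (rule Inf_greatest, clarify)
      fix y assume "y \<in> K"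
      then obtain x where x: "x \<in> D" "y \<in> S x" using D by auto
      have "c0 \<le> c x" unfolding c0_def using D x by simp
      also have "\<dots> \<le> h y" using S x D by (meson less_imp_le subsetD)
      finally show "c0 \<le> h y" .
    qed
    ultimately show False by simp
  qed
  then obtain x where x: "x \<in> K" "h x \<le> m" by auto
  show thesis
    by (rule that[OF x(1)]) (use x(2) in \<open>auto simp: m_def intro: order_trans Inf_lower\<close>)
qed


section \<open>Subgradients of a partly smooth function with convex sections\<close>

lemma affine_parallel_diff:
  assumes "affine_parallel S N" "subspace N" "a \<in> S" "b \<in> S"
  shows "a - b \<in> N"
proof -
  obtain c where "N = (\<lambda>x. c + x) ` S" using assms(1) unfolding affine_parallel_def by auto
  then have "c + a \<in> N" "c + b \<in> N" using assms by auto
  then have "(c + a) - (c + b) \<in> N" using assms(2) by (intro subspace_diff)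
  then show ?thesis by simp
qed

lemma affine_parallel_add:
  assumes "affine_parallel S N" "subspace N" "a \<in> S" "n \<in> N"
  shows "a + n \<in> S"
proof -
  obtain c where c: "N = (\<lambda>x. c + x) ` S" using assms(1) unfolding affine_parallel_def by auto
  then have "c + a \<in> N" using assms by auto
  then have "(c + a) + n \<in> N" by (rule subspace_add[OF assms(2) _ assms(4)])
  then obtain s where "s \<in> S" "c + a + n = c + s" using c by auto
  then show ?thesis by (simp add: add.assoc)
qed

lemma normal_space_iff: "n \<in> normal_space M x \<longleftrightarrow> (\<forall>v\<in>tangent_space M x. v \<bullet> n = 0)"
  unfolding normal_space_def orthogonal_comp_def orthogonal_def by simp

lemma subspace_normal_space: "subspace (normal_space M x)"
  unfolding normal_space_def by (rule subspace_orthogonal_comp)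

lemma tendsto_of_has_vector_derivative:
  assumes "(\<gamma> has_vector_derivative v) (at 0)"
  shows "(\<gamma> \<longlongrightarrow> \<gamma> 0) (nhds 0)"
  using has_vector_derivative_continuous[OF assms]
  by (simp add: continuous_within tendsto_at_iff_tendsto_nhds)

text \<open>Since \<Omega> is open, every u-direction is tangent to the product, so its normals have
  no u-component. This rigidity of the u-part is what the lifting of subgradients exploits.\<close>

lemma normal_space_Times:
  fixes M :: "'x::euclidean_space set" and \<Omega> :: "'u::euclidean_space set"
  assumes "open \<Omega>" "u \<in> \<Omega>" "x \<in> M"
  shows "normal_space (M \<times> \<Omega>) (x, u) = {(n, w). n \<in> normal_space M x \<and> w = 0}"
proof -
  have t1: "v \<in> tangent_space M x" if vw: "(v, w) \<in> tangent_space (M \<times> \<Omega>) (x, u)" for v w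
  proof -
    obtain \<gamma> where \<gamma>: "\<gamma> 0 = (x, u)" "\<forall>\<^sub>F t in nhds 0. \<gamma> t \<in> M \<times> \<Omega>"
      "(\<gamma> has_vector_derivative (v, w)) (at 0)"
      using vw unfolding tangent_space_def curve_at_def by auto
    have "((\<lambda>t. fst (\<gamma> t)) has_vector_derivative v) (at 0)"
      using bounded_linear.has_vector_derivative[OF bounded_linear_fst \<gamma>(3)] by simp
    moreover have "\<forall>\<^sub>F t in nhds 0. fst (\<gamma> t) \<in> M" using \<gamma>(2) by eventually_elim auto
    ultimately show ?thesis
      using \<gamma>(1) unfolding tangent_space_def curve_at_def by (intro CollectI exI[of _ "\<lambda>t. fst (\<gamma> t)"]) simp
  qed
  have t2: "(v, 0) \<in> tangent_space (M \<times> \<Omega>) (x, u)" if v: "v \<in> tangent_space M x" for v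
  proof -
    obtain \<gamma> where \<gamma>: "\<gamma> 0 = x" "\<forall>\<^sub>F t in nhds 0. \<gamma> t \<in> M" "(\<gamma> has_vector_derivative v) (at 0)"
      using v unfolding tangent_space_def curve_at_def by auto
    have "((\<lambda>t. (\<gamma> t, u)) has_vector_derivative (v, 0)) (at 0)"
      using has_vector_derivative_Pair[OF \<gamma>(3) has_vector_derivative_const[of u]] by simp
    moreover have "\<forall>\<^sub>F t in nhds 0. (\<gamma> t, u) \<in> M \<times> \<Omega>" using \<gamma>(2) by eventually_elim (use assms in auto)
    ultimately show ?thesis
      using \<gamma>(1) unfolding tangent_space_def curve_at_def by (intro CollectI exI[of _ "\<lambda>t. (\<gamma> t, u)"]) simp
  qed
  have t3: "(0, w) \<in> tangent_space (M \<times> \<Omega>) (x, u)" for w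
  proof -
    have d: "((\<lambda>t. u + t *\<^sub>R w) has_vector_derivative w) (at 0)"
      by (auto intro!: derivative_eq_intros)
    have "((\<lambda>t. (x, u + t *\<^sub>R w)) has_vector_derivative (0, w)) (at 0)"
      using has_vector_derivative_Pair[OF has_vector_derivative_const[of x] d] by simp
    moreover have "\<forall>\<^sub>F t in nhds 0. u + t *\<^sub>R w \<in> \<Omega>"
      using tendsto_of_has_vector_derivative[OF d] assms(1,2) by (auto dest: topological_tendstoD)
    then have "\<forall>\<^sub>F t in nhds 0. (x, u + t *\<^sub>R w) \<in> M \<times> \<Omega>"
      by eventually_elim (use assms in auto)
    ultimately show ?thesis
      unfolding tangent_space_def curve_at_def by (intro CollectI exI[of _ "\<lambda>t. (x, u + t *\<^sub>R w)"]) simp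
  qed
  show ?thesis
  proof (intro set_eqI iffI; clarify)
    fix n w assume nw: "(n, w) \<in> normal_space (M \<times> \<Omega>) (x, u)"
    have "v \<bullet> n = 0" if "v \<in> tangent_space M x" for v
      using nw t2[OF that] unfolding normal_space_iff by fastforce
    moreover have "w \<bullet> w = 0"
      using nw t3[of w] unfolding normal_space_iff by fastforce
    ultimately show "n \<in> normal_space M x \<and> w = 0" by (simp add: normal_space_iff)
  next
    fix n assume "n \<in> normal_space M x"
    then show "(n, 0) \<in> normal_space (M \<times> \<Omega>) (x, u)"
      using t1 unfolding normal_space_iff by auto
  qed
qed

section \<open>Joint subgradients of \<open>g\<close> and subgradients of its sections\<close>

locale partly_smooth_composite =
  fixes f :: "'x::euclidean_space \<times> 'u::euclidean_space \<Rightarrow> real"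
    and g :: "'x \<times> 'u \<Rightarrow> ereal"
    and M :: "'x set" and \<Omega> :: "'u set" and xs :: 'x and us :: 'u
  assumes \<Omega>: "open \<Omega>"
    and f_C2: "Ck_on 2 f UNIV"
    and g_proper: "proper_fun g" and g_lsc: "lsc_fun g"
    and g_ps: "partly_smooth g (M \<times> \<Omega>)"
    and f_convex: "\<And>u. u \<in> \<Omega> \<Longrightarrow> convex_on UNIV (\<lambda>x. f (x, u))"
    and g_convex: "\<And>u. u \<in> \<Omega> \<Longrightarrow> convex_fun (\<lambda>x. g (x, u))"
    and xs: "xs \<in> M" and us: "us \<in> \<Omega>"
    and nondegenerate: "0 \<in> rel_interior (subdiff (\<lambda>x. ereal (f (x, us)) + g (x, us)) xs)"
begin

abbreviation "Q x u \<equiv> convex_subgradients (\<lambda>y. g (y, u)) x"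

lemma g_not_MInf: "g z \<noteq> - \<infinity>"
  using g_proper unfolding proper_fun_def by blast

lemma g_regular: "x \<in> M \<Longrightarrow> u \<in> \<Omega> \<Longrightarrow> regular_at g (x, u)"
  and subdiff_nonempty: "x \<in> M \<Longrightarrow> u \<in> \<Omega> \<Longrightarrow> subdiff g (x, u) \<noteq> {}"
  and g_parallel: "x \<in> M \<Longrightarrow> u \<in> \<Omega> \<Longrightarrow> affine_parallel (affine hull (subdiff g (x, u))) (normal_space (M \<times> \<Omega>) (x, u))"
  and g_PK: "x \<in> M \<Longrightarrow> u \<in> \<Omega> \<Longrightarrow> PK_continuous_at (M \<times> \<Omega>) (subdiff g) (x, u)"
  and g_C2: "x \<in> M \<Longrightarrow> u \<in> \<Omega> \<Longrightarrow> C2_along (M \<times> \<Omega>) g (x, u)"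
  using g_ps unfolding partly_smooth_def by (auto dest!: bspec[of _ _ "(x, u)"] eventually_nhds_x_imp_x)

lemma g_finite: "x \<in> M \<Longrightarrow> u \<in> \<Omega> \<Longrightarrow> \<bar>g (x, u)\<bar> \<noteq> \<infinity>"
  using g_regular unfolding regular_at_def by auto

lemma g_real: "x \<in> M \<Longrightarrow> u \<in> \<Omega> \<Longrightarrow> g (x, u) = ereal (real_of_ereal (g (x, u)))"
  using g_finite by (simp add: ereal_real')

lemma subdiff_regular:
  assumes "x \<in> M" "u \<in> \<Omega>"
  shows "subdiff g (x, u) = {v. (v, -1) \<in> regular_normals (epi g) ((x, u), real_of_ereal (g (x, u)))}"
  using g_regular[OF assms] unfolding subdiff_def regular_at_def regular_set_at_def by auto

text \<open>Restricted to the slice with u fixed, a joint regular normal is a regular normal of the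
  epigraph of g(., u), and convexity of that slice turns it into a global subgradient.\<close>

lemma subdiff_fst_subgradient:
  assumes "x \<in> M" "u \<in> \<Omega>" and pw: "(p, w) \<in> subdiff g (x, u)"
  shows "p \<in> Q x u"
proof -
  let ?r = "real_of_ereal (g (x, u))"
  have reg: "((p, w), -1) \<in> regular_normals (epi g) ((x, u), ?r)"
    using pw subdiff_regular[OF assms(1,2)] by simp
  have "(p, -1) \<in> regular_normals (epi (\<lambda>y. g (y, u))) (x, ?r)"
    unfolding regular_normals_def
  proof clarify
    fix e :: real assume "e > 0"
    then obtain d where d: "d > 0" "\<And>y. y \<in> epi g \<Longrightarrow> y \<noteq> ((x, u), ?r) \<Longrightarrow> dist y ((x, u), ?r) < d
        \<Longrightarrow> ((p, w), -1) \<bullet> (y - ((x, u), ?r)) \<le> e * norm (y - ((x, u), ?r))"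
      using reg unfolding regular_normals_def eventually_at by force
    have "(p, -1) \<bullet> (z - (x, ?r)) \<le> e * norm (z - (x, ?r))"
      if z: "z \<in> epi (\<lambda>y. g (y, u))" "z \<noteq> (x, ?r)" "dist z (x, ?r) < d" for z
    proof -
      obtain y r where yr: "z = (y, r)" by (cases z)
      show ?thesis
        using d(2)[of "((y, u), r)"] z unfolding yr
        by (auto simp: epi_def dist_Pair_Pair norm_Pair)
    qed
    then show "\<forall>\<^sub>F z in at (x, ?r) within epi (\<lambda>y. g (y, u)). (p, -1) \<bullet> (z - (x, ?r)) \<le> e * norm (z - (x, ?r))"
      unfolding eventually_at using d(1) by blast
  qed
  moreover have "(x, ?r) \<in> epi (\<lambda>y. g (y, u))"
    using g_real[OF assms(1,2)] by (simp add: epi_def)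
  ultimately have "(p, -1) \<bullet> ((y, r) - (x, ?r)) \<le> 0" if "(y, r) \<in> epi (\<lambda>y. g (y, u))" for y r
    using regular_normals_convexD[OF _ _ _ that] g_convex[OF assms(2)] unfolding convex_fun_def by blast
  then show ?thesis
    using g_finite[OF assms(1,2)] by (intro epi_inner_imp_subgradient) auto
qed

text \<open>Two joint subgradients differ by a normal of M x \<Omega>, whose u-component
  vanishes.\<close>

lemma subdiff_snd_unique:
  assumes "x \<in> M" "u \<in> \<Omega>" "(p, w) \<in> subdiff g (x, u)" "(p', w') \<in> subdiff g (x, u)"
  shows "w = w'"
proof -
  have "(p, w) - (p', w') \<in> normal_space (M \<times> \<Omega>) (x, u)"
    by (rule affine_parallel_diff[OF g_parallel[OF assms(1,2)] subspace_normal_space])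
       (use assms in \<open>auto intro: hull_inc\<close>)
  then show ?thesis using normal_space_Times[OF \<Omega> assms(2,1)] by auto
qed

end

lemma convergent_subsequence_cball:
  fixes z :: "nat \<Rightarrow> 'a::heine_borel"
  assumes "\<And>n. z n \<in> cball a B"
  obtains l r where "strict_mono r" "(z \<circ> r) \<longlonglongrightarrow> l"
  using compact_cball[of a B] assms unfolding compact_def by blast

lemma gradient_eq:
  assumes "GDERIV \<phi> x :> d"
  shows "gradient \<phi> x = d"
  unfolding gradient_def
proof (rule the_equality)
  fix d' assume "GDERIV \<phi> x :> d'"
  then have "(\<lambda>h. h \<bullet> d') = (\<lambda>h. h \<bullet> d)"
    using assms unfolding gderiv_def by (rule has_derivative_unique)
  then have "(d' - d) \<bullet> d' = (d' - d) \<bullet> d" by metis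
  then have "(d' - d) \<bullet> (d' - d) = 0" by (simp add: inner_diff_right)
  then show "d' = d" by simp
qed (rule assms)

lemma GDERIV_of_has_derivative:
  fixes \<phi> :: "'a::euclidean_space \<Rightarrow> real"
  assumes "(\<phi> has_derivative D) (at x)"
  shows "GDERIV \<phi> x :> (\<Sum>b\<in>Basis. D b *\<^sub>R b)"
proof -
  have lin: "linear D" using assms by (rule has_derivative_linear)
  have "D h = h \<bullet> (\<Sum>b\<in>Basis. D b *\<^sub>R b)" for h
  proof -
    have "D h = D (\<Sum>b\<in>Basis. (h \<bullet> b) *\<^sub>R b)" by (simp add: euclidean_representation)
    also have "\<dots> = (\<Sum>b\<in>Basis. (h \<bullet> b) * D b)" by (simp add: linear_sum[OF lin] linear_cmul[OF lin])
    finally show ?thesis by (simp add: inner_sum_right mult.commute)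
  qed
  then have "D = (\<lambda>h. h \<bullet> (\<Sum>b\<in>Basis. D b *\<^sub>R b))" by (rule ext)
  with assms show ?thesis unfolding gderiv_def by simp
qed

lemma GDERIV_gradient:
  fixes \<phi> :: "'a::euclidean_space \<Rightarrow> real"
  assumes "\<phi> differentiable (at x)"
  shows "GDERIV \<phi> x :> gradient \<phi> x"
  using assms GDERIV_of_has_derivative gradient_eq unfolding differentiable_def by metis

context partly_smooth_composite
begin

text \<open>At a local minimizer Y of g + k, minus the gradient of k is a regular subgradient of g.
  Because k is quadratic, the remainder is explicit: |x - X|^2 / 2 + c |v - V|^2 / 2.\<close>

lemma penalized_minimizer_normal:
  fixes x0 q :: 'x and u0 :: 'u and G c :: real
  defines "k \<equiv> \<lambda>y. - (q \<bullet> fst y) + (norm (fst y - x0))\<^sup>2 / 2 + c / 2 * (norm (snd y - u0))\<^sup>2"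
  assumes c: "c \<ge> 0" and G: "g Y = ereal G" and S: "open S" "Y \<in> S"
    and min: "\<And>y. y \<in> S \<Longrightarrow> ereal (G + k Y) \<le> g y + ereal (k y)"
  shows "((q - (fst Y - x0), - (c *\<^sub>R (snd Y - u0))), -1) \<in> regular_normals (epi g) (Y, G)"
  unfolding regular_normals_def
proof clarify
  fix e :: real assume e: "e > 0"
  obtain d where d: "d > 0" "ball Y d \<subseteq> S" using S open_contains_ball by blast
  \<comment> \<open>The remainder is at most (1 + c) / 2 times the squared distance to (Y, G), so
    within this radius it is at most e times the distance.\<close>
  define d' where "d' = min d (2 * e / (1 + c))"
  have d': "d' > 0" "d' \<le> d" "d' \<le> 2 * e / (1 + c)" using d e c unfolding d'_def by auto
  have "((q - (fst Y - x0), - (c *\<^sub>R (snd Y - u0))), -1) \<bullet> (z - (Y, G)) \<le> e * norm (z - (Y, G))"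
    if z: "z \<in> epi g" "dist z (Y, G) < d'" for z
  proof -
    obtain x v r where zz: "z = ((x, v), r)" by (metis prod.collapse)
    obtain X V where Y: "Y = (X, V)" by (cases Y)
    have ze: "g (x, v) \<le> ereal r" using z(1) by (simp add: zz epi_def)
    have dist_xv: "dist (x, v) Y < d'"
      using z(2) unfolding zz dist_Pair_Pair[of "(x, v)"]
      by (meson le_less_trans real_sqrt_sum_squares_ge1)
    have "(x, v) \<in> S" using d(2) dist_xv d' by (auto simp: dist_commute subset_iff)
    from min[OF this] have "ereal (G + k Y) \<le> ereal r + ereal (k (x, v))"
      using add_right_mono[OF ze] order_trans by blast
    then have mn: "G + k Y \<le> r + k (x, v)" by simp
    have id1: "(norm (x - x0))\<^sup>2 = (norm (X - x0))\<^sup>2 + 2 * ((X - x0) \<bullet> (x - X)) + (norm (x - X))\<^sup>2"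
      unfolding power2_norm_eq_inner by (simp add: inner_diff inner_commute algebra_simps)
    have id2: "(norm (v - u0))\<^sup>2 = (norm (V - u0))\<^sup>2 + 2 * ((V - u0) \<bullet> (v - V)) + (norm (v - V))\<^sup>2"
      unfolding power2_norm_eq_inner by (simp add: inner_diff inner_commute algebra_simps)
    have "((q - (fst Y - x0), - (c *\<^sub>R (snd Y - u0))), -1) \<bullet> (z - (Y, G))
        = (q - (X - x0)) \<bullet> (x - X) - c * ((V - u0) \<bullet> (v - V)) - (r - G)"
      unfolding zz Y by simp
    also have "\<dots> \<le> (q - (X - x0)) \<bullet> (x - X) - c * ((V - u0) \<bullet> (v - V)) + k (x, v) - k Y"
      using mn by simp
    also have "\<dots> = (norm (x - X))\<^sup>2 / 2 + c / 2 * (norm (v - V))\<^sup>2"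
      unfolding k_def Y fst_conv snd_conv id1 id2
      by (simp add: inner_diff_left inner_diff_right inner_add_left algebra_simps add_divide_distrib
          diff_divide_distrib)
    also have "\<dots> \<le> (1 + c) / 2 * (norm (z - (Y, G)))\<^sup>2"
    proof -
      have n: "(norm (z - (Y, G)))\<^sup>2 = (norm (x - X))\<^sup>2 + (norm (v - V))\<^sup>2 + (r - G)\<^sup>2"
        unfolding zz Y by (simp add: norm_Pair)
      have "(norm (x - X))\<^sup>2 / 2 + c / 2 * (norm (v - V))\<^sup>2
          \<le> (1 + c) / 2 * (norm (x - X))\<^sup>2 + (1 + c) / 2 * (norm (v - V))\<^sup>2 + (1 + c) / 2 * (r - G)\<^sup>2"
        using c by (intro add_increasing2 add_mono) (auto simp: mult_right_mono field_simps)
      then show ?thesis unfolding n by (simp add: algebra_simps)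
    qed
    also have "\<dots> = ((1 + c) / 2 * norm (z - (Y, G))) * norm (z - (Y, G))"
      by (simp add: power2_eq_square)
    also have "\<dots> \<le> e * norm (z - (Y, G))"
    proof (rule mult_right_mono)
      have "(1 + c) / 2 * norm (z - (Y, G)) \<le> (1 + c) / 2 * (2 * e / (1 + c))"
        using z(2) d' c by (intro mult_left_mono) (auto simp: dist_norm)
      also have "\<dots> = e" using c by simp
      finally show "(1 + c) / 2 * norm (z - (Y, G)) \<le> e" .
    qed simp
    finally show ?thesis .
  qed
  then show "\<forall>\<^sub>F z in at (Y, G) within epi g.
      ((q - (fst Y - x0), - (c *\<^sub>R (snd Y - u0))), -1) \<bullet> (z - (Y, G)) \<le> e * norm (z - (Y, G))"
    unfolding eventually_at using d'(1) by blast
qed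

(* q is approximated by the first components of regular normals at minimizers of
   g - q x + |x - x0|^2 / 2 + j |u - u0|^2 / 2.  If the second components blow up, they leave a
   normal (0, w, 0) with w nonzero, which the shape of the normal space of M x Omega excludes. *)
lemma subgradient_lift:
  assumes x0: "x0 \<in> M" and u0: "u0 \<in> \<Omega>" and q: "q \<in> Q x0 u0"
  shows "\<exists>w. (q, w) \<in> subdiff g (x0, u0)"
proof -
  define a where "a = real_of_ereal (g (x0, u0))"
  have a: "g (x0, u0) = ereal a" unfolding a_def by (rule g_real[OF x0 u0])
  define k where "k = (\<lambda>(j::nat) (y::'x \<times> 'u). - (q \<bullet> fst y) + (norm (fst y - x0))\<^sup>2 / 2 + real j / 2 * (norm (snd y - u0))\<^sup>2)"
  let ?K = "cball (x0, u0) 1"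
  have "\<exists>y\<in>?K. \<forall>y'\<in>?K. g y + ereal (k j y) \<le> g y' + ereal (k j y')" for j
  proof -
    have "lsc_fun (\<lambda>y. g y + ereal (k j y))"
      unfolding k_def by (intro lsc_fun_add_continuous g_lsc g_not_MInf continuous_intros) auto
    from lsc_fun_attains_min[OF this compact_cball] show ?thesis by (metis cball_eq_empty not_one_less_zero)
  qed
  then obtain Y where Y: "\<And>j. Y j \<in> ?K" "\<And>j y. y \<in> ?K \<Longrightarrow> g (Y j) + ereal (k j (Y j)) \<le> g y + ereal (k j y)"
    by metis
  define G where "G = (\<lambda>j. real_of_ereal (g (Y j)))"
  have kz: "k j (x0, u0) = - (q \<bullet> x0)" for j by (simp add: k_def)
  have up: "g (Y j) + ereal (k j (Y j)) \<le> ereal (a - q \<bullet> x0)" for j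
    using Y(2)[of "(x0, u0)" j] by (simp add: a kz)
  have G: "g (Y j) = ereal (G j)" for j
    using up[of j] g_not_MInf[of "Y j"] unfolding G_def by (cases "g (Y j)") auto
  have Gle: "G j + k j (Y j) \<le> a - q \<bullet> x0" for j using up[of j] by (simp add: G)
  \<comment> \<open>A lower bound for g on the compact ball. Together with the upper bound on the
    penalized minimum it keeps j |u - u0|^2 bounded, which forces the u-components to u0.\<close>
  obtain yb where yb: "\<And>y. y \<in> ?K \<Longrightarrow> g yb \<le> g y"
    by (rule lsc_fun_attains_min[OF g_lsc compact_cball, of "(x0, u0)" 1]) auto
  have "g yb \<le> ereal a" using yb[of "(x0, u0)"] a by simp
  then obtain b where b: "g yb = ereal b" using g_not_MInf[of yb] by (cases "g yb") auto
  have Gb: "b \<le> G j" for j using yb[OF Y(1), of j] by (simp add: b G)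
  obtain l s where ls: "strict_mono (s::nat \<Rightarrow> nat)" "(Y \<circ> s) \<longlonglongrightarrow> l"
    by (rule convergent_subsequence_cball[OF Y(1)])
  define X where "X = (\<lambda>j. fst (Y (s j)))"
  define V where "V = (\<lambda>j. snd (Y (s j)))"
  have Xl: "X \<longlonglongrightarrow> fst l" and Vl: "V \<longlonglongrightarrow> snd l"
    using tendsto_fst[OF ls(2)] tendsto_snd[OF ls(2)] by (simp_all add: X_def V_def o_def)
  have kX: "k (s j) (Y (s j)) = - (q \<bullet> X j) + (norm (X j - x0))\<^sup>2 / 2 + real (s j) / 2 * (norm (V j - u0))\<^sup>2" for j
    by (simp add: k_def X_def V_def)
  have GX: "G (s j) \<le> a + q \<bullet> (X j - x0) - (norm (X j - x0))\<^sup>2 / 2" for j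
  proof -
    have "0 \<le> real (s j) / 2 * (norm (V j - u0))\<^sup>2" by simp
    then show ?thesis using Gle[of "s j"] unfolding kX inner_diff_right by linarith
  qed
  have lu: "snd l = u0"
  proof -
    define C where "C = 2 * (a - b + norm q)"
    have "(norm (V j - u0))\<^sup>2 \<le> C / real j" if j: "j \<ge> 1" for j
    proof -
      have "norm (X j - x0) \<le> norm (Y (s j) - (x0, u0))"
        unfolding X_def by (metis fst_diff fst_conv norm_fst_le prod.collapse)
      also have "\<dots> \<le> 1" using Y(1)[of "s j"] by (simp add: dist_norm norm_minus_commute)
      finally have "q \<bullet> (X j - x0) \<le> norm q"
        using norm_cauchy_schwarz[of q "X j - x0"] mult_left_mono[of "norm (X j - x0)" 1 "norm q"] by simp
      moreover have "0 \<le> (norm (X j - x0))\<^sup>2 / 2" by simp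
      moreover have "b \<le> G (s j)" by (rule Gb)
      moreover have "q \<bullet> X j = q \<bullet> (X j - x0) + q \<bullet> x0" by (simp add: inner_diff_right)
      ultimately have "real (s j) / 2 * (norm (V j - u0))\<^sup>2 \<le> a - b + norm q"
        using Gle[of "s j"] unfolding kX by linarith
      then have "real (s j) * (norm (V j - u0))\<^sup>2 \<le> C" unfolding C_def by simp
      moreover have "real j * (norm (V j - u0))\<^sup>2 \<le> real (s j) * (norm (V j - u0))\<^sup>2"
        using seq_suble[OF ls(1), of j] by (intro mult_right_mono) auto
      ultimately have "(norm (V j - u0))\<^sup>2 * real j \<le> C" by (simp add: mult.commute)
      then show ?thesis using j by (simp add: pos_le_divide_eq)
    qed
    then have "\<forall>\<^sub>F j in sequentially. (norm (V j - u0))\<^sup>2 \<le> C / real j"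
      unfolding eventually_sequentially by (intro exI[of _ 1]) simp
    moreover have "(\<lambda>j. (norm (V j - u0))\<^sup>2) \<longlonglongrightarrow> (norm (snd l - u0))\<^sup>2"
      by (intro tendsto_intros Vl)
    ultimately have "(norm (snd l - u0))\<^sup>2 \<le> 0"
      by (intro tendsto_le[OF sequentially_bot lim_const_over_n[of C]])
    then show ?thesis by simp
  qed
  \<comment> \<open>At the limit point, lower semicontinuity and the subgradient inequality of the
    section at u0 bound g from below by exactly the linear term of the upper bound, leaving no room
    for |x - x0|^2 / 2.\<close>
  have lx: "fst l = x0"
  proof (rule ccontr)
    assume ne: "fst l \<noteq> x0"
    define \<delta> where "\<delta> = (norm (fst l - x0))\<^sup>2 / 2"
    define R where "R = a + q \<bullet> (fst l - x0)"
    have \<delta>: "\<delta> > 0" using ne unfolding \<delta>_def by simp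
    have "ereal R \<le> g l"
      using q lu a unfolding convex_subgradients_def R_def by (cases l) (auto dest: spec[of _ "fst l"])
    then have "ereal (R - \<delta> / 2) < g l" using \<delta> by (simp add: less_le_trans[of _ "ereal R"])
    from lsc_fun_eventually[where h = g, OF g_lsc this] ls(2)
    have "\<forall>\<^sub>F j in sequentially. ereal (R - \<delta> / 2) < g (Y (s j))"
      unfolding filterlim_iff by (auto simp: o_def)
    then have "\<forall>\<^sub>F j in sequentially. R - \<delta> / 2 \<le> a + q \<bullet> (X j - x0) - (norm (X j - x0))\<^sup>2 / 2"
      by eventually_elim (use GX in \<open>auto simp: G intro: less_imp_le less_le_trans\<close>)
    moreover have "(\<lambda>j. a + q \<bullet> (X j - x0) - (norm (X j - x0))\<^sup>2 / 2) \<longlonglongrightarrow> R - \<delta>"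
      unfolding R_def \<delta>_def by (intro tendsto_intros Xl) auto
    ultimately have "R - \<delta> / 2 \<le> R - \<delta>" by (intro tendsto_lowerbound) auto
    then show False using \<delta> by simp
  qed
  have Yl: "(\<lambda>j. Y (s j)) \<longlonglongrightarrow> (x0, u0)"
    using ls(2) lx lu by (cases l) (simp add: o_def)
  \<comment> \<open>The values must converge as well: the normals are attached to the points (Y, G)
    of the epigraph, which have to tend to ((x0, u0), a).\<close>
  have Gl: "(\<lambda>j. G (s j)) \<longlonglongrightarrow> a"
  proof (rule order_tendstoI)
    fix c assume "c < a"
    then have "ereal c < g (x0, u0)" by (simp add: a)
    from lsc_fun_eventually[where h = g, OF g_lsc this] Yl
    have "\<forall>\<^sub>F j in sequentially. ereal c < g (Y (s j))" unfolding filterlim_iff by blast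
    then show "\<forall>\<^sub>F j in sequentially. c < G (s j)" by (simp add: G)
  next
    fix c assume c: "a < c"
    have "(\<lambda>j. a + q \<bullet> (X j - x0) - (norm (X j - x0))\<^sup>2 / 2) \<longlonglongrightarrow> a + q \<bullet> (x0 - x0) - (norm (x0 - x0))\<^sup>2 / 2"
      by (intro tendsto_intros Xl[unfolded lx]) auto
    then have "\<forall>\<^sub>F j in sequentially. a + q \<bullet> (X j - x0) - (norm (X j - x0))\<^sup>2 / 2 < c"
      using c by (intro order_tendstoD) auto
    then show "\<forall>\<^sub>F j in sequentially. G (s j) < c"
      by eventually_elim (use GX le_less_trans in blast)
  qed
  define \<mu> where "\<mu> = (\<lambda>j. real (s j) *\<^sub>R (V j - u0))"
  have "\<forall>\<^sub>F j in sequentially. dist (Y (s j)) (x0, u0) < 1"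
    using Yl by (rule tendstoD) simp
  then have "\<forall>\<^sub>F j in sequentially. ((q - (X j - x0), - \<mu> j), -1) \<in> regular_normals (epi g) (Y (s j), G (s j))"
  proof eventually_elim
    case (elim j)
    have "((q - (fst (Y (s j)) - x0), - (real (s j) *\<^sub>R (snd (Y (s j)) - u0))), -1)
        \<in> regular_normals (epi g) (Y (s j), G (s j))"
    proof (rule penalized_minimizer_normal[where S = "ball (x0, u0) 1"])
      show "Y (s j) \<in> ball (x0, u0) 1" using elim by (simp add: dist_commute)
      fix y assume "y \<in> ball (x0, u0) 1"
      then have "y \<in> ?K" by simp
      from Y(2)[OF this, of "s j"] show "ereal (G (s j) + (- (q \<bullet> fst (Y (s j))) + (norm (fst (Y (s j)) - x0))\<^sup>2 / 2
           + real (s j) / 2 * (norm (snd (Y (s j)) - u0))\<^sup>2))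
         \<le> g y + ereal (- (q \<bullet> fst y) + (norm (fst y - x0))\<^sup>2 / 2 + real (s j) / 2 * (norm (snd y - u0))\<^sup>2)"
        by (simp add: G k_def)
    qed (auto simp: G)
    then show ?case by (simp add: X_def V_def \<mu>_def)
  qed
  then obtain n0 where n0: "\<And>j. j \<ge> n0 \<Longrightarrow> ((q - (X j - x0), - \<mu> j), -1) \<in> regular_normals (epi g) (Y (s j), G (s j))"
    unfolding eventually_sequentially by auto
  \<comment> \<open>Scaling by \<tau> keeps the normals bounded whether or not \<mu> blows up, and
    |\<tau> \<mu>| = 1 - \<tau> ensures that the limits \<theta> and w cannot both vanish.\<close>
  define \<tau> where "\<tau> = (\<lambda>j. 1 / (1 + norm (\<mu> j)))"
  have \<tau>: "0 < \<tau> j" "\<tau> j \<le> 1" "norm (\<tau> j *\<^sub>R \<mu> j) = 1 - \<tau> j" for j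
  proof -
    have p: "1 + norm (\<mu> j) > 0" using norm_ge_zero[of "\<mu> j"] by linarith
    show "0 < \<tau> j" "\<tau> j \<le> 1" using p unfolding \<tau>_def by auto
    then show "norm (\<tau> j *\<^sub>R \<mu> j) = 1 - \<tau> j" using p unfolding \<tau>_def by (simp add: field_simps)
  qed
  have bd: "(\<tau> (j + n0), \<tau> (j + n0) *\<^sub>R \<mu> (j + n0)) \<in> cball (0::real, 0::'u) 2" for j
    using norm_Pair_le[of "\<tau> (j + n0)" "\<tau> (j + n0) *\<^sub>R \<mu> (j + n0)"] \<tau>[of "j + n0"]
    by (simp add: mem_cball_0 zero_prod_def[symmetric])
  obtain m r where mr: "strict_mono (r::nat \<Rightarrow> nat)"
    "((\<lambda>j. (\<tau> (j + n0), \<tau> (j + n0) *\<^sub>R \<mu> (j + n0))) \<circ> r) \<longlonglongrightarrow> m"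
    by (rule convergent_subsequence_cball[OF bd])
  obtain \<theta> w where m: "m = (\<theta>, w)" by (cases m)
  define i where "i = (\<lambda>j. r j + n0)"
  have \<tau>l: "(\<lambda>j. \<tau> (i j)) \<longlonglongrightarrow> \<theta>" and wl: "(\<lambda>j. \<tau> (i j) *\<^sub>R \<mu> (i j)) \<longlonglongrightarrow> w"
    using tendsto_fst[OF mr(2)] tendsto_snd[OF mr(2)] by (simp_all add: m i_def o_def)
  have i: "filterlim i sequentially sequentially"
    unfolding i_def using filterlim_compose[OF filterlim_add_const_nat_at_top filterlim_subseq[OF mr(1)]] by simp
  have \<theta>0: "\<theta> \<ge> 0" by (rule LIMSEQ_le_const[OF \<tau>l]) (use \<tau>(1) less_imp_le in blast)
  have nw: "norm w = 1 - \<theta>"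
    using LIMSEQ_unique[OF tendsto_norm[OF wl, unfolded \<tau>(3)] tendsto_diff[OF tendsto_const \<tau>l]] .
  have lim: "((\<theta> *\<^sub>R q, - w), - \<theta>) \<in> limiting_normals (epi g) ((x0, u0), a)"
    unfolding limiting_normals_def
  proof (intro CollectI exI conjI allI)
    fix j
    show "(Y (s (i j)), G (s (i j))) \<in> epi g" using G[of "s (i j)"] by (cases "Y (s (i j))") (simp add: epi_def)
    show "\<tau> (i j) *\<^sub>R ((q - (X (i j) - x0), - \<mu> (i j)), -1) \<in> regular_normals (epi g) (Y (s (i j)), G (s (i j)))"
      by (intro regular_normals_scale n0 \<tau>(1)) (simp add: i_def)
  next
    show "(\<lambda>j. (Y (s (i j)), G (s (i j)))) \<longlonglongrightarrow> ((x0, u0), a)"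
      by (intro tendsto_Pair filterlim_compose[OF Yl i] filterlim_compose[OF Gl i])
    have "(\<lambda>j. ((\<tau> (i j) *\<^sub>R (q - (X (i j) - x0)), - (\<tau> (i j) *\<^sub>R \<mu> (i j))), - \<tau> (i j)))
        \<longlonglongrightarrow> ((\<theta> *\<^sub>R (q - (x0 - x0)), - w), - \<theta>)"
      by (intro tendsto_intros \<tau>l wl filterlim_compose[OF Xl[unfolded lx] i])
    then show "(\<lambda>j. \<tau> (i j) *\<^sub>R ((q - (X (i j) - x0), - \<mu> (i j)), -1 :: real)) \<longlonglongrightarrow> ((\<theta> *\<^sub>R q, - w), - \<theta>)"
      by simp
  qed
  show ?thesis
  proof (cases "\<theta> = 0")
    case False
    then have "(1 / \<theta>) *\<^sub>R ((\<theta> *\<^sub>R q, - w), - \<theta>) \<in> limiting_normals (epi g) ((x0, u0), a)"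
      using \<theta>0 by (intro limiting_normals_scale[OF lim]) auto
    then have "((q, - (1 / \<theta>) *\<^sub>R w), -1) \<in> limiting_normals (epi g) ((x0, u0), a)"
      using False by simp
    then show ?thesis unfolding subdiff_def using a by auto
  next
    case True
    have "regular_set_at (epi g) ((x0, u0), a)"
      using g_regular[OF x0 u0] unfolding regular_at_def a_def by auto
    then have w: "((0, - w), 0) \<in> regular_normals (epi g) ((x0, u0), a)"
      using lim True unfolding regular_set_at_def by simp
    obtain p w1 where p: "(p, w1) \<in> subdiff g (x0, u0)" using subdiff_nonempty[OF x0 u0] by auto
    then have "((p, w1), -1) \<in> regular_normals (epi g) ((x0, u0), a)"
      unfolding subdiff_regular[OF x0 u0] a_def by simp
    from regular_normals_add[OF this w] have "(p, w1 - w) \<in> subdiff g (x0, u0)"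
      unfolding subdiff_regular[OF x0 u0] a_def by simp
    then have "w1 = w1 - w" by (rule subdiff_snd_unique[OF x0 u0 p])
    then show ?thesis using nw True by simp
  qed
qed

section \<open>Nondegeneracy for the section of \<open>g\<close> and identification of
  subgradients\<close>

lemma f_differentiable: "f differentiable (at z)"
  using f_C2 unfolding numeral_2_eq_2 by (simp only: Ck_on.simps) blast

lemma f_section_differentiable: "(\<lambda>y. f (y, u)) differentiable (at x)"
proof -
  have "(\<lambda>y. (y, u)) differentiable (at x)"
    by (intro differentiableI[of _ "\<lambda>h. (h, 0)"] derivative_eq_intros) auto
  from differentiable_compose[OF f_differentiable this] show ?thesis .
qed

text \<open>Adding the smooth part translates the subdifferential, and the relative interior moves
  along. Later uses of nondegeneracy go through this form.\<close>

lemma nondegenerate_prox: "- grad_x f (xs, us) \<in> rel_interior (Q xs us)"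
proof -
  let ?d = "grad_x f (xs, us)"
  have d: "GDERIV (\<lambda>x. f (x, us)) xs :> ?d"
    unfolding grad_x_def by (simp add: GDERIV_gradient f_section_differentiable)
  have "subdiff (\<lambda>x. ereal (f (x, us)) + g (x, us)) xs = (\<lambda>v. ?d + v) ` Q xs us"
    using subdiff_eq_convex_subgradients[OF convex_fun_add_real[OF f_convex[OF us] g_convex[OF us]], of xs]
      convex_subgradients_add_smooth[OF f_convex[OF us] d g_convex[OF us]] g_not_MInf by simp
  then have "0 \<in> (\<lambda>v. ?d + v) ` rel_interior (Q xs us)"
    using nondegenerate by (simp add: rel_interior_translation)
  then obtain v where "v \<in> rel_interior (Q xs us)" "?d + v = 0" by auto
  then show ?thesis by (metis add_eq_0_iff)
qed

text \<open>If v n stayed outside the closed convex set \<open>Q (y n) (t n)\<close>, its normalized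
  displacement from the nearest point would be normal to M and accumulate at a unit normal l. By
  nondegeneracy the limiting set extends beyond the limit of v n in direction l, and inner
  semicontinuity carries points beyond it into the nearby sets, contradicting the separation by the
  nearest point. \<open>closed\<close>, the closedness of the normal bundle, is left to the
  chart.\<close>

lemma identification:
  assumes y: "\<And>n::nat. y n \<in> M" "y \<longlonglongrightarrow> xs" and t: "\<And>n. t n \<in> \<Omega>" "t \<longlonglongrightarrow> us"
    and v: "v \<longlonglongrightarrow> - grad_x f (xs, us)"
    and normal: "\<And>n p. p \<in> Q (y n) (t n) \<Longrightarrow> v n - p \<in> normal_space M (y n)"
    and closed: "\<And>z d l. (\<And>n::nat. z n \<in> M \<and> d n \<in> normal_space M (z n)) \<Longrightarrow> z \<longlonglongrightarrow> xs \<Longrightarrow> d \<longlonglongrightarrow> l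
      \<Longrightarrow> l \<in> normal_space M xs"
  shows "\<forall>\<^sub>F n in sequentially. v n \<in> Q (y n) (t n)"
proof (rule ccontr)
  assume "\<not> ?thesis"
  then obtain s :: "nat \<Rightarrow> nat" where s: "strict_mono s" "\<And>n. v (s n) \<notin> Q (y (s n)) (t (s n))"
    using not_eventually_sequentiallyD[of "\<lambda>n. v n \<in> Q (y n) (t n)"] by auto
  define C where "C = (\<lambda>n. Q (y (s n)) (t (s n)))"
  define c where "c = (\<lambda>n. closest_point (C n) (v (s n)))"
  define d where "d = (\<lambda>n. v (s n) - c n)"
  have cv: "convex (C n)" "closed (C n)" for n
    unfolding C_def by (rule convex_convex_subgradients closed_convex_subgradients)+
  have ne: "C n \<noteq> {}" for n
    using subdiff_nonempty[OF y(1) t(1)] subdiff_fst_subgradient[OF y(1) t(1)] unfolding C_def by fast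
  have c: "c n \<in> C n" for n unfolding c_def by (rule closest_point_in_set[OF cv(2) ne])
  have d0: "d n \<noteq> 0" for n using c[of n] s(2)[of n] unfolding d_def C_def by auto
  define \<nu> where "\<nu> = (\<lambda>n. d n /\<^sub>R norm (d n))"
  have \<nu>1: "norm (\<nu> n) = 1" for n unfolding \<nu>_def using d0 by simp
  have \<nu>N: "\<nu> n \<in> normal_space M (y (s n))" for n
    unfolding \<nu>_def d_def
    using normal[of "c n" "s n"] c[of n] subspace_normal_space by (intro subspace_scale) (auto simp: C_def)
  have "\<nu> n \<in> cball 0 1" for n using \<nu>1 by simp
  then obtain l r where lr: "strict_mono (r::nat \<Rightarrow> nat)" "(\<nu> \<circ> r) \<longlonglongrightarrow> l"
    by (rule convergent_subsequence_cball)
  have sr: "strict_mono (s \<circ> r)" using s(1) lr(1) by (simp add: strict_mono_o)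
  have ysr: "(y \<circ> (s \<circ> r)) \<longlonglongrightarrow> xs" "(t \<circ> (s \<circ> r)) \<longlonglongrightarrow> us" "(v \<circ> (s \<circ> r)) \<longlonglongrightarrow> - grad_x f (xs, us)"
    using LIMSEQ_subseq_LIMSEQ[OF y(2) sr] LIMSEQ_subseq_LIMSEQ[OF t(2) sr] LIMSEQ_subseq_LIMSEQ[OF v sr] .
  have lN: "l \<in> normal_space M xs"
    by (rule closed[OF _ ysr(1) lr(2)]) (use y(1) \<nu>N in auto)
  have l1: "norm l = 1"
    using LIMSEQ_unique[OF tendsto_norm[OF lr(2)]] \<nu>1 by (auto simp: o_def)
  let ?v = "- grad_x f (xs, us)"
  obtain e where e: "e > 0" "ball ?v e \<inter> affine hull (Q xs us) \<subseteq> Q xs us" and vQ: "?v \<in> Q xs us"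
    using nondegenerate_prox unfolding mem_rel_interior_ball by auto
  \<comment> \<open>A point beyond the limit of v in direction l, within the radius e given by the
    relative interior. It lies in the affine hull of \<open>Q xs us\<close> because the joint
    subdifferential has an affine hull parallel to the normal space, which contains (l, 0).\<close>
  let ?p = "?v + (e / 2) *\<^sub>R l"
  obtain w where w: "(?v, w) \<in> subdiff g (xs, us)" using subgradient_lift[OF xs us vQ] by auto
  have "(?v, w) + ((e / 2) *\<^sub>R l, 0) \<in> affine hull (subdiff g (xs, us))"
    by (rule affine_parallel_add[OF g_parallel[OF xs us] subspace_normal_space])
       (use w subspace_scale[OF subspace_normal_space lN] in \<open>auto simp: normal_space_Times[OF \<Omega> us xs] hull_inc\<close>)
  then have "fst ((?v, w) + ((e / 2) *\<^sub>R l, 0)) \<in> fst ` (affine hull (subdiff g (xs, us)))" by (rule imageI)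
  then have "?p \<in> affine hull (fst ` subdiff g (xs, us))"
    unfolding affine_hull_linear_image[OF bounded_linear_fst] by simp
  moreover have "fst ` subdiff g (xs, us) \<subseteq> Q xs us" using subdiff_fst_subgradient[OF xs us] by auto
  ultimately have "?p \<in> affine hull (Q xs us)" using hull_mono by blast
  moreover have "?p \<in> ball ?v e" using e(1) l1 by (simp add: dist_norm)
  ultimately have "?p \<in> Q xs us" using e(2) by blast
  then obtain w' where w': "(?p, w') \<in> subdiff g (xs, us)" using subgradient_lift[OF xs us] by auto
  have "(\<lambda>n. (y (s (r n)), t (s (r n)))) \<longlonglongrightarrow> (xs, us)"
    using tendsto_Pair[OF ysr(1,2)] by (simp add: o_def)
  then obtain W where W: "\<forall>\<^sub>F n in sequentially. W n \<in> subdiff g (y (s (r n)), t (s (r n)))" "W \<longlonglongrightarrow> (?p, w')"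
    using conjunct2[OF g_PK[OF xs us, unfolded PK_continuous_at_def], rule_format, OF w',
        of "\<lambda>n. (y (s (r n)), t (s (r n)))"] y(1) t(1) by auto
  have "\<forall>\<^sub>F n in sequentially. \<nu> (r n) \<bullet> fst (W n) \<le> \<nu> (r n) \<bullet> v (s (r n))"
    using W(1)
  proof eventually_elim
    case (elim n)
    have "fst (W n) \<in> C (r n)"
      using subdiff_fst_subgradient[OF y(1) t(1)] elim unfolding C_def by (metis prod.collapse)
    \<comment> \<open>Separation at the nearest point. In the limit it bounds l . ?p by the inner
      product of l with the limit of v, although ?p lies e/2 further along l.\<close>
    then have "d (r n) \<bullet> (fst (W n) - c (r n)) \<le> 0"
      unfolding d_def c_def by (rule closest_point_dot[OF cv])
    moreover have "0 \<le> d (r n) \<bullet> d (r n)" by simp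
    ultimately have "d (r n) \<bullet> fst (W n) \<le> d (r n) \<bullet> v (s (r n))"
      unfolding d_def by (simp add: inner_diff_right)
    then show ?case unfolding \<nu>_def using d0[of "r n"] by (simp add: divide_right_mono)
  qed
  moreover have "(\<lambda>n. \<nu> (r n) \<bullet> fst (W n)) \<longlonglongrightarrow> l \<bullet> ?p"
    using tendsto_inner[OF lr(2) tendsto_fst[OF W(2)]] by (simp add: o_def)
  moreover have "(\<lambda>n. \<nu> (r n) \<bullet> v (s (r n))) \<longlonglongrightarrow> l \<bullet> ?v"
    using tendsto_inner[OF lr(2) ysr(3)] by (simp add: o_def)
  ultimately have "l \<bullet> ?p \<le> l \<bullet> ?v"
    by (intro tendsto_le[OF sequentially_bot])
  then have "e / 2 * (norm l)\<^sup>2 \<le> 0"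
    unfolding inner_add_right inner_scaleR_right power2_norm_eq_inner by simp
  then show False using e(1) l1 by simp
qed

end

section \<open>Adjoints and projections\<close>

text \<open>The transpose, written out in the basis so that its regularity in A and y reduces to
  sums and inner products.\<close>

definition adj :: "('a::euclidean_space \<Rightarrow>\<^sub>L 'b::real_inner) \<Rightarrow> 'b \<Rightarrow> 'a" where
  "adj A y = (\<Sum>e\<in>Basis. (blinfun_apply A e \<bullet> y) *\<^sub>R e)"

lemma inner_adj: "adj A y \<bullet> c = blinfun_apply A c \<bullet> y"
proof -
  have "blinfun_apply A c = blinfun_apply A (\<Sum>e\<in>Basis. (c \<bullet> e) *\<^sub>R e)"
    by (simp add: euclidean_representation)
  also have "\<dots> = (\<Sum>e\<in>Basis. (c \<bullet> e) *\<^sub>R blinfun_apply A e)"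
    by (simp add: blinfun.sum_right blinfun.scaleR_right)
  finally show ?thesis
    unfolding adj_def by (simp add: inner_sum_left inner_sum_right inner_commute[of _ c] mult.commute)
qed

lemma C1_near_adj:
  assumes "C1_near b A x" "C1_near b y x"
  shows "C1_near b (\<lambda>z. adj (A z) (y z)) x"
  unfolding adj_def
proof (intro C1_near_sum)
  fix e :: 'b
  have "C1_near b (\<lambda>z. blinfun_apply (A z) e) x"
    by (rule C1_near_lin_compose[OF blinfun.bounded_linear_left assms(1)])
  from C1_near_bilinear[OF bounded_bilinear_inner this assms(2)]
  show "C1_near b (\<lambda>z. (blinfun_apply (A z) e \<bullet> y z) *\<^sub>R e) x"
    by (rule C1_near_lin_compose[OF bounded_linear_scaleR_left])
qed

lemma orthogonal_projection_exists:
  fixes S :: "'a::euclidean_space set"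
  assumes "subspace S"
  shows "\<exists>pr :: 'a \<Rightarrow>\<^sub>L 'a. (\<forall>v. blinfun_apply pr v \<in> S) \<and> (\<forall>v\<in>S. blinfun_apply pr v = v) \<and>
    (\<forall>v w. blinfun_apply pr v \<bullet> w = v \<bullet> blinfun_apply pr w)"
proof -
  obtain B where B: "B \<subseteq> S" "pairwise orthogonal B" "\<And>x. x \<in> B \<Longrightarrow> norm x = 1" "independent B" "span B = S"
    using orthonormal_basis_subspace[OF assms] by metis
  have fin: "finite B" using B(4) by (rule independent_imp_finite)
  define p where "p = (\<lambda>v. \<Sum>b\<in>B. (v \<bullet> b) *\<^sub>R b)"
  have bl: "bounded_linear p"
    unfolding p_def
    by (intro bounded_linear_sum bounded_linear_scaleR_const bounded_linear_inner_left)
  have pS: "p v \<in> S" for v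
    unfolding p_def using B(1) assms by (intro subspace_sum subspace_scale) auto
  have pid: "p v = v" if "v \<in> S" for v
  proof -
    have "v \<in> span B" using that B(5) by simp
    moreover have "p b = b" if "b \<in> B" for b
    proof -
      have "p b = (\<Sum>b'\<in>B. if b' = b then b else 0)"
        unfolding p_def
      proof (rule sum.cong[OF refl])
        fix b' assume "b' \<in> B"
        then show "(b \<bullet> b') *\<^sub>R b' = (if b' = b then b else 0)"
          using B(2,3) that by (auto simp: pairwise_def orthogonal_def dot_square_norm)
      qed
      then show ?thesis using fin that by simp
    qed
    ultimately show ?thesis
      using linear_eq_on_span[OF bounded_linear.linear[OF bl] linear_id, of B v] by auto
  qed
  have "p v \<bullet> w = v \<bullet> p w" for v w
    unfolding p_def by (simp add: inner_sum_left inner_sum_right inner_commute mult.commute)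
  then show ?thesis
    using pS pid by (intro exI[of _ "Blinfun p"]) (simp add: bounded_linear_Blinfun_apply[OF bl])
qed

lemma curve_has_derivative:
  assumes "(\<phi> has_derivative D) (at (\<gamma> 0))" "(\<gamma> has_vector_derivative v) (at (0::real))"
  shows "((\<lambda>t. \<phi> (\<gamma> t)) has_vector_derivative D v) (at 0)"
proof -
  have "((\<lambda>t. \<phi> (\<gamma> t)) has_derivative (\<lambda>t. D (t *\<^sub>R v))) (at 0)"
    using assms(2) unfolding has_vector_derivative_def
    by (rule has_derivative_compose[where f = \<gamma> and g = \<phi>, OF _ assms(1)])
  then show ?thesis
    unfolding has_vector_derivative_def using linear_cmul[OF has_derivative_linear[OF assms(1)]] by simp
qed

lemma has_vector_derivative_transform_nhds:
  assumes "(\<gamma> has_vector_derivative v) (at t)" "\<forall>\<^sub>F y in nhds t. \<gamma> y = \<delta> y"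
  shows "(\<delta> has_vector_derivative v) (at t)"
proof -
  have "\<forall>\<^sub>F y in at t. \<gamma> y = \<delta> y"
    using assms(2) by (auto simp: eventually_at_filter elim: eventually_mono)
  with assms(1) show ?thesis
    unfolding has_vector_derivative_def
    by (rule has_derivative_transform_eventually) (use eventually_nhds_x_imp_x[OF assms(2)] in auto)
qed

lemma line_has_derivative: "((\<lambda>t. x + t *\<^sub>R v) has_vector_derivative v) (at 0)"
  by (auto intro!: derivative_eq_intros)

lemma local_min_derivative_zero:
  fixes k :: "real \<Rightarrow> real"
  assumes "(k has_real_derivative d) (at 0)" "\<forall>\<^sub>F t in nhds 0. k 0 \<le> k t"
  shows "d = 0"
proof -
  obtain e where "e > 0" "\<And>t. dist t 0 < e \<Longrightarrow> k 0 \<le> k t"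
    using assms(2) unfolding eventually_nhds_metric by auto
  then show ?thesis
    using DERIV_local_min[OF assms(1), of e] by (auto simp: dist_real_def)
qed

lemma eventually_nhds_sequence:
  fixes a :: "'a::metric_space"
  assumes "\<And>z. (\<And>n::nat. \<not> P (z n)) \<Longrightarrow> z \<longlonglongrightarrow> a \<Longrightarrow> False"
  shows "\<forall>\<^sub>F x in nhds a. P x"
proof (rule ccontr)
  assume "\<not> ?thesis"
  then have "\<exists>z. dist z a < 1 / real (Suc n) \<and> \<not> P z" for n
    unfolding eventually_nhds_metric by (auto dest!: spec[of _ "1 / real (Suc n)"])
  then obtain z where z: "\<And>n. dist (z n) a < 1 / real (Suc n)" "\<And>n. \<not> P (z n)" by metis
  have "(\<lambda>n. dist (z n) a) \<longlonglongrightarrow> 0"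
    by (rule tendsto_sandwich[OF _ _ tendsto_const LIMSEQ_inverse_real_of_nat])
       (use z(1) in \<open>auto intro!: always_eventually less_imp_le simp: inverse_eq_divide\<close>)
  then have "z \<longlonglongrightarrow> a" by (subst tendsto_dist_iff)
  then show False using assms z(2) by blast
qed

text \<open>The quadratic term adds its strong convexity to the subgradient inequality, so the
  proximal objective at z exceeds its value at y by at least |z - y|^2 / 2. Thus y is the unique
  minimizer, which pins down the choice in \<open>arg_min\<close>; the growth bound is a separate
  conclusion because the injectivity argument for the stationarity equation uses it.\<close>

lemma prox_eqI:
  fixes h :: "'a::euclidean_space \<Rightarrow> ereal"
  assumes a: "a > 0" and v: "(w - y) /\<^sub>R a \<in> convex_subgradients h y"
  shows "prox (\<lambda>z. ereal a * h z) w = y"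
    and "ereal a * h y + ereal ((norm (y - w))\<^sup>2 / 2 + (norm (z - y))\<^sup>2 / 2)
      \<le> ereal a * h z + ereal ((norm (z - w))\<^sup>2 / 2)"
proof -
  obtain r where r: "h y = ereal r" using v unfolding convex_subgradients_def by (cases "h y") auto
  have low: "ereal a * h y + ereal ((norm (y - w))\<^sup>2 / 2 + (norm (z - y))\<^sup>2 / 2)
      \<le> ereal a * h z + ereal ((norm (z - w))\<^sup>2 / 2)" for z
  proof (cases "h z")
    case (real t)
    have id: "(norm (z - w))\<^sup>2 = (norm (y - w))\<^sup>2 - 2 * ((w - y) \<bullet> (z - y)) + (norm (z - y))\<^sup>2"
      unfolding power2_norm_eq_inner by (simp add: inner_diff inner_commute algebra_simps)
    have "r + ((w - y) /\<^sub>R a) \<bullet> (z - y) \<le> t"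
      using v r real unfolding convex_subgradients_def by (auto dest: spec[of _ z])
    then have "a * (r + ((w - y) /\<^sub>R a) \<bullet> (z - y)) \<le> a * t" using a by simp
    then have "a * r + (w - y) \<bullet> (z - y) \<le> a * t"
      using a by (simp add: distrib_left mult.assoc[symmetric])
    then show ?thesis using real r id by (simp add: field_simps)
  next
    case PInf
    then show ?thesis using a by simp
  next
    case MInf
    then show ?thesis using v r unfolding convex_subgradients_def by (auto dest: spec[of _ z])
  qed
  show "ereal a * h y + ereal ((norm (y - w))\<^sup>2 / 2 + (norm (z - y))\<^sup>2 / 2)
      \<le> ereal a * h z + ereal ((norm (z - w))\<^sup>2 / 2)" by (rule low)
  let ?o = "\<lambda>z. ereal a * h z + ereal ((norm (z - w))\<^sup>2 / 2)"
  have lt: "?o y < ?o z" if "z \<noteq> y" for z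
  proof -
    have "?o y < ereal a * h y + ereal ((norm (y - w))\<^sup>2 / 2 + (norm (z - y))\<^sup>2 / 2)"
      using that r by simp
    also have "\<dots> \<le> ?o z" by (rule low)
    finally show ?thesis .
  qed
  then have "is_arg_min ?o (\<lambda>_. True) y"
    unfolding is_arg_min_def using less_asym by (metis less_irrefl)
  moreover have "z = y" if "is_arg_min ?o (\<lambda>_. True) z" for z
    using that lt[of z] unfolding is_arg_min_def by blast
  ultimately show "prox (\<lambda>z. ereal a * h z) w = y"
    unfolding prox_def arg_min_def by (rule some_equality)
qed

section \<open>The proximal map in a chart\<close>

(* phi = Psi o pr parametrizes M near xs by the linear model space S.  Composing with the
   projection makes phi a function on the whole space whose values depend only on M. *)
locale chart = partly_smooth_composite f g M \<Omega> xs us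
  for f :: "'x::euclidean_space \<times> 'u::euclidean_space \<Rightarrow> real" and g M \<Omega> xs us +
  fixes S W V :: "'x set" and \<Phi> \<Psi> :: "'x \<Rightarrow> 'x" and pr :: "'x \<Rightarrow>\<^sub>L 'x"
    and Wg :: "('x \<times> 'u) set" and gt :: "'x \<times> 'u \<Rightarrow> real"
  assumes S: "subspace S" and W: "open W" "xs \<in> W" and V: "open V"
    and hom: "homeomorphism W V \<Phi> \<Psi>"
    and \<Phi>2: "Ck_on 2 \<Phi> W" and \<Psi>2: "Ck_on 2 \<Psi> V" and img: "\<Phi> ` (M \<inter> W) = S \<inter> V"
    and pr_S: "\<And>v. blinfun_apply pr v \<in> S" and pr_id: "\<And>v. v \<in> S \<Longrightarrow> blinfun_apply pr v = v"
    and pr_adj: "\<And>v w. blinfun_apply pr v \<bullet> w = v \<bullet> blinfun_apply pr w"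
    and Wg: "open Wg" "(xs, us) \<in> Wg" and gt2: "Ck_on 2 gt Wg"
    and g_gt: "\<And>y. y \<in> (M \<times> \<Omega>) \<inter> Wg \<Longrightarrow> g y = ereal (gt y)"
begin

definition \<phi> :: "'x \<Rightarrow> 'x" where "\<phi> s = \<Psi> (blinfun_apply pr s)"
definition d\<phi> :: "'x \<Rightarrow> 'x \<Rightarrow>\<^sub>L 'x" where "d\<phi> s = deriv_op \<Psi> (blinfun_apply pr s) o\<^sub>L pr"
definition sb :: 'x where "sb = \<Phi> xs"
text \<open>The coordinates and parameters at which the chart is valid and \<open>gt\<close>
  represents \<open>g\<close>.\<close>

definition dom :: "'x \<Rightarrow> 'u \<Rightarrow> bool" where
  "dom s u \<longleftrightarrow> blinfun_apply pr s \<in> V \<and> u \<in> \<Omega> \<and> (\<phi> s, u) \<in> Wg"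
definition G :: "'x \<times> 'u \<Rightarrow> real" where "G z = gt (\<phi> (fst z), snd z)"
text \<open>The gradient of s |-> G (s, u), composed from the derivatives of \<open>gt\<close> and
  \<phi> so that its own regularity can be read off.\<close>

definition \<Gamma> :: "'x \<times> 'u \<Rightarrow> 'x" where
  "\<Gamma> z = (\<Sum>e\<in>Basis. blinfun_apply (deriv_op gt (\<phi> (fst z), snd z)) (blinfun_apply (d\<phi> (fst z)) e, 0) *\<^sub>R e)"

lemma pr_pr [simp]: "blinfun_apply pr (blinfun_apply pr v) = blinfun_apply pr v"
  by (rule pr_id[OF pr_S])

lemma sb: "sb \<in> S" "sb \<in> V" "blinfun_apply pr sb = sb" "\<phi> sb = xs"
proof -
  have "sb \<in> \<Phi> ` (M \<inter> W)" unfolding sb_def using xs W by auto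
  then show "sb \<in> S" "sb \<in> V" using img by auto
  then show "blinfun_apply pr sb = sb" by (simp add: pr_id)
  then show "\<phi> sb = xs" unfolding \<phi>_def using homeomorphism_apply1[OF hom W(2)] by (simp add: sb_def)
qed

lemma \<phi>_mem:
  assumes "blinfun_apply pr s \<in> V"
  shows "\<phi> s \<in> M" "\<phi> s \<in> W" "\<Phi> (\<phi> s) = blinfun_apply pr s"
proof -
  have "blinfun_apply pr s \<in> \<Phi> ` (M \<inter> W)" using assms pr_S img by auto
  then obtain y where y: "y \<in> M" "y \<in> W" "blinfun_apply pr s = \<Phi> y" by auto
  then have "\<phi> s = y" unfolding \<phi>_def using homeomorphism_apply1[OF hom] by simp
  with y show "\<phi> s \<in> M" "\<phi> s \<in> W" "\<Phi> (\<phi> s) = blinfun_apply pr s" by auto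
qed

lemma \<Phi>_mem:
  assumes "x \<in> M" "x \<in> W"
  shows "\<Phi> x \<in> S" "\<Phi> x \<in> V" "blinfun_apply pr (\<Phi> x) = \<Phi> x" "\<phi> (\<Phi> x) = x"
proof -
  have "\<Phi> x \<in> \<Phi> ` (M \<inter> W)" using assms by auto
  then show "\<Phi> x \<in> S" "\<Phi> x \<in> V" using img by auto
  then show "blinfun_apply pr (\<Phi> x) = \<Phi> x" by (simp add: pr_id)
  then show "\<phi> (\<Phi> x) = x" unfolding \<phi>_def using homeomorphism_apply1[OF hom assms(2)] by simp
qed

lemma \<Psi>_deriv:
  assumes "y \<in> V"
  shows "(\<Psi> has_derivative blinfun_apply (deriv_op \<Psi> y)) (at y)"
  using C1_near_differentiable[OF Ck_on_2_imp_C1_near_deriv_op(2)[OF \<Psi>2 V assms]]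
  by (rule has_derivative_deriv_op)

lemma \<Phi>_deriv:
  assumes "y \<in> W"
  shows "(\<Phi> has_derivative blinfun_apply (deriv_op \<Phi> y)) (at y)"
  using C1_near_differentiable[OF Ck_on_2_imp_C1_near_deriv_op(2)[OF \<Phi>2 W(1) assms]]
  by (rule has_derivative_deriv_op)

lemma \<phi>_deriv:
  assumes "blinfun_apply pr s \<in> V"
  shows "(\<phi> has_derivative blinfun_apply (d\<phi> s)) (at s)"
proof -
  have "((\<lambda>s. \<Psi> (blinfun_apply pr s)) has_derivative (\<lambda>v. blinfun_apply (deriv_op \<Psi> (blinfun_apply pr s)) (blinfun_apply pr v))) (at s)"
    by (rule has_derivative_compose[OF bounded_linear_imp_has_derivative[OF blinfun.bounded_linear_right] \<Psi>_deriv[OF assms]])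
  then show ?thesis
    by (simp add: \<phi>_def[abs_def] d\<phi>_def blinfun_compose.rep_eq o_def)
qed

lemma d\<phi>_pr: "blinfun_apply (d\<phi> s) (blinfun_apply pr v) = blinfun_apply (d\<phi> s) v"
  and d\<phi>_pr': "d\<phi> (blinfun_apply pr s) = d\<phi> s"
  by (simp_all add: d\<phi>_def)

text \<open>Differentiating \<Phi> (\<Psi> y) = y gives the derivative of \<Psi> a left inverse;
  \<phi> sees v only through its projection to S.\<close>

lemma d\<phi>_injective:
  assumes "blinfun_apply pr s \<in> V" "blinfun_apply (d\<phi> s) v = 0"
  shows "blinfun_apply pr v = 0"
proof -
  let ?y = "blinfun_apply pr s"
  have yW: "\<Psi> ?y \<in> W" using \<phi>_mem(2)[OF assms(1)] by (simp add: \<phi>_def)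
  have "((\<lambda>y. \<Phi> (\<Psi> y)) has_derivative (\<lambda>v. blinfun_apply (deriv_op \<Phi> (\<Psi> ?y)) (blinfun_apply (deriv_op \<Psi> ?y) v))) (at ?y)"
    by (rule has_derivative_compose[OF \<Psi>_deriv[OF assms(1)] \<Phi>_deriv[OF yW]])
  moreover have "\<forall>\<^sub>F y in at ?y. \<Phi> (\<Psi> y) = y"
    using eventually_nhds_in_open[OF V assms(1)] homeomorphism_apply2[OF hom]
    by (auto simp: eventually_at_filter elim: eventually_mono)
  ultimately have "((\<lambda>y. y) has_derivative (\<lambda>v. blinfun_apply (deriv_op \<Phi> (\<Psi> ?y)) (blinfun_apply (deriv_op \<Psi> ?y) v))) (at ?y)"
    by (rule has_derivative_transform_eventually) (use homeomorphism_apply2[OF hom assms(1)] in auto)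
  from has_derivative_unique[OF this has_derivative_ident]
  have "blinfun_apply (deriv_op \<Phi> (\<Psi> ?y)) (blinfun_apply (deriv_op \<Psi> ?y) v) = v" for v by metis
  from this[of "blinfun_apply pr v"] show ?thesis using assms(2) by (simp add: d\<phi>_def)
qed

lemma dom_base: "dom sb us"
  unfolding dom_def using sb us Wg by simp

lemma dom_eventually:
  assumes "dom s u"
  shows "\<forall>\<^sub>F z in nhds (s, u). dom (fst z) (snd z)"
proof -
  have s: "blinfun_apply pr s \<in> V" "u \<in> \<Omega>" "(\<phi> s, u) \<in> Wg" using assms unfolding dom_def by auto
  have f: "(fst \<longlongrightarrow> s) (nhds (s, u))" "(snd \<longlongrightarrow> u) (nhds (s, u))"
    using tendsto_fst[OF filterlim_ident, of "(s, u)"] tendsto_snd[OF filterlim_ident, of "(s, u)"] by simp_all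
  have "(\<phi> \<longlongrightarrow> \<phi> s) (nhds s)"
    using has_derivative_continuous[OF \<phi>_deriv[OF s(1)]]
    by (simp add: continuous_within tendsto_at_iff_tendsto_nhds)
  then have \<phi>: "((\<lambda>z. \<phi> (fst z)) \<longlongrightarrow> \<phi> s) (nhds (s, u))"
    by (rule filterlim_compose[OF _ f(1)])
  have "\<forall>\<^sub>F z in nhds (s, u). blinfun_apply pr (fst z) \<in> V"
    by (rule topological_tendstoD[OF _ V s(1)]) (intro tendsto_intros f)
  moreover have "\<forall>\<^sub>F z in nhds (s, u). snd z \<in> \<Omega>"
    by (rule topological_tendstoD[OF f(2) \<Omega> s(2)])
  moreover have "\<forall>\<^sub>F z in nhds (s, u). (\<phi> (fst z), snd z) \<in> Wg"
    by (rule topological_tendstoD[OF tendsto_Pair[OF \<phi> f(2)] Wg(1) s(3)])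
  ultimately show ?thesis by eventually_elim (simp add: dom_def)
qed

lemma dom_line:
  assumes "dom s u"
  shows "\<forall>\<^sub>F t in nhds 0. dom (s + t *\<^sub>R v) u"
proof -
  have "((\<lambda>t. (s + t *\<^sub>R v, u)) \<longlongrightarrow> (s + 0 *\<^sub>R v, u)) (nhds 0)"
    by (intro tendsto_intros filterlim_ident)
  with dom_eventually[OF assms] show ?thesis unfolding filterlim_iff by force
qed

lemma g_eq_G:
  assumes "dom s u"
  shows "g (\<phi> s, u) = ereal (G (s, u))"
  using assms \<phi>_mem(1) g_gt unfolding dom_def G_def by auto

lemma gt_deriv:
  assumes "z \<in> Wg"
  shows "(gt has_derivative blinfun_apply (deriv_op gt z)) (at z)"
  using C1_near_differentiable[OF Ck_on_2_imp_C1_near_deriv_op(2)[OF gt2 Wg(1) assms]]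
  by (rule has_derivative_deriv_op)

lemma inner_\<Gamma>: "\<Gamma> (s, u) \<bullet> v = blinfun_apply (deriv_op gt (\<phi> s, u)) (blinfun_apply (d\<phi> s) v, 0)"
proof -
  let ?D = "\<lambda>v. blinfun_apply (deriv_op gt (\<phi> s, u)) (blinfun_apply (d\<phi> s) v, 0)"
  have lin: "linear ?D"
  proof (rule linearI)
    fix v w :: 'x and r :: real
    have "?D (v + w) = blinfun_apply (deriv_op gt (\<phi> s, u)) ((blinfun_apply (d\<phi> s) v, 0) + (blinfun_apply (d\<phi> s) w, 0))"
      by (simp add: blinfun.add_right)
    then show "?D (v + w) = ?D v + ?D w" by (simp only: blinfun.add_right)
    have "?D (r *\<^sub>R v) = blinfun_apply (deriv_op gt (\<phi> s, u)) (r *\<^sub>R (blinfun_apply (d\<phi> s) v, 0))"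
      by (simp add: blinfun.scaleR_right)
    then show "?D (r *\<^sub>R v) = r *\<^sub>R ?D v" by (simp only: blinfun.scaleR_right)
  qed
  have "?D v = ?D (\<Sum>e\<in>Basis. (v \<bullet> e) *\<^sub>R e)" by (simp add: euclidean_representation)
  also have "\<dots> = (\<Sum>e\<in>Basis. (v \<bullet> e) * ?D e)"
    by (simp add: linear_sum[OF lin] linear_cmul[OF lin])
  finally show ?thesis
    unfolding \<Gamma>_def by (simp add: inner_sum_left inner_sum_right inner_commute[of _ v] mult.commute)
qed

lemma \<Gamma>_pr: "\<Gamma> (s, u) \<bullet> blinfun_apply pr v = \<Gamma> (s, u) \<bullet> v"
  by (simp add: inner_\<Gamma> d\<phi>_pr)

lemma G_deriv:
  assumes "dom s u"
  shows "((\<lambda>s. G (s, u)) has_derivative (\<lambda>v. \<Gamma> (s, u) \<bullet> v)) (at s)"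
proof -
  have s: "blinfun_apply pr s \<in> V" "(\<phi> s, u) \<in> Wg" using assms unfolding dom_def by auto
  have "((\<lambda>s. (\<phi> s, u)) has_derivative (\<lambda>v. (blinfun_apply (d\<phi> s) v, 0))) (at s)"
    by (intro has_derivative_Pair \<phi>_deriv s has_derivative_const)
  from has_derivative_compose[OF this gt_deriv[OF s(2)]] show ?thesis
    by (simp add: G_def inner_\<Gamma>)
qed

lemma C1_near_\<phi>: "C1_near b \<phi> sb"
proof -
  have "C1_near True \<Psi> (blinfun_apply pr sb)"
    using Ck_on_2_imp_C1_near_deriv_op(2)[OF \<Psi>2 V sb(2)] sb(3) by simp
  from C1_near_compose[OF C1_near_linear[OF blinfun.bounded_linear_right] this]
  show ?thesis unfolding \<phi>_def[abs_def] by (rule C1_near_True_imp)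
qed

lemma C1_near_d\<phi>:
  assumes "C1_near b (deriv_op \<Psi>) sb"
  shows "C1_near b d\<phi> sb"
proof -
  have "C1_near b (\<lambda>s. deriv_op \<Psi> (blinfun_apply pr s)) sb"
    by (rule C1_near_compose[OF C1_near_linear[OF blinfun.bounded_linear_right]]) (simp add: sb(3) assms)
  from C1_near_lin_compose[OF bounded_bilinear.bounded_linear_left[OF bounded_bilinear_blinfun_compose] this, of pr]
  show ?thesis by (simp add: d\<phi>_def[abs_def])
qed

lemma C1_near_d\<phi>_False: "C1_near False d\<phi> sb"
  using C1_near_d\<phi> Ck_on_2_imp_C1_near_deriv_op(1)[OF \<Psi>2 V sb(2)] .

lemma C1_near_fst: "C1_near b h (fst z) \<Longrightarrow> C1_near b (\<lambda>z. h (fst z)) z"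
  by (rule C1_near_compose[OF C1_near_linear[OF bounded_linear_fst]])

lemma C1_near_\<Gamma>: "C1_near False \<Gamma> (sb, us)"
  unfolding \<Gamma>_def
proof (intro C1_near_sum C1_near_lin_compose[OF bounded_linear_scaleR_left])
  fix e :: 'x
  have 1: "C1_near False (\<lambda>z. (\<phi> (fst z), snd z)) (sb, us)"
    by (intro C1_near_Pair C1_near_fst C1_near_linear[OF bounded_linear_snd]) (simp add: C1_near_\<phi>)
  have 2: "C1_near False (\<lambda>z. deriv_op gt (\<phi> (fst z), snd z)) (sb, us)"
    by (rule C1_near_compose[OF 1]) (simp add: sb Ck_on_2_imp_C1_near_deriv_op(1)[OF gt2 Wg])
  have 3: "C1_near False (\<lambda>z. (blinfun_apply (d\<phi> (fst z)) e, 0::'u)) (sb, us)"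
    by (intro C1_near_Pair C1_near_const C1_near_lin_compose[OF blinfun.bounded_linear_left] C1_near_fst)
       (simp add: C1_near_d\<phi>_False)
  show "C1_near False (\<lambda>z. blinfun_apply (deriv_op gt (\<phi> (fst z), snd z)) (blinfun_apply (d\<phi> (fst z)) e, 0)) (sb, us)"
    by (rule C1_near_bilinear[OF bounded_bilinear_blinfun_apply 2 3])
qed

text \<open>Near its base point a curve in M is the image under \<phi> of its coordinate curve
  \<Phi> (\<gamma> t), so its velocity lies in the range of \<open>d\<phi> s\<close>. The third
  claim keeps this coordinate form, with which functions on M are differentiated along arbitrary
  curves.\<close>

lemma tangent_space_chart:
  assumes "blinfun_apply pr s \<in> V"
  shows "tangent_space M (\<phi> s) = range (blinfun_apply (d\<phi> s))"
    and "\<And>v. curve_at M (\<phi> s) (blinfun_apply (d\<phi> s) v) (\<lambda>t. \<phi> (s + t *\<^sub>R v))"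
    and "\<And>\<gamma> v. curve_at M (\<phi> s) v \<gamma> \<Longrightarrow>
      (\<forall>\<^sub>F t in nhds 0. \<gamma> t = \<phi> (\<Phi> (\<gamma> t)) \<and> \<Phi> (\<gamma> t) \<in> S \<inter> V) \<and>
      ((\<lambda>t. \<Phi> (\<gamma> t)) has_vector_derivative blinfun_apply (deriv_op \<Phi> (\<phi> s)) v) (at 0) \<and>
      v = blinfun_apply (d\<phi> s) (blinfun_apply (deriv_op \<Phi> (\<phi> s)) v)"
proof -
  show c: "curve_at M (\<phi> s) (blinfun_apply (d\<phi> s) v) (\<lambda>t. \<phi> (s + t *\<^sub>R v))" for v
    unfolding curve_at_def
  proof (intro conjI)
    have "((\<lambda>t. blinfun_apply pr (s + t *\<^sub>R v)) \<longlongrightarrow> blinfun_apply pr (s + 0 *\<^sub>R v)) (nhds 0)"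
      by (intro tendsto_intros filterlim_ident)
    then have "\<forall>\<^sub>F t in nhds 0. blinfun_apply pr (s + t *\<^sub>R v) \<in> V"
      by (rule topological_tendstoD[OF _ V]) (simp add: assms)
    then show "\<forall>\<^sub>F t in nhds 0. \<phi> (s + t *\<^sub>R v) \<in> M" by eventually_elim (rule \<phi>_mem)
    show "((\<lambda>t. \<phi> (s + t *\<^sub>R v)) has_vector_derivative blinfun_apply (d\<phi> s) v) (at 0)"
      by (rule curve_has_derivative[OF _ line_has_derivative]) (simp add: \<phi>_deriv[OF assms])
  qed simp
  show d: "(\<forall>\<^sub>F t in nhds 0. \<gamma> t = \<phi> (\<Phi> (\<gamma> t)) \<and> \<Phi> (\<gamma> t) \<in> S \<inter> V) \<and>
      ((\<lambda>t. \<Phi> (\<gamma> t)) has_vector_derivative blinfun_apply (deriv_op \<Phi> (\<phi> s)) v) (at 0) \<and>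
      v = blinfun_apply (d\<phi> s) (blinfun_apply (deriv_op \<Phi> (\<phi> s)) v)"
    if \<gamma>: "curve_at M (\<phi> s) v \<gamma>" for \<gamma> v
  proof -
    have g0: "\<gamma> 0 = \<phi> s" and gM: "\<forall>\<^sub>F t in nhds 0. \<gamma> t \<in> M" and gd: "(\<gamma> has_vector_derivative v) (at 0)"
      using \<gamma> unfolding curve_at_def by auto
    have "\<forall>\<^sub>F t in nhds 0. \<gamma> t \<in> W"
      by (rule topological_tendstoD[OF tendsto_of_has_vector_derivative[OF gd] W(1)])
         (simp add: g0 \<phi>_mem(2)[OF assms])
    with gM have ev: "\<forall>\<^sub>F t in nhds 0. \<gamma> t = \<phi> (\<Phi> (\<gamma> t)) \<and> \<Phi> (\<gamma> t) \<in> S \<inter> V"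
      by eventually_elim (simp add: \<Phi>_mem)
    have d1: "((\<lambda>t. \<Phi> (\<gamma> t)) has_vector_derivative blinfun_apply (deriv_op \<Phi> (\<phi> s)) v) (at 0)"
      by (rule curve_has_derivative[OF _ gd]) (simp add: g0 \<Phi>_deriv[OF \<phi>_mem(2)[OF assms]])
    have "(\<phi> has_derivative blinfun_apply (d\<phi> s)) (at (\<Phi> (\<gamma> 0)))"
      using \<phi>_deriv[of "blinfun_apply pr s"] assms by (simp add: g0 \<phi>_mem(3)[OF assms] d\<phi>_pr')
    from curve_has_derivative[where \<gamma> = "\<lambda>t. \<Phi> (\<gamma> t)", OF this d1]
    have "((\<lambda>t. \<phi> (\<Phi> (\<gamma> t))) has_vector_derivative blinfun_apply (d\<phi> s) (blinfun_apply (deriv_op \<Phi> (\<phi> s)) v)) (at 0)" .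
    moreover have "\<forall>\<^sub>F t in nhds 0. \<phi> (\<Phi> (\<gamma> t)) = \<gamma> t" using ev by eventually_elim simp
    ultimately have "(\<gamma> has_vector_derivative blinfun_apply (d\<phi> s) (blinfun_apply (deriv_op \<Phi> (\<phi> s)) v)) (at 0)"
      by (rule has_vector_derivative_transform_nhds)
    then have "v = blinfun_apply (d\<phi> s) (blinfun_apply (deriv_op \<Phi> (\<phi> s)) v)"
      by (rule vector_derivative_unique_at[OF gd])
    with ev d1 show ?thesis by (intro conjI)
  qed
  show "tangent_space M (\<phi> s) = range (blinfun_apply (d\<phi> s))"
  proof
    show "tangent_space M (\<phi> s) \<subseteq> range (blinfun_apply (d\<phi> s))"
    proof
      fix v assume "v \<in> tangent_space M (\<phi> s)"
      then obtain \<gamma> where "curve_at M (\<phi> s) v \<gamma>" unfolding tangent_space_def by auto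
      from d[OF this] show "v \<in> range (blinfun_apply (d\<phi> s))" by (metis rangeI)
    qed
    show "range (blinfun_apply (d\<phi> s)) \<subseteq> tangent_space M (\<phi> s)"
      unfolding tangent_space_def using c by (auto intro!: exI)
  qed
qed

lemma normal_space_chart:
  assumes "blinfun_apply pr s \<in> V"
  shows "n \<in> normal_space M (\<phi> s) \<longleftrightarrow> (\<forall>c. blinfun_apply (d\<phi> s) c \<bullet> n = 0)"
  unfolding normal_space_iff tangent_space_chart(1)[OF assms] by auto

text \<open>Normality is a system of linear equations whose coefficients, the columns of
  \<open>d\<phi>\<close>, depend continuously on the point. This supplies the hypothesis
  \<open>closed\<close> of \<open>identification\<close>.\<close>

lemma normal_closed:
  assumes z: "\<And>n::nat. z n \<in> M \<and> d n \<in> normal_space M (z n)" "z \<longlonglongrightarrow> xs" and d: "d \<longlonglongrightarrow> l"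
  shows "l \<in> normal_space M xs"
proof -
  have "\<forall>\<^sub>F n in sequentially. z n \<in> W" using z(2) W by (rule topological_tendstoD)
  have \<Phi>z: "(\<lambda>n. \<Phi> (z n)) \<longlonglongrightarrow> sb"
    unfolding sb_def
    using continuous_within_tendsto_compose'[of xs UNIV \<Phi> z sequentially] has_derivative_continuous[OF \<Phi>_deriv[OF W(2)]] z(2)
    by simp
  have "blinfun_apply (d\<phi> sb) c \<bullet> l = 0" for c
  proof -
    have "(\<lambda>n. d\<phi> (\<Phi> (z n))) \<longlonglongrightarrow> d\<phi> sb"
      using filterlim_compose[OF C1_near_tendsto[OF C1_near_d\<phi>_False] \<Phi>z] .
    then have "(\<lambda>n. blinfun_apply (d\<phi> (\<Phi> (z n))) c \<bullet> d n) \<longlonglongrightarrow> blinfun_apply (d\<phi> sb) c \<bullet> l"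
      by (intro tendsto_intros d)
    moreover have "\<forall>\<^sub>F n in sequentially. blinfun_apply (d\<phi> (\<Phi> (z n))) c \<bullet> d n = 0"
      using \<open>\<forall>\<^sub>F n in sequentially. z n \<in> W\<close>
    proof eventually_elim
      case (elim n)
      have "blinfun_apply pr (\<Phi> (z n)) \<in> V" "\<phi> (\<Phi> (z n)) = z n"
        using \<Phi>_mem[of "z n"] elim z(1) by auto
      then show ?case using normal_space_chart[of "\<Phi> (z n)" "d n"] z(1) by simp
    qed
    ultimately have "(\<lambda>n::nat. 0::real) \<longlonglongrightarrow> blinfun_apply (d\<phi> sb) c \<bullet> l"
      by (rule Lim_transform_eventually)
    then show ?thesis using LIMSEQ_unique[OF tendsto_const] by metis
  qed
  then show ?thesis using normal_space_chart[of sb l] sb by simp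
qed

text \<open>In coordinates: the tangential part of v is the Riemannian gradient of g(., u) at \<phi>
  s. It is the part of the subgradient condition that is visible on M.\<close>

definition critical :: "'x \<Rightarrow> 'u \<Rightarrow> 'x \<Rightarrow> bool" where
  "critical s u v \<longleftrightarrow> (\<forall>c. v \<bullet> blinfun_apply (d\<phi> s) c = \<Gamma> (s, u) \<bullet> c)"

text \<open>g(., u) minus the linear function with slope p is minimal at \<phi> s, so its derivative
  along curves in M vanishes there.\<close>

lemma subgradient_critical:
  assumes "dom s u" "p \<in> Q (\<phi> s) u"
  shows "critical s u p"
  unfolding critical_def
proof
  fix c
  have s: "blinfun_apply pr s \<in> V" using assms(1) unfolding dom_def by auto
  let ?k = "\<lambda>t. G (s + t *\<^sub>R c, u) - p \<bullet> \<phi> (s + t *\<^sub>R c)"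
  have dG: "((\<lambda>t. G (s + t *\<^sub>R c, u)) has_vector_derivative \<Gamma> (s, u) \<bullet> c) (at 0)"
    using curve_has_derivative[where \<phi> = "\<lambda>s. G (s, u)", OF _ line_has_derivative] G_deriv[OF assms(1)] by fastforce
  have dp: "((\<lambda>t. \<phi> (s + t *\<^sub>R c)) has_vector_derivative blinfun_apply (d\<phi> s) c) (at 0)"
    using curve_has_derivative[where \<phi> = \<phi>, OF _ line_has_derivative] \<phi>_deriv[OF s] by fastforce
  have "(?k has_vector_derivative \<Gamma> (s, u) \<bullet> c - p \<bullet> blinfun_apply (d\<phi> s) c) (at 0)"
    by (intro has_vector_derivative_diff dG bounded_linear.has_vector_derivative[OF bounded_linear_inner_right dp])
  then have "(?k has_real_derivative \<Gamma> (s, u) \<bullet> c - p \<bullet> blinfun_apply (d\<phi> s) c) (at 0)"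
    by (simp add: has_real_derivative_iff_has_vector_derivative)
  moreover have "\<forall>\<^sub>F t in nhds 0. ?k 0 \<le> ?k t"
    using dom_line[OF assms(1), of c]
  proof eventually_elim
    case (elim t)
    have "g (\<phi> s, u) + ereal (p \<bullet> (\<phi> (s + t *\<^sub>R c) - \<phi> s)) \<le> g (\<phi> (s + t *\<^sub>R c), u)"
      using assms(2) unfolding convex_subgradients_def by auto
    then show ?case
      unfolding g_eq_G[OF assms(1)] g_eq_G[OF elim] by (simp add: inner_diff_right)
  qed
  ultimately have "\<Gamma> (s, u) \<bullet> c - p \<bullet> blinfun_apply (d\<phi> s) c = 0"
    by (rule local_min_derivative_zero)
  then show "p \<bullet> blinfun_apply (d\<phi> s) c = \<Gamma> (s, u) \<bullet> c" by simp
qed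

text \<open>A converse near the solution. Two vectors critical at the same point differ by a normal,
  which is the hypothesis \<open>normal\<close> of \<open>identification\<close>; a smooth equation
  on M thus decides membership in a nonsmooth subdifferential.\<close>

lemma critical_identification:
  "\<forall>\<^sub>F z in nhds (sb, us, - grad_x f (xs, us)).
     dom (fst z) (fst (snd z)) \<and>
     (critical (fst z) (fst (snd z)) (snd (snd z)) \<longrightarrow> snd (snd z) \<in> Q (\<phi> (fst z)) (fst (snd z)))"
proof -
  let ?a = "(sb, us, - grad_x f (xs, us))"
  have "((\<lambda>z. (fst z, fst (snd z))) \<longlongrightarrow> (sb, us)) (nhds ?a)"
    using tendsto_Pair[OF tendsto_fst[OF filterlim_ident, of ?a] tendsto_fst[OF tendsto_snd[OF filterlim_ident, of ?a]]]
    by simp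
  with dom_eventually[OF dom_base] have "\<forall>\<^sub>F z in nhds ?a. dom (fst z) (fst (snd z))"
    unfolding filterlim_iff by force
  moreover have "\<forall>\<^sub>F z in nhds ?a. dom (fst z) (fst (snd z)) \<longrightarrow>
     critical (fst z) (fst (snd z)) (snd (snd z)) \<longrightarrow> snd (snd z) \<in> Q (\<phi> (fst z)) (fst (snd z))"
  proof (rule eventually_nhds_sequence)
    fix z :: "nat \<Rightarrow> 'x \<times> 'u \<times> 'x"
    define s where "s = (\<lambda>n. fst (z n))"
    define u where "u = (\<lambda>n. fst (snd (z n)))"
    define v where "v = (\<lambda>n. snd (snd (z n)))"
    assume "\<And>n. \<not> (dom (fst (z n)) (fst (snd (z n))) \<longrightarrow>
      critical (fst (z n)) (fst (snd (z n))) (snd (snd (z n))) \<longrightarrow> snd (snd (z n)) \<in> Q (\<phi> (fst (z n))) (fst (snd (z n))))"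
    then have D: "dom (s n) (u n)" and C: "critical (s n) (u n) (v n)" and N: "v n \<notin> Q (\<phi> (s n)) (u n)" for n
      unfolding s_def u_def v_def by auto
    assume "z \<longlonglongrightarrow> ?a"
    then have l: "s \<longlonglongrightarrow> sb" "u \<longlonglongrightarrow> us" "v \<longlonglongrightarrow> - grad_x f (xs, us)"
      using tendsto_fst[of z ?a] tendsto_fst[OF tendsto_snd[of z ?a]] tendsto_snd[OF tendsto_snd[of z ?a]]
      unfolding s_def u_def v_def by simp_all
    have sV: "blinfun_apply pr (s n) \<in> V" for n using D unfolding dom_def by auto
    have "\<forall>\<^sub>F n in sequentially. v n \<in> Q (\<phi> (s n)) (u n)"
    proof (rule identification[where y = "\<lambda>n. \<phi> (s n)" and t = u, OF _ _ _ l(2,3)])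
      show "\<phi> (s n) \<in> M" for n by (rule \<phi>_mem[OF sV])
      show "(\<lambda>n. \<phi> (s n)) \<longlonglongrightarrow> xs"
        using filterlim_compose[OF C1_near_tendsto[OF C1_near_\<phi>] l(1)] sb by simp
      show "u n \<in> \<Omega>" for n using D unfolding dom_def by auto
      show "v n - p \<in> normal_space M (\<phi> (s n))" if "p \<in> Q (\<phi> (s n)) (u n)" for n p
        using subgradient_critical[OF D that] C[of n] unfolding normal_space_chart[OF sV] critical_def
        by (simp add: inner_diff_right inner_commute[of "blinfun_apply _ _"])
    qed (rule normal_closed)
    then show False using N by simp
  qed
  ultimately show ?thesis by eventually_elim auto
qed

end

lemma small_of_zero_derivative:
  fixes k :: "real \<Rightarrow> real"
  assumes "(k has_real_derivative 0) (at 0)" "k 0 = 0" "\<epsilon> > 0"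
  shows "\<exists>\<delta>>0. \<forall>t. \<bar>t\<bar> < \<delta> \<longrightarrow> \<bar>k t\<bar> \<le> \<epsilon> * \<bar>t\<bar>"
proof -
  have "((\<lambda>t. k t / t) \<longlongrightarrow> 0) (at 0)"
    using assms(1,2) by (simp add: DERIV_def)
  then have "\<forall>\<^sub>F t in at 0. dist (k t / t) 0 < \<epsilon>" using assms(3) by (rule tendstoD)
  then obtain \<delta> where \<delta>: "\<delta> > 0" "\<And>t. t \<noteq> 0 \<Longrightarrow> dist t 0 < \<delta> \<Longrightarrow> dist (k t / t) 0 < \<epsilon>"
    unfolding eventually_at by auto
  have "\<bar>k t\<bar> \<le> \<epsilon> * \<bar>t\<bar>" if "\<bar>t\<bar> < \<delta>" for t
  proof (cases "t = 0")
    case False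
    then have "\<bar>k t\<bar> / \<bar>t\<bar> < \<epsilon>" using \<delta>(2)[of t] that by (simp add: dist_real_def)
    then show ?thesis using False by (simp add: pos_divide_less_eq less_imp_le)
  qed (use assms(2) in simp)
  with \<delta>(1) show ?thesis by blast
qed

context partly_smooth_composite
begin

lemma grad_f: "GDERIV (\<lambda>y. f (y, u)) x :> grad_x f (x, u)"
  unfolding grad_x_def by (simp add: GDERIV_gradient f_section_differentiable)

lemma grad_f_subgradient: "- grad_x f (xs, us) \<in> Q xs us"
  using nondegenerate_prox rel_interior_subset by blast

lemma grad_f_eq: "grad_x f z = (\<Sum>e\<in>Basis. blinfun_apply (deriv_op f z) (e, 0) *\<^sub>R e)"
proof -
  obtain x u where z: "z = (x, u)" by (cases z)
  have "((\<lambda>y. (y, u)) has_derivative (\<lambda>h. (h, 0))) (at x)"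
    by (auto intro!: derivative_eq_intros)
  from has_derivative_compose[OF this has_derivative_deriv_op[OF f_differentiable]]
  have "((\<lambda>y. f (y, u)) has_derivative (\<lambda>h. blinfun_apply (deriv_op f (x, u)) (h, 0))) (at x)" .
  from gradient_eq[OF GDERIV_of_has_derivative[OF this]] show ?thesis
    unfolding z grad_x_def by simp
qed

lemma C1_near_grad_f: "C1_near False (grad_x f) z"
proof -
  have d: "C1_near False (deriv_op f) z"
    using Ck_on_2_imp_C1_near_deriv_op(1)[OF f_C2] by simp
  have "C1_near False (\<lambda>z. \<Sum>e\<in>Basis. blinfun_apply (deriv_op f z) (e, 0::'u) *\<^sub>R e) z"
    by (intro C1_near_sum C1_near_lin_compose[OF bounded_linear_scaleR_left]
        C1_near_lin_compose[OF blinfun.bounded_linear_left d])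
  then show ?thesis by (simp add: grad_f_eq[abs_def])
qed

end

section \<open>The stationarity equation of the proximal subproblem\<close>

context chart
begin

text \<open>The gradient in s of a G (s, u) + |\<phi> s - w|^2 / 2, completed by
  \<open>s - blinfun_apply pr s\<close>. Since \<phi> and G ignore the component of s orthogonal to
  S, the gradient alone would have a derivative that is degenerate in those directions; the added
  term forces the component to be 0.\<close>

definition H :: "'x \<times> real \<times> 'x \<times> 'u \<Rightarrow> 'x" where
  "H = (\<lambda>(s, a, w, u). a *\<^sub>R \<Gamma> (s, u) + adj (d\<phi> s) (\<phi> s - w) + (s - blinfun_apply pr s))"

lemma inner_H: "H (s, a, w, u) \<bullet> c
    = a * (\<Gamma> (s, u) \<bullet> c) + (\<phi> s - w) \<bullet> blinfun_apply (d\<phi> s) c + (s - blinfun_apply pr s) \<bullet> c"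
  unfolding H_def by (simp add: inner_add_left inner_adj inner_commute[of "\<phi> s - w"])

text \<open>Testing with the component of s orthogonal to S isolates the added term, which must
  vanish; the rest is the first-order condition.\<close>

lemma H_zeroD:
  assumes "H (s, a, w, u) = 0" "a > 0"
  shows "critical s u ((w - \<phi> s) /\<^sub>R a)"
proof -
  let ?c = "s - blinfun_apply pr s"
  have pc: "blinfun_apply pr ?c = 0" by (simp add: blinfun.diff_right)
  have "\<Gamma> (s, u) \<bullet> ?c = 0" using \<Gamma>_pr[of s u ?c] pc by simp
  moreover have "blinfun_apply (d\<phi> s) ?c = 0" using d\<phi>_pr[of s ?c] pc by simp
  ultimately have "?c \<bullet> ?c = 0" using inner_H[of s a w u ?c] assms(1) by simp
  then have c: "?c = 0" by simp
  show ?thesis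
    unfolding critical_def
  proof
    fix d
    have "a * (\<Gamma> (s, u) \<bullet> d) = (w - \<phi> s) \<bullet> blinfun_apply (d\<phi> s) d"
      using inner_H[of s a w u d] assms(1) c by (simp add: inner_diff_left)
    then have "((w - \<phi> s) /\<^sub>R a) \<bullet> blinfun_apply (d\<phi> s) d = inverse a * (a * (\<Gamma> (s, u) \<bullet> d))"
      by simp
    then show "((w - \<phi> s) /\<^sub>R a) \<bullet> blinfun_apply (d\<phi> s) d = \<Gamma> (s, u) \<bullet> d"
      using assms(2) by simp
  qed
qed

abbreviation "wb a \<equiv> xs - a *\<^sub>R grad_x f (xs, us)"

lemma H_base: "H (sb, a, wb a, us) = 0"
proof -
  have "critical sb us (- grad_x f (xs, us))"
    by (rule subgradient_critical[OF dom_base]) (simp add: sb grad_f_subgradient)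
  then have c: "grad_x f (xs, us) \<bullet> blinfun_apply (d\<phi> sb) c = - (\<Gamma> (sb, us) \<bullet> c)" for c
    unfolding critical_def by (metis inner_minus_left minus_minus)
  have "H (sb, a, wb a, us) \<bullet> c = 0" for c
    unfolding inner_H by (simp add: sb c)
  then show ?thesis using inner_eq_zero_iff by blast
qed

(* Along a kernel direction v the objective q t of the proximal problem grows only like o(t^2),
   whereas strong convexity makes it grow at least like |phi (sb + t v) - xs|^2 / 2. *)
lemma H_injective:
  assumes a: "a > 0" and D: "(H has_derivative D) (at (sb, a, wb a, us))" "D (v, 0) = 0"
  shows "v = 0"
proof -
  define s where "s = (\<lambda>t. sb + t *\<^sub>R v)"
  define K where "K = (\<lambda>t. H (s t, a, wb a, us))"
  have K0: "K 0 = 0" unfolding K_def s_def by (simp add: H_base)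
  have "((\<lambda>t. (s t, a, wb a, us)) has_vector_derivative (v, 0, 0, 0)) (at 0)"
    unfolding s_def
    by (intro has_vector_derivative_Pair line_has_derivative has_vector_derivative_const)
  from curve_has_derivative[where \<gamma> = "\<lambda>t. (s t, a, wb a, us)", OF _ this, of H D] D
  have "(K has_vector_derivative 0) (at 0)"
    unfolding K_def by (simp add: s_def zero_prod_def)
  from bounded_linear.has_vector_derivative[OF bounded_linear_inner_left this]
  have Kc: "((\<lambda>t. K t \<bullet> c) has_real_derivative 0) (at 0)" for c
    by (simp add: has_real_derivative_iff_has_vector_derivative)
  \<comment> \<open>Orthogonally to S only the added term of H is present, so a kernel direction v
    has no such component and the whole line s t stays in S.\<close>
  let ?c = "v - blinfun_apply pr v"
  have pc: "blinfun_apply pr ?c = 0" by (simp add: blinfun.diff_right)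
  have "K t \<bullet> ?c = t * (?c \<bullet> ?c)" for t
  proof -
    have "\<Gamma> (s t, us) \<bullet> ?c = 0" using \<Gamma>_pr[of "s t" us ?c] pc by simp
    moreover have "blinfun_apply (d\<phi> (s t)) ?c = 0" using d\<phi>_pr[of "s t" ?c] pc by simp
    moreover have "s t - blinfun_apply pr (s t) = t *\<^sub>R ?c"
      unfolding s_def by (simp add: blinfun.add_right blinfun.scaleR_right sb algebra_simps)
    ultimately show ?thesis unfolding K_def inner_H by simp
  qed
  then have "((\<lambda>t. t * (?c \<bullet> ?c)) has_real_derivative 0) (at 0)" using Kc[of ?c] by simp
  moreover have "((\<lambda>t. t * (?c \<bullet> ?c)) has_real_derivative ?c \<bullet> ?c) (at 0)"
    by (auto intro!: derivative_eq_intros)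
  ultimately have "?c \<bullet> ?c = 0" by (rule DERIV_unique[symmetric])
  then have pv: "blinfun_apply pr v = v" by simp
  have ps: "blinfun_apply pr (s t) = s t" for t
    unfolding s_def by (simp add: blinfun.add_right blinfun.scaleR_right sb pv)
  define q where "q = (\<lambda>t. a * G (s t, us) + (norm (\<phi> (s t) - wb a))\<^sup>2 / 2)"
  have dom: "\<forall>\<^sub>F t in nhds 0. dom (s t) us" unfolding s_def by (rule dom_line[OF dom_base])
  have dq: "(q has_real_derivative K t \<bullet> v) (at t)" if "dom (s t) us" for t
  proof -
    have "((\<lambda>h. sb + h *\<^sub>R v) has_vector_derivative v) (at t)"
      by (auto intro!: derivative_eq_intros)
    then have ds: "(s has_derivative (\<lambda>h. h *\<^sub>R v)) (at t)"
      unfolding s_def has_vector_derivative_def .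
    have pV: "blinfun_apply pr (s t) \<in> V" using that unfolding dom_def by auto
    have d1: "((\<lambda>t. G (s t, us)) has_derivative (\<lambda>h. \<Gamma> (s t, us) \<bullet> (h *\<^sub>R v))) (at t)"
      by (rule has_derivative_compose[OF ds G_deriv[OF that]])
    have d2: "((\<lambda>t. \<phi> (s t) - wb a) has_derivative (\<lambda>h. blinfun_apply (d\<phi> (s t)) (h *\<^sub>R v))) (at t)"
      using has_derivative_diff[OF has_derivative_compose[OF ds \<phi>_deriv[OF pV]] has_derivative_const] by simp
    have "((\<lambda>t. a * G (s t, us) + ((\<phi> (s t) - wb a) \<bullet> (\<phi> (s t) - wb a)) / 2) has_derivative
       (\<lambda>h. a * (\<Gamma> (s t, us) \<bullet> (h *\<^sub>R v)) + ((\<phi> (s t) - wb a) \<bullet> blinfun_apply (d\<phi> (s t)) (h *\<^sub>R v)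
          + blinfun_apply (d\<phi> (s t)) (h *\<^sub>R v) \<bullet> (\<phi> (s t) - wb a)) / 2)) (at t)"
      by (rule has_derivative_add[OF has_derivative_mult_right[OF d1]
            bounded_linear.has_derivative[OF bounded_linear_divide has_derivative_inner[OF d2 d2]]])
    moreover have "(\<lambda>h. a * (\<Gamma> (s t, us) \<bullet> (h *\<^sub>R v)) + ((\<phi> (s t) - wb a) \<bullet> blinfun_apply (d\<phi> (s t)) (h *\<^sub>R v)
          + blinfun_apply (d\<phi> (s t)) (h *\<^sub>R v) \<bullet> (\<phi> (s t) - wb a)) / 2) = (\<lambda>h. (K t \<bullet> v) * h)"
      unfolding K_def inner_H
      by (rule ext) (simp add: ps blinfun.scaleR_right inner_commute algebra_simps
        add_divide_distrib diff_divide_distrib)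
    ultimately show ?thesis
      unfolding q_def has_field_derivative_def power2_norm_eq_inner by simp
  qed
  have q_low: "q 0 + (norm (\<phi> (s t) - xs))\<^sup>2 / 2 \<le> q t" if "dom (s t) us" for t
  proof -
    have "(wb a - xs) /\<^sub>R a \<in> Q xs us" using grad_f_subgradient a by simp
    from prox_eqI(2)[OF a this, of "\<phi> (s t)"]
    have "ereal a * g (xs, us) + ereal ((norm (xs - wb a))\<^sup>2 / 2 + (norm (\<phi> (s t) - xs))\<^sup>2 / 2)
      \<le> ereal a * g (\<phi> (s t), us) + ereal ((norm (\<phi> (s t) - wb a))\<^sup>2 / 2)" .
    then show ?thesis
      using g_eq_G[OF that] g_eq_G[OF dom_base] unfolding q_def s_def by (simp add: sb)
  qed
  obtain r where r: "r > 0" "\<And>t. \<bar>t\<bar> < r \<Longrightarrow> dom (s t) us"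
    using dom unfolding eventually_nhds_metric by (auto simp: dist_real_def)
  let ?e = "blinfun_apply (d\<phi> sb) v"
  have "?e = 0"
  proof (rule ccontr)
    assume e: "?e \<noteq> 0"
    \<comment> \<open>A quarter of |?e|^2, so that the upper and lower estimates meet in |?e|^4 <=
      |?e|^4 / 2.\<close>
    define \<epsilon> where "\<epsilon> = (norm ?e)\<^sup>2 / 4"
    have \<epsilon>: "\<epsilon> > 0" using e unfolding \<epsilon>_def by simp
    obtain \<delta> where \<delta>: "\<delta> > 0" "\<And>t. \<bar>t\<bar> < \<delta> \<Longrightarrow> \<bar>K t \<bullet> v\<bar> \<le> \<epsilon> * \<bar>t\<bar>"
      using small_of_zero_derivative[OF Kc[of v] _ \<epsilon>] K0 by auto
    have small: "(norm (\<phi> (s t) - xs))\<^sup>2 \<le> 2 * \<epsilon> * t\<^sup>2" if t: "0 < t" "t < min \<delta> r" for t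
    proof -
      obtain \<xi> where \<xi>: "0 < \<xi>" "\<xi> < t" "q t - q 0 = (t - 0) * (K \<xi> \<bullet> v)"
        using MVT2[of 0 t q "\<lambda>t. K t \<bullet> v"] dq r(2) t by auto
      have "(norm (\<phi> (s t) - xs))\<^sup>2 / 2 \<le> q t - q 0" using q_low[OF r(2)[of t]] t by simp
      also have "\<dots> \<le> t * (\<epsilon> * \<xi>)"
        unfolding \<xi>(3) using \<delta>(2)[of \<xi>] \<xi> t by simp
      also have "\<dots> \<le> t * (\<epsilon> * t)" using \<xi> t \<epsilon> by simp
      finally show ?thesis by (simp add: power2_eq_square mult_ac)
    qed
    let ?m = "\<lambda>t. \<phi> (s t) \<bullet> ?e"
    have "((\<lambda>t. \<phi> (s t)) has_vector_derivative ?e) (at 0)"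
      unfolding s_def by (rule curve_has_derivative[OF _ line_has_derivative]) (simp add: \<phi>_deriv sb)
    from bounded_linear.has_vector_derivative[OF bounded_linear_inner_left this]
    have "(?m has_real_derivative ?e \<bullet> ?e) (at 0)"
      by (simp add: has_real_derivative_iff_has_vector_derivative)
    then have "((\<lambda>t. (?m t - ?m 0) / t) \<longlongrightarrow> ?e \<bullet> ?e) (at 0)"
      by (simp add: DERIV_def)
    then have "((\<lambda>t. (?m t - ?m 0) / t) \<longlongrightarrow> ?e \<bullet> ?e) (at_right 0)"
      by (rule tendsto_within_subset) simp
    then have "((\<lambda>t. ((?m t - ?m 0) / t)\<^sup>2) \<longlongrightarrow> (?e \<bullet> ?e)\<^sup>2) (at_right 0)"
      by (rule tendsto_power)
    moreover have "\<forall>\<^sub>F t in at_right 0. ((?m t - ?m 0) / t)\<^sup>2 \<le> 2 * \<epsilon> * (norm ?e)\<^sup>2"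
    proof -
      have "\<forall>\<^sub>F t in at_right (0::real). 0 < t \<and> t < min \<delta> r"
        using \<delta>(1) r(1) by (auto simp: eventually_at_right_field intro!: exI[of _ "min \<delta> r"])
      then show ?thesis
      proof eventually_elim
        case (elim t)
        have "?m t - ?m 0 = (\<phi> (s t) - xs) \<bullet> ?e"
          by (simp add: inner_diff_left s_def sb)
        then have "(?m t - ?m 0)\<^sup>2 \<le> (norm (\<phi> (s t) - xs))\<^sup>2 * (norm ?e)\<^sup>2"
          using Cauchy_Schwarz_ineq[of "\<phi> (s t) - xs" ?e] by (simp add: power2_norm_eq_inner)
        also have "\<dots> \<le> 2 * \<epsilon> * t\<^sup>2 * (norm ?e)\<^sup>2"
          using small elim by (intro mult_right_mono) auto
        finally show ?case using elim by (simp add: power_divide pos_divide_le_eq mult_ac)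
      qed
    qed
    ultimately have "(?e \<bullet> ?e)\<^sup>2 \<le> 2 * \<epsilon> * (norm ?e)\<^sup>2"
      by (intro tendsto_upperbound) auto
    then have "(norm ?e)\<^sup>2 * (norm ?e)\<^sup>2 \<le> 1 / 2 * ((norm ?e)\<^sup>2 * (norm ?e)\<^sup>2)"
      unfolding \<epsilon>_def power2_norm_eq_inner by (simp add: power2_eq_square)
    moreover have "(norm ?e)\<^sup>2 * (norm ?e)\<^sup>2 > 0" using e by simp
    ultimately show False by linarith
  qed
  then have "blinfun_apply pr v = 0" by (intro d\<phi>_injective[of sb]) (simp_all add: sb)
  then show ?thesis using pv by simp
qed

lemma C1_near_H:
  assumes \<Gamma>C: "C1_near b \<Gamma> (sb, us)" and \<Psi>C: "C1_near b (deriv_op \<Psi>) sb"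
  shows "C1_near b H (sb, a, w, us)"
proof -
  let ?z = "(sb, a, w, us)"
  have s: "C1_near b (\<lambda>z::'x \<times> real \<times> 'x \<times> 'u. fst z) ?z"
    and a: "C1_near b (\<lambda>z::'x \<times> real \<times> 'x \<times> 'u. fst (snd z)) ?z"
    and w: "C1_near b (\<lambda>z::'x \<times> real \<times> 'x \<times> 'u. fst (snd (snd z))) ?z"
    and u: "C1_near b (\<lambda>z::'x \<times> real \<times> 'x \<times> 'u. snd (snd (snd z))) ?z"
    by (intro C1_near_linear bounded_linear_intros)+
  have 1: "C1_near b (\<lambda>z. \<Gamma> (fst z, snd (snd (snd z)))) ?z"
    by (rule C1_near_compose[OF C1_near_Pair[OF s u]]) (simp add: \<Gamma>C)
  have 2: "C1_near b (\<lambda>z::'x \<times> real \<times> 'x \<times> 'u. d\<phi> (fst z)) ?z"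
    by (rule C1_near_compose[OF s]) (simp add: C1_near_d\<phi>[OF \<Psi>C])
  have 3: "C1_near b (\<lambda>z::'x \<times> real \<times> 'x \<times> 'u. \<phi> (fst z)) ?z"
    by (rule C1_near_compose[OF s]) (simp add: C1_near_\<phi>)
  have "C1_near b (\<lambda>z. fst (snd z) *\<^sub>R \<Gamma> (fst z, snd (snd (snd z)))
      + adj (d\<phi> (fst z)) (\<phi> (fst z) - fst (snd (snd z))) + (fst z - blinfun_apply pr (fst z))) ?z"
    by (intro C1_near_add C1_near_diff C1_near_adj C1_near_bilinear[OF bounded_bilinear_scaleR] a s w 1 2 3
        C1_near_lin_compose[OF blinfun.bounded_linear_right])
  then show ?thesis by (simp add: H_def split_beta')
qed

text \<open>The implicit solution \<sigma> depends jointly on step size, proximal argument and u.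
  The scaled residual (w - \<phi> (\<sigma> p)) / a tends to minus the gradient of f at the base
  point, so identification turns criticality into a subgradient and \<phi> (\<sigma> p) into the
  proximal point. Composition with \<open>m\<close>, the explicit gradient step, gives the full
  map.\<close>

lemma C1_near_prox_grad_step:
  assumes a: "a > 0" and \<Gamma>C: "C1_near b \<Gamma> (sb, us)" and \<Psi>C: "C1_near b (deriv_op \<Psi>) sb"
    and fC: "C1_near b (grad_x f) (xs, us)"
  shows "C1_near b (\<lambda>(a, x, u). prox_grad_step f g a x u) (a, xs, us)"
proof -
  let ?p = "(a, wb a, us)"
  obtain \<sigma> where \<sigma>: "C1_near b \<sigma> ?p" "\<sigma> ?p = sb" "\<forall>\<^sub>F p in nhds ?p. H (\<sigma> p, p) = 0"
    by (rule implicit_function[OF C1_near_H[OF \<Gamma>C \<Psi>C] H_base H_injective[OF a]])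
  have \<phi>\<sigma>: "C1_near b (\<lambda>p. \<phi> (\<sigma> p)) ?p"
    by (rule C1_near_compose[OF \<sigma>(1)]) (simp add: \<sigma>(2) C1_near_\<phi>)
  have l: "(\<sigma> \<longlongrightarrow> sb) (nhds ?p)" "((\<lambda>p. \<phi> (\<sigma> p)) \<longlongrightarrow> xs) (nhds ?p)"
    using C1_near_tendsto[OF \<sigma>(1)] C1_near_tendsto[OF \<phi>\<sigma>] \<sigma>(2) sb by simp_all
  have la: "(fst \<longlongrightarrow> a) (nhds ?p)" and lw: "((\<lambda>p. fst (snd p)) \<longlongrightarrow> wb a) (nhds ?p)"
    and lu: "((\<lambda>p. snd (snd p)) \<longlongrightarrow> us) (nhds ?p)"
    using tendsto_fst[OF filterlim_ident, of ?p] tendsto_fst[OF tendsto_snd[OF filterlim_ident, of ?p]]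
      tendsto_snd[OF tendsto_snd[OF filterlim_ident, of ?p]] by simp_all
  have "((\<lambda>p. (\<sigma> p, snd (snd p), (fst (snd p) - \<phi> (\<sigma> p)) /\<^sub>R fst p)) \<longlongrightarrow> (sb, us, (wb a - xs) /\<^sub>R a)) (nhds ?p)"
    by (intro tendsto_intros l la lw lu) (use a in simp)
  also have "(wb a - xs) /\<^sub>R a = - grad_x f (xs, us)" using a by simp
  finally have "\<forall>\<^sub>F p in nhds ?p. critical (\<sigma> p) (snd (snd p)) ((fst (snd p) - \<phi> (\<sigma> p)) /\<^sub>R fst p)
      \<longrightarrow> (fst (snd p) - \<phi> (\<sigma> p)) /\<^sub>R fst p \<in> Q (\<phi> (\<sigma> p)) (snd (snd p))"
    using critical_identification unfolding filterlim_iff by (force elim: eventually_mono)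
  moreover have "\<forall>\<^sub>F p in nhds ?p. fst p > 0"
    using la a by (rule order_tendstoD)
  ultimately have px: "\<forall>\<^sub>F p in nhds ?p.
      prox (\<lambda>y. ereal (fst p) * g (y, snd (snd p))) (fst (snd p)) = \<phi> (\<sigma> p)"
    using \<sigma>(3)
  proof eventually_elim
    case (elim p)
    obtain a' w u where p: "p = (a', w, u)" by (metis prod.collapse)
    have "critical (\<sigma> p) u ((w - \<phi> (\<sigma> p)) /\<^sub>R a')"
      using H_zeroD[of "\<sigma> p" a' w u] elim by (simp add: p)
    then have "(w - \<phi> (\<sigma> p)) /\<^sub>R a' \<in> Q (\<phi> (\<sigma> p)) u" using elim(1) by (simp add: p)
    from prox_eqI(1)[OF _ this] elim(2) show ?case by (simp add: p)
  qed
  define m where "m = (\<lambda>z::real \<times> 'x \<times> 'u. (fst z, fst (snd z) - fst z *\<^sub>R grad_x f (snd z), snd (snd z)))"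
  have mC: "C1_near b m (a, xs, us)"
    unfolding m_def
  proof (intro C1_near_Pair C1_near_diff C1_near_bilinear[OF bounded_bilinear_scaleR] C1_near_linear[OF bounded_linear_fst])
    show "C1_near b (\<lambda>z::real \<times> 'x \<times> 'u. fst (snd z)) (a, xs, us)"
      "C1_near b (\<lambda>z::real \<times> 'x \<times> 'u. snd (snd z)) (a, xs, us)"
      by (intro C1_near_linear bounded_linear_intros)+
    show "C1_near b (\<lambda>z::real \<times> 'x \<times> 'u. grad_x f (snd z)) (a, xs, us)"
      by (rule C1_near_compose[OF C1_near_linear[OF bounded_linear_snd]]) (simp add: fC)
  qed
  have m0: "m (a, xs, us) = ?p" by (simp add: m_def)
  have C: "C1_near b (\<lambda>z. \<phi> (\<sigma> (m z))) (a, xs, us)"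
    by (rule C1_near_compose[OF mC]) (simp add: m0 \<phi>\<sigma>)
  have "(m \<longlongrightarrow> ?p) (nhds (a, xs, us))" using C1_near_tendsto[OF mC] by (simp add: m0)
  with px have "\<forall>\<^sub>F z in nhds (a, xs, us).
      prox (\<lambda>y. ereal (fst (m z)) * g (y, snd (snd (m z)))) (fst (snd (m z))) = \<phi> (\<sigma> (m z))"
    unfolding filterlim_iff by blast
  then have "\<forall>\<^sub>F z in nhds (a, xs, us). \<phi> (\<sigma> (m z)) = (\<lambda>(a, x, u). prox_grad_step f g a x u) z"
    by eventually_elim (simp add: m_def prox_grad_step_def split_beta)
  then show ?thesis by (rule C1_near_cong[OF C])
qed

text \<open>Stationarity of \<psi> u for F(., u) on M says that minus the gradient of f is critical
  there. For u near \<open>us\<close>, identification makes it a subgradient of g(., u), and this is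
  the fixed-point equation of the step for the given a.\<close>

lemma prox_grad_step_fixed_point:
  assumes \<psi>: "(\<psi> \<longlongrightarrow> xs) (nhds us)"
    and min: "\<forall>\<^sub>F u in nhds us. \<psi> u \<in> M \<and> (\<forall>y\<in>M. ereal (f (\<psi> u, u)) + g (\<psi> u, u) \<le> ereal (f (y, u)) + g (y, u))"
    and a: "a > 0"
  shows "\<forall>\<^sub>F u in nhds us. prox_grad_step f g a (\<psi> u) u = \<psi> u"
proof -
  have "isCont \<Phi> xs" using has_derivative_continuous[OF \<Phi>_deriv[OF W(2)]] .
  then have "(\<Phi> \<longlongrightarrow> sb) (nhds xs)"
    by (simp add: sb_def isCont_def tendsto_at_iff_tendsto_nhds)
  then have l1: "((\<lambda>u. \<Phi> (\<psi> u)) \<longlongrightarrow> sb) (nhds us)" by (rule filterlim_compose[OF _ \<psi>])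
  have "((\<lambda>u. (\<psi> u, u)) \<longlongrightarrow> (xs, us)) (nhds us)"
    by (intro tendsto_Pair \<psi> filterlim_ident)
  from filterlim_compose[OF C1_near_tendsto[OF C1_near_grad_f] this]
  have l2: "((\<lambda>u. grad_x f (\<psi> u, u)) \<longlongrightarrow> grad_x f (xs, us)) (nhds us)" .
  have "((\<lambda>u. (\<Phi> (\<psi> u), u, - grad_x f (\<psi> u, u))) \<longlongrightarrow> (sb, us, - grad_x f (xs, us))) (nhds us)"
    by (intro tendsto_intros l1 l2 filterlim_ident)
  then have "\<forall>\<^sub>F u in nhds us. dom (\<Phi> (\<psi> u)) u \<and> (critical (\<Phi> (\<psi> u)) u (- grad_x f (\<psi> u, u)) \<longrightarrow>
      - grad_x f (\<psi> u, u) \<in> Q (\<phi> (\<Phi> (\<psi> u))) u)"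
    using critical_identification unfolding filterlim_iff by (force elim: eventually_mono)
  moreover have "\<forall>\<^sub>F u in nhds us. \<psi> u \<in> W" using \<psi> W by (rule topological_tendstoD)
  ultimately show ?thesis using min
  proof eventually_elim
    case (elim u)
    define s where "s = \<Phi> (\<psi> u)"
    have \<psi>M: "\<psi> u \<in> M" and \<psi>min: "\<And>y. y \<in> M \<Longrightarrow> ereal (f (\<psi> u, u)) + g (\<psi> u, u) \<le> ereal (f (y, u)) + g (y, u)"
      using elim(3) by auto
    have \<phi>s: "\<phi> s = \<psi> u" unfolding s_def by (rule \<Phi>_mem(4)[OF \<psi>M elim(2)])
    have dom: "dom s u" using elim(1) unfolding s_def by simp
    then have sV: "blinfun_apply pr s \<in> V" unfolding dom_def by simp
    have "critical s u (- grad_x f (\<psi> u, u))"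
      unfolding critical_def
    proof
      fix c
      let ?k = "\<lambda>t. f (\<phi> (s + t *\<^sub>R c), u) + G (s + t *\<^sub>R c, u)"
      have dG: "((\<lambda>t. G (s + t *\<^sub>R c, u)) has_vector_derivative \<Gamma> (s, u) \<bullet> c) (at 0)"
        using curve_has_derivative[where \<phi> = "\<lambda>s. G (s, u)", OF _ line_has_derivative] G_deriv[OF dom] by fastforce
      have dp: "((\<lambda>t. \<phi> (s + t *\<^sub>R c)) has_vector_derivative blinfun_apply (d\<phi> s) c) (at 0)"
        using curve_has_derivative[where \<phi> = \<phi>, OF _ line_has_derivative] \<phi>_deriv[OF sV] by fastforce
      have df: "((\<lambda>t. f (\<phi> (s + t *\<^sub>R c), u)) has_vector_derivative blinfun_apply (d\<phi> s) c \<bullet> grad_x f (\<psi> u, u)) (at 0)"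
        by (rule curve_has_derivative[where \<phi> = "\<lambda>y. f (y, u)" and \<gamma> = "\<lambda>t. \<phi> (s + t *\<^sub>R c)", OF _ dp])
           (use grad_f[of u "\<psi> u"] in \<open>simp add: gderiv_def \<phi>s\<close>)
      have "(?k has_real_derivative blinfun_apply (d\<phi> s) c \<bullet> grad_x f (\<psi> u, u) + \<Gamma> (s, u) \<bullet> c) (at 0)"
        using has_vector_derivative_add[OF df dG]
        by (simp add: has_real_derivative_iff_has_vector_derivative)
      moreover have "\<forall>\<^sub>F t in nhds 0. ?k 0 \<le> ?k t"
        using dom_line[OF dom, of c]
      proof eventually_elim
        case (elim t)
        then have "\<phi> (s + t *\<^sub>R c) \<in> M" unfolding dom_def by (intro \<phi>_mem) auto
        from \<psi>min[OF this] show ?case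
          unfolding \<phi>s[symmetric] g_eq_G[OF dom] g_eq_G[OF elim] by simp
      qed
      ultimately have "blinfun_apply (d\<phi> s) c \<bullet> grad_x f (\<psi> u, u) + \<Gamma> (s, u) \<bullet> c = 0"
        by (rule local_min_derivative_zero)
      then show "- grad_x f (\<psi> u, u) \<bullet> blinfun_apply (d\<phi> s) c = \<Gamma> (s, u) \<bullet> c"
        by (simp add: inner_commute)
    qed
    then have "- grad_x f (\<psi> u, u) \<in> Q (\<psi> u) u" using elim(1) \<phi>s unfolding s_def by simp
    moreover have "(\<psi> u - a *\<^sub>R grad_x f (\<psi> u, u) - \<psi> u) /\<^sub>R a = - grad_x f (\<psi> u, u)"
      using a by simp
    ultimately show ?case
      unfolding prox_grad_step_def by (intro prox_eqI(1)[OF a]) simp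
  qed
qed

end

section \<open>Lipschitz second derivatives from Riemannian data\<close>

lemma loc_reg_vector:
  fixes h :: "'c::metric_space \<Rightarrow> 'a::euclidean_space"
  assumes "\<And>e. e \<in> Basis \<Longrightarrow> loc_reg b (\<lambda>x. h x \<bullet> e) a"
  shows "loc_reg b h a"
proof -
  have "loc_reg b (\<lambda>x. \<Sum>e\<in>Basis. (h x \<bullet> e) *\<^sub>R e) a"
    by (intro loc_reg_sum loc_reg_compose[OF assms loc_reg_linear[OF bounded_linear_scaleR_left]])
  then show ?thesis by (simp add: euclidean_representation)
qed

text \<open>The Riemannian data are Lipschitz only relative to M x \<Omega>; composed with a
  Lipschitz map into that set they become Lipschitz on an open set.\<close>

lemma loc_reg_lipschitz_near:
  assumes h: "lipschitz_near N h a" and k: "loc_reg True k z" "k z = a" and N: "\<forall>\<^sub>F x in nhds z. k x \<in> N"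
  shows "loc_reg True (\<lambda>x. h (k x)) z"
proof -
  obtain e C where e: "e > 0" "C-lipschitz_on (N \<inter> ball a e) h"
    using h unfolding lipschitz_near_def by auto
  obtain S D where S: "open S" "z \<in> S" "D-lipschitz_on S k"
    using k(1) unfolding loc_reg_def by auto
  have "(k \<longlongrightarrow> k z) (nhds z)"
    using loc_reg_isCont[OF k(1)] unfolding isCont_def tendsto_at_iff_tendsto_nhds .
  then have "\<forall>\<^sub>F x in nhds z. k x \<in> ball a e"
    by (rule topological_tendstoD) (use e k(2) in auto)
  with N eventually_nhds_in_open[OF S(1,2)]
  have "\<forall>\<^sub>F x in nhds z. x \<in> S \<and> k x \<in> N \<inter> ball a e" by eventually_elim auto
  then obtain T where T: "open T" "z \<in> T" "\<And>x. x \<in> T \<Longrightarrow> x \<in> S \<and> k x \<in> N \<inter> ball a e"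
    unfolding eventually_nhds by blast
  have "D-lipschitz_on T k" using S(3) by (rule lipschitz_on_subset) (use T in auto)
  moreover have "C-lipschitz_on (k ` T) h" using e(2) by (rule lipschitz_on_subset) (use T in auto)
  ultimately have "(C * D)-lipschitz_on T (\<lambda>x. h (k x))" by (rule lipschitz_on_compose2)
  then show ?thesis by (rule loc_regI_lipschitz[OF T(1,2)])
qed

lemma Pair_zero_Basis_cases:
  assumes "i \<in> (Basis :: ('a::euclidean_space \<times> 'b::euclidean_space) set)"
  obtains v where "i = (v, 0)" | w where "i = (0, w)"
  using assms unfolding Basis_prod_def by auto

lemma eventually_nhds_fst_slice:
  assumes "\<forall>\<^sub>F z in nhds (x, u). P z"
  shows "\<forall>\<^sub>F y in nhds x. P (y, u)"
proof -
  have "((\<lambda>y. (y, u)) \<longlongrightarrow> (x, u)) (nhds x)" by (intro tendsto_Pair filterlim_ident tendsto_const)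
  with assms show ?thesis unfolding filterlim_iff by blast
qed

lemma eventually_nhds_snd_slice:
  assumes "\<forall>\<^sub>F z in nhds (x, u). P z"
  shows "\<forall>\<^sub>F v in nhds u. P (x, v)"
proof -
  have "((\<lambda>v. (x, v)) \<longlongrightarrow> (x, u)) (nhds u)" by (intro tendsto_Pair filterlim_ident tendsto_const)
  with assms show ?thesis unfolding filterlim_iff by blast
qed

lemma has_derivative_transform_nhds:
  assumes "(h has_derivative D) (at x)" "\<forall>\<^sub>F y in nhds x. h y = k y"
  shows "(k has_derivative D) (at x)"
proof -
  have "\<forall>\<^sub>F y in at x. h y = k y"
    using assms(2) by (auto simp: eventually_at_filter elim: eventually_mono)
  with assms(1) show ?thesis
    by (rule has_derivative_transform_eventually) (use eventually_nhds_x_imp_x[OF assms(2)] in auto)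
qed

lemma has_derivative_fst_slice:
  assumes "(h has_derivative D) (at (x, u))"
  shows "((\<lambda>y. h (y, u)) has_derivative (\<lambda>v. D (v, 0))) (at x)"
proof -
  have "((\<lambda>y. (y, u)) has_derivative (\<lambda>v. (v, 0))) (at x)" by (auto intro!: derivative_eq_intros)
  from has_derivative_compose[OF this assms] show ?thesis .
qed

lemma has_derivative_snd_slice:
  assumes "(h has_derivative D) (at (x, u))"
  shows "((\<lambda>v. h (x, v)) has_derivative (\<lambda>v. D (0, v))) (at u)"
proof -
  have "((\<lambda>v. (x, v)) has_derivative (\<lambda>v. (0, v))) (at u)" by (auto intro!: derivative_eq_intros)
  from has_derivative_compose[OF this assms] show ?thesis .
qed

context partly_smooth_composite
begin

text \<open>The gradient map is already C^1, so the columns of its derivative are those of the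
  Hessian in x and of the mixed derivative.\<close>

lemma C1_near_grad_f_lipschitz:
  assumes "lipschitz_near UNIV (hess_x f) (xs, us)" "lipschitz_near UNIV (Du_grad_x f) (xs, us)"
  shows "C1_near True (grad_x f) (xs, us)"
proof -
  have d: "(grad_x f has_derivative blinfun_apply (deriv_op (grad_x f) z)) (at z)" for z
    using C1_near_differentiable[OF C1_near_grad_f] by (rule has_derivative_deriv_op)
  have hess: "blinfun_apply (deriv_op (grad_x f) z) (v, 0) = blinfun_apply (hess_x f z) v" for z v
    using deriv_op_apply[OF has_derivative_fst_slice[OF d[of "(fst z, snd z)"]]]
    by (simp add: hess_x_def split_beta)
  have du: "blinfun_apply (deriv_op (grad_x f) z) (0, v) = blinfun_apply (Du_grad_x f z) v" for z v
    using deriv_op_apply[OF has_derivative_snd_slice[OF d[of "(fst z, snd z)"]]]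
    by (simp add: Du_grad_x_def split_beta)
  have reg: "loc_reg True (hess_x f) (xs, us)" "loc_reg True (Du_grad_x f) (xs, us)"
    using loc_reg_lipschitz_near[OF assms(1) loc_reg_linear[OF bounded_linear_ident]]
      loc_reg_lipschitz_near[OF assms(2) loc_reg_linear[OF bounded_linear_ident]] by auto
  have "loc_reg True (deriv_op (grad_x f)) (xs, us)"
  proof (rule loc_reg_blinfun)
    fix i :: "'x \<times> 'u" assume "i \<in> Basis"
    then show "loc_reg True (\<lambda>z. blinfun_apply (deriv_op (grad_x f) z) i) (xs, us)"
    proof (cases rule: Pair_zero_Basis_cases)
      case (1 v)
      then show ?thesis
        using loc_reg_compose[OF reg(1) loc_reg_linear[OF blinfun.bounded_linear_left]] by (simp add: hess)
    next
      case (2 w)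
      then show ?thesis
        using loc_reg_compose[OF reg(2) loc_reg_linear[OF blinfun.bounded_linear_left]] by (simp add: du)
    qed
  qed
  then show ?thesis unfolding C1_near_def using d by (intro exI[of _ "deriv_op (grad_x f)"]) simp
qed

end

text \<open>Uniqueness: by \<open>sub\<close> the difference of two candidates is tangent, so some
  curve has it as velocity, and comparing derivatives along that curve makes it orthogonal to
  itself.\<close>

lemma riem_grad_eqI:
  assumes \<xi>: "\<xi> \<in> tangent_space M x" and sub: "subspace (tangent_space M x)"
    and d: "\<And>\<gamma> v. curve_at M x v \<gamma> \<Longrightarrow> ((\<lambda>t. h (\<gamma> t)) has_real_derivative (\<xi> \<bullet> v)) (at 0)"
  shows "riem_grad M h x = \<xi>"
  unfolding riem_grad_def
proof (rule the_equality)
  show "\<xi> \<in> tangent_space M x \<and> (\<forall>\<gamma> v. curve_at M x v \<gamma> \<longrightarrow> ((\<lambda>t. h (\<gamma> t)) has_real_derivative (\<xi> \<bullet> v)) (at 0))"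
    using \<xi> d by blast
  fix \<eta> assume \<eta>: "\<eta> \<in> tangent_space M x \<and> (\<forall>\<gamma> v. curve_at M x v \<gamma> \<longrightarrow> ((\<lambda>t. h (\<gamma> t)) has_real_derivative (\<eta> \<bullet> v)) (at 0))"
  then have "\<eta> - \<xi> \<in> tangent_space M x" using \<xi> sub by (auto intro: subspace_diff)
  then obtain \<gamma> where "curve_at M x (\<eta> - \<xi>) \<gamma>" unfolding tangent_space_def by auto
  then have "\<eta> \<bullet> (\<eta> - \<xi>) = \<xi> \<bullet> (\<eta> - \<xi>)" using \<eta> d DERIV_unique by blast
  then have "(\<eta> - \<xi>) \<bullet> (\<eta> - \<xi>) = 0" by (simp add: inner_diff_left)
  then show "\<eta> = \<xi>" by simp
qed

text \<open>Existence and uniqueness behind \<open>THE\<close>: the operator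
  \<open>pT o\<^sub>L (D o\<^sub>L pT)\<close> has the defining property, and that property fixes
  the tangential part of each derivative along a curve. Agreement with D modulo normals suffices, as
  the result is paired with tangent vectors.\<close>

lemma riem_hess_property:
  fixes x :: "'a::euclidean_space" and D :: "'a \<Rightarrow>\<^sub>L 'a"
  assumes sub: "subspace (tangent_space M x)"
    and d: "\<And>\<gamma> v. curve_at M x v \<gamma> \<Longrightarrow> ((\<lambda>t. riem_grad M h (\<gamma> t)) has_vector_derivative (blinfun_apply D v)) (at 0)"
    and c: "curve_at M x v \<gamma>"
  shows "blinfun_apply D v - blinfun_apply (riem_hess M h x) v \<in> normal_space M x"
proof -
  define hess where "hess = (\<lambda>H. (\<forall>w\<in>normal_space M x. blinfun_apply H w = 0) \<and>
     (\<forall>\<gamma> v. curve_at M x v \<gamma> \<longrightarrow>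
        (\<exists>d. ((\<lambda>t. riem_grad M h (\<gamma> t)) has_vector_derivative d) (at 0) \<and>
             blinfun_apply H v \<in> tangent_space M x \<and>
             d - blinfun_apply H v \<in> normal_space M x)))"
  obtain pT :: "'a \<Rightarrow>\<^sub>L 'a" where pT: "\<And>v. blinfun_apply pT v \<in> tangent_space M x"
    "\<And>v. v \<in> tangent_space M x \<Longrightarrow> blinfun_apply pT v = v"
    "\<And>v w. blinfun_apply pT v \<bullet> w = v \<bullet> blinfun_apply pT w"
    using orthogonal_projection_exists[OF sub] by blast
  have pN: "v - blinfun_apply pT v \<in> normal_space M x" for v
    unfolding normal_space_iff
  proof
    fix y assume "y \<in> tangent_space M x"
    then show "y \<bullet> (v - blinfun_apply pT v) = 0"
      using pT(2)[of y] pT(3)[of y v] by (simp add: inner_diff_right)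
  qed
  have pT0: "blinfun_apply pT w = 0" if "w \<in> normal_space M x" for w
  proof -
    have "blinfun_apply pT w \<bullet> w = 0" using that pT(1)[of w] unfolding normal_space_iff by blast
    then have "blinfun_apply pT w \<bullet> blinfun_apply pT w = 0"
      using pT(2)[OF pT(1)[of w]] pT(3)[of w "blinfun_apply pT w"] by (simp add: inner_commute[of w])
    then show ?thesis by simp
  qed
  define H0 where "H0 = pT o\<^sub>L (D o\<^sub>L pT)"
  have "hess H0"
    unfolding hess_def
  proof (intro conjI ballI allI impI)
    fix w assume "w \<in> normal_space M x"
    then show "blinfun_apply H0 w = 0" by (simp add: H0_def pT0)
  next
    fix \<gamma> v assume \<gamma>: "curve_at M x v \<gamma>"
    then have "v \<in> tangent_space M x" unfolding tangent_space_def by auto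
    then have "blinfun_apply H0 v = blinfun_apply pT (blinfun_apply D v)" by (simp add: H0_def pT)
    then show "\<exists>d. ((\<lambda>t. riem_grad M h (\<gamma> t)) has_vector_derivative d) (at 0) \<and>
             blinfun_apply H0 v \<in> tangent_space M x \<and> d - blinfun_apply H0 v \<in> normal_space M x"
      using d[OF \<gamma>] pT(1) pN by (intro exI[of _ "blinfun_apply D v"]) simp
  qed
  moreover have "H1 = H2" if H: "hess H1" "hess H2" for H1 H2
  proof (rule blinfun_eqI)
    fix w
    have N: "blinfun_apply H1 (w - blinfun_apply pT w) = 0" "blinfun_apply H2 (w - blinfun_apply pT w) = 0"
      using H pN unfolding hess_def by auto
    obtain \<gamma> where \<gamma>: "curve_at M x (blinfun_apply pT w) \<gamma>" using pT(1)[of w] unfolding tangent_space_def by auto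
    let ?p = "blinfun_apply pT w"
    obtain d1 where d1: "((\<lambda>t. riem_grad M h (\<gamma> t)) has_vector_derivative d1) (at 0)"
      "blinfun_apply H1 ?p \<in> tangent_space M x" "d1 - blinfun_apply H1 ?p \<in> normal_space M x"
      using H(1) \<gamma> unfolding hess_def by blast
    obtain d2 where d2: "((\<lambda>t. riem_grad M h (\<gamma> t)) has_vector_derivative d2) (at 0)"
      "blinfun_apply H2 ?p \<in> tangent_space M x" "d2 - blinfun_apply H2 ?p \<in> normal_space M x"
      using H(2) \<gamma> unfolding hess_def by blast
    have "d1 = d2" using vector_derivative_unique_at[OF d1(1) d2(1)] .
    let ?e = "blinfun_apply H1 ?p - blinfun_apply H2 ?p"
    have "?e \<in> tangent_space M x" using d1 d2 sub by (intro subspace_diff)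
    moreover have "(d2 - blinfun_apply H2 ?p) - (d1 - blinfun_apply H1 ?p) \<in> normal_space M x"
      by (rule subspace_diff[OF subspace_normal_space d2(3) d1(3)])
    then have "?e \<in> normal_space M x" using \<open>d1 = d2\<close> by simp
    ultimately have "?e \<bullet> ?e = 0" unfolding normal_space_iff by blast
    then have "blinfun_apply H1 ?p = blinfun_apply H2 ?p" by simp
    then show "blinfun_apply H1 w = blinfun_apply H2 w" using N by (simp add: blinfun.diff_right)
  qed
  ultimately have "\<exists>!H. hess H" by blast
  moreover have "riem_hess M h x = (THE H. hess H)" unfolding riem_hess_def hess_def ..
  ultimately have "hess (riem_hess M h x)" by (simp add: theI')
  then obtain e where "((\<lambda>t. riem_grad M h (\<gamma> t)) has_vector_derivative e) (at 0)"
    "e - blinfun_apply (riem_hess M h x) v \<in> normal_space M x"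
    using c unfolding hess_def by blast
  then show ?thesis using vector_derivative_unique_at[OF d[OF c]] by metis
qed

context chart
begin

lemma subspace_tangent_space:
  assumes "blinfun_apply pr s \<in> V"
  shows "subspace (tangent_space M (\<phi> s))"
  unfolding tangent_space_chart(1)[OF assms]
  by (intro linear_subspace_image bounded_linear.linear blinfun.bounded_linear_right subspace_UNIV)

lemma \<phi>_pr: "\<phi> (blinfun_apply pr s) = \<phi> s"
  by (simp add: \<phi>_def)

lemma \<Gamma>_pr': "\<Gamma> (blinfun_apply pr s, u) = \<Gamma> (s, u)"
  by (simp add: \<Gamma>_def \<phi>_pr d\<phi>_pr')

lemma dom_pr: "dom (blinfun_apply pr s) u = dom s u"
  by (simp add: dom_def \<phi>_pr)

(* The tangent vector d phi (s) a representing Gamma is determined by a linear equation for a. *)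
lemma representing_vector:
  obtains \<alpha> where "C1_near False \<alpha> (sb, us)"
    "\<forall>\<^sub>F z in nhds (sb, us). \<forall>c. blinfun_apply (d\<phi> (fst z)) (\<alpha> z) \<bullet> blinfun_apply (d\<phi> (fst z)) c = \<Gamma> z \<bullet> c"
proof -
  define E where "E = (\<lambda>(a, z). adj (d\<phi> (fst z)) (blinfun_apply (d\<phi> (fst z)) a) + (a - blinfun_apply pr a) - \<Gamma> z)"
  have E: "E (a, z) \<bullet> c = blinfun_apply (d\<phi> (fst z)) a \<bullet> blinfun_apply (d\<phi> (fst z)) c + (a - blinfun_apply pr a) \<bullet> c - \<Gamma> z \<bullet> c" for a z c
    unfolding E_def
    by (simp add: inner_add_left inner_diff_left inner_adj inner_commute[of "blinfun_apply (d\<phi> (fst z)) c"])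
  \<comment> \<open>The Gram operator of \<open>d\<phi> sb\<close> plus the projection onto the
    complement of S. It is positive definite: a vector killed by both terms lies in S, where
    \<open>d\<phi> sb\<close> is injective.\<close>
  define A where "A = (\<Sum>e\<in>Basis. column_op e (adj (d\<phi> sb) (blinfun_apply (d\<phi> sb) e))) + (id_blinfun - pr)"
  have A: "blinfun_apply A v \<bullet> c = blinfun_apply (d\<phi> sb) v \<bullet> blinfun_apply (d\<phi> sb) c + (v - blinfun_apply pr v) \<bullet> c" for v c
  proof -
    have "blinfun_apply (d\<phi> sb) v = blinfun_apply (d\<phi> sb) (\<Sum>e\<in>Basis. (v \<bullet> e) *\<^sub>R e)"
      by (simp add: euclidean_representation)
    also have "\<dots> = (\<Sum>e\<in>Basis. (v \<bullet> e) *\<^sub>R blinfun_apply (d\<phi> sb) e)"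
      by (simp add: blinfun.sum_right blinfun.scaleR_right)
    finally show ?thesis
      unfolding A_def
      by (simp add: blinfun.add_left blinfun.sum_left blinfun.diff_left inner_add_left inner_sum_left inner_adj
          inner_commute[of "blinfun_apply (d\<phi> sb) c"])
  qed
  have inj: "v = 0" if "blinfun_apply A v = 0" for v
  proof -
    have pp: "(v - blinfun_apply pr v) \<bullet> v = (v - blinfun_apply pr v) \<bullet> (v - blinfun_apply pr v)"
      using pr_adj[of v "blinfun_apply pr v"] pr_adj[of v v] by (simp add: inner_diff_left inner_diff_right inner_commute)
    have "(norm (blinfun_apply (d\<phi> sb) v))\<^sup>2 + (norm (v - blinfun_apply pr v))\<^sup>2 = 0"
      using A[of v v] that unfolding pp power2_norm_eq_inner by simp
    then have "blinfun_apply (d\<phi> sb) v = 0" "v = blinfun_apply pr v"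
      by (simp_all add: sum_power2_eq_zero_iff)
    then show ?thesis using d\<phi>_injective[of sb v] by (simp add: sb)
  qed
  have bij: "bij (blinfun_apply A)" by (rule blinfun_bijI[OF inj])
  define a0 where "a0 = blinfun_apply (op_inv A) (\<Gamma> (sb, us))"
  have a0: "blinfun_apply A a0 = \<Gamma> (sb, us)" unfolding a0_def using bij by simp
  have EA: "E (a, (sb, us)) = blinfun_apply A a - \<Gamma> (sb, us)" for a
  proof -
    have "(E (a, (sb, us)) - (blinfun_apply A a - \<Gamma> (sb, us))) \<bullet> c = 0" for c
      using E[of a "(sb, us)" c] A[of a c] by (simp add: inner_diff_left)
    then have "E (a, (sb, us)) - (blinfun_apply A a - \<Gamma> (sb, us)) = 0" using inner_eq_zero_iff by blast
    then show ?thesis by simp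
  qed
  have EC: "C1_near False E (a0, (sb, us))"
  proof -
    have a: "C1_near False (\<lambda>y::'x \<times> 'x \<times> 'u. fst y) (a0, sb, us)"
      and z: "C1_near False (\<lambda>y::'x \<times> 'x \<times> 'u. snd y) (a0, sb, us)"
      and s: "C1_near False (\<lambda>y::'x \<times> 'x \<times> 'u. fst (snd y)) (a0, sb, us)"
      by (intro C1_near_linear bounded_linear_intros)+
    have 1: "C1_near False (\<lambda>y::'x \<times> 'x \<times> 'u. d\<phi> (fst (snd y))) (a0, sb, us)"
      by (rule C1_near_compose[OF s]) (simp add: C1_near_d\<phi>_False)
    have 2: "C1_near False (\<lambda>y::'x \<times> 'x \<times> 'u. \<Gamma> (snd y)) (a0, sb, us)"
      by (rule C1_near_compose[OF z]) (simp add: C1_near_\<Gamma>)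
    have "C1_near False (\<lambda>y. adj (d\<phi> (fst (snd y))) (blinfun_apply (d\<phi> (fst (snd y))) (fst y))
        + (fst y - blinfun_apply pr (fst y)) - \<Gamma> (snd y)) (a0, sb, us)"
      by (intro C1_near_add C1_near_diff C1_near_adj C1_near_bilinear[OF bounded_bilinear_blinfun_apply] 1 2 a
          C1_near_lin_compose[OF blinfun.bounded_linear_right])
    then show ?thesis unfolding E_def by (simp add: split_beta')
  qed
  have Einj: "v = 0" if D: "(E has_derivative D) (at (a0, (sb, us)))" "D (v, 0) = 0" for D v
  proof -
    have "((\<lambda>a. E (a, (sb, us))) has_derivative (\<lambda>v. D (v, 0))) (at a0)"
      using has_derivative_fst_slice[OF D(1)] .
    moreover have "((\<lambda>a. E (a, (sb, us))) has_derivative blinfun_apply A) (at a0)"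
      unfolding EA
      using has_derivative_diff[OF bounded_linear_imp_has_derivative[OF blinfun.bounded_linear_right] has_derivative_const]
      by simp
    ultimately have "(\<lambda>v. D (v, 0)) = blinfun_apply A" by (rule has_derivative_unique)
    then have "blinfun_apply A v = 0" using D(2) by metis
    then show ?thesis by (rule inj)
  qed
  have "E (a0, (sb, us)) = 0" by (simp add: EA a0)
  then obtain \<alpha> where \<alpha>: "C1_near False \<alpha> (sb, us)" "\<forall>\<^sub>F z in nhds (sb, us). E (\<alpha> z, z) = 0"
    by (rule implicit_function[OF EC _ Einj])
  show thesis
  proof (rule that[OF \<alpha>(1)])
    show "\<forall>\<^sub>F z in nhds (sb, us). \<forall>c. blinfun_apply (d\<phi> (fst z)) (\<alpha> z) \<bullet> blinfun_apply (d\<phi> (fst z)) c = \<Gamma> z \<bullet> c"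
      using \<alpha>(2)
    proof eventually_elim
      case (elim z)
      let ?c = "\<alpha> z - blinfun_apply pr (\<alpha> z)"
      have pc: "blinfun_apply pr ?c = 0" by (simp add: blinfun.diff_right)
      have "\<Gamma> z \<bullet> ?c = 0" using \<Gamma>_pr[of "fst z" "snd z" ?c] pc by simp
      moreover have "blinfun_apply (d\<phi> (fst z)) ?c = 0" using d\<phi>_pr[of "fst z" ?c] pc by simp
      ultimately have "?c \<bullet> ?c = 0" using E[of "\<alpha> z" z ?c] elim by simp
      then have c0: "?c = 0" by simp
      show ?case using E[of "\<alpha> z" z] elim unfolding c0 by simp
    qed
  qed
qed

text \<open>Along a curve in M the values of \<open>g\<close> are those of G along the coordinate
  curve, so the derivative is the pairing of \<Gamma> with the coordinate velocity, which the
  hypothesis on \<open>a\<close> rewrites as a pairing of tangent vectors.\<close>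

lemma riem_grad_chart:
  assumes dom: "dom s u"
    and a: "\<And>c. blinfun_apply (d\<phi> s) a \<bullet> blinfun_apply (d\<phi> s) c = \<Gamma> (s, u) \<bullet> c"
  shows "riem_grad_x M g (\<phi> s, u) = blinfun_apply (d\<phi> s) a"
proof -
  have sV: "blinfun_apply pr s \<in> V" using dom unfolding dom_def by auto
  have "riem_grad M (\<lambda>y. real_of_ereal (g (y, u))) (\<phi> s) = blinfun_apply (d\<phi> s) a"
  proof (rule riem_grad_eqI)
    show "blinfun_apply (d\<phi> s) a \<in> tangent_space M (\<phi> s)" unfolding tangent_space_chart(1)[OF sV] by simp
    show "subspace (tangent_space M (\<phi> s))" by (rule subspace_tangent_space[OF sV])
    fix \<gamma> v assume \<gamma>: "curve_at M (\<phi> s) v \<gamma>"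
    define c where "c = blinfun_apply (deriv_op \<Phi> (\<phi> s)) v"
    have ev: "\<forall>\<^sub>F t in nhds 0. \<gamma> t = \<phi> (\<Phi> (\<gamma> t)) \<and> \<Phi> (\<gamma> t) \<in> S \<inter> V"
      and d: "((\<lambda>t. \<Phi> (\<gamma> t)) has_vector_derivative c) (at 0)" and v: "v = blinfun_apply (d\<phi> s) c"
      using tangent_space_chart(3)[OF sV \<gamma>] unfolding c_def by blast+
    have \<gamma>0: "\<Phi> (\<gamma> 0) = blinfun_apply pr s"
      using \<gamma> \<phi>_mem(3)[OF sV] unfolding curve_at_def by simp
    have "((\<lambda>s. G (s, u)) has_derivative (\<lambda>v. \<Gamma> (s, u) \<bullet> v)) (at (\<Phi> (\<gamma> 0)))"
      using G_deriv[of "blinfun_apply pr s" u] dom by (simp add: dom_pr \<gamma>0 \<Gamma>_pr')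
    from curve_has_derivative[where \<gamma> = "\<lambda>t. \<Phi> (\<gamma> t)", OF this d]
    have "((\<lambda>t. G (\<Phi> (\<gamma> t), u)) has_vector_derivative \<Gamma> (s, u) \<bullet> c) (at 0)" .
    moreover have "\<forall>\<^sub>F t in nhds 0. G (\<Phi> (\<gamma> t), u) = real_of_ereal (g (\<gamma> t, u))"
    proof -
      have "((\<lambda>t. (\<Phi> (\<gamma> t), u)) \<longlongrightarrow> (blinfun_apply pr s, u)) (nhds 0)"
        using tendsto_of_has_vector_derivative[OF d] \<gamma>0 by (intro tendsto_Pair) auto
      with dom_eventually[of "blinfun_apply pr s" u] dom
      have "\<forall>\<^sub>F t in nhds 0. dom (\<Phi> (\<gamma> t)) u"
        unfolding filterlim_iff dom_pr by force
      with ev show ?thesis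
      proof eventually_elim
        case (elim t)
        then show ?case using g_eq_G[OF elim(2)] by simp
      qed
    qed
    ultimately have "((\<lambda>t. real_of_ereal (g (\<gamma> t, u))) has_vector_derivative \<Gamma> (s, u) \<bullet> c) (at 0)"
      by (rule has_vector_derivative_transform_nhds)
    then show "((\<lambda>t. real_of_ereal (g (\<gamma> t, u))) has_real_derivative blinfun_apply (d\<phi> s) a \<bullet> v) (at 0)"
      unfolding v a by (simp add: has_real_derivative_iff_has_vector_derivative)
  qed
  then show ?thesis by (simp add: riem_grad_x_def)
qed

text \<open>Let R be the Riemannian gradient in coordinates. Differentiating \<Gamma> . e = R .
  d\<phi> e in s gives Hess(d\<phi> v) . d\<phi> e + R . d^2\<phi>(v, e), since the normal part of
  the derivative of R is orthogonal to d\<phi> e; in u it gives D_u R . d\<phi> e. Every ingredient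
  is Lipschitz: d^2\<phi> by \<open>\<Psi>C\<close>, d\<phi> because it is C^1, the Riemannian data
  by hypothesis.\<close>

lemma C1_near_\<Gamma>_lipschitz:
  assumes \<Psi>C: "C1_near True (deriv_op \<Psi>) sb"
    and Lg: "lipschitz_near (M \<times> \<Omega>) (riem_grad_x M g) (xs, us)"
    and Lh: "lipschitz_near (M \<times> \<Omega>) (riem_hess_x M g) (xs, us)"
    and Lu: "lipschitz_near (M \<times> \<Omega>) (Du_riem_grad_x M g) (xs, us)"
  shows "C1_near True \<Gamma> (sb, us)"
proof -
  obtain \<alpha> where \<alpha>: "C1_near False \<alpha> (sb, us)"
    "\<forall>\<^sub>F z in nhds (sb, us). \<forall>c. blinfun_apply (d\<phi> (fst z)) (\<alpha> z) \<bullet> blinfun_apply (d\<phi> (fst z)) c = \<Gamma> z \<bullet> c"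
    by (rule representing_vector)
  define R where "R = (\<lambda>z. blinfun_apply (d\<phi> (fst z)) (\<alpha> z))"
  have RC: "C1_near False R (sb, us)"
    unfolding R_def
    by (intro C1_near_bilinear[OF bounded_bilinear_blinfun_apply] \<alpha>(1) C1_near_fst) (simp add: C1_near_d\<phi>_False)
  have good: "\<forall>\<^sub>F z in nhds (sb, us). dom (fst z) (snd z) \<and> riem_grad_x M g (\<phi> (fst z), snd z) = R z \<and>
      (\<forall>c. \<Gamma> z \<bullet> c = R z \<bullet> blinfun_apply (d\<phi> (fst z)) c)"
    using \<alpha>(2) dom_eventually[OF dom_base]
  proof eventually_elim
    case (elim z)
    then show ?case using riem_grad_chart[of "fst z" "snd z" "\<alpha> z"] by (simp add: R_def)
  qed
  obtain d\<phi>' where d\<phi>': "\<forall>\<^sub>F s in nhds sb. (d\<phi> has_derivative blinfun_apply (d\<phi>' s)) (at s)"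
    and rd\<phi>': "loc_reg True d\<phi>' sb"
    using C1_near_d\<phi>[OF \<Psi>C] by (rule C1_nearE)
  have fst_tendsto: "(fst \<longlongrightarrow> sb) (nhds (sb, us))" and snd_tendsto: "(snd \<longlongrightarrow> us) (nhds (sb, us))"
    using tendsto_fst[OF filterlim_ident, of "(sb, us)"] tendsto_snd[OF filterlim_ident, of "(sb, us)"] by simp_all
  have d\<phi>'z: "\<forall>\<^sub>F z in nhds (sb, us). (d\<phi> has_derivative blinfun_apply (d\<phi>' (fst z))) (at (fst z))"
    using d\<phi>' fst_tendsto unfolding filterlim_iff by blast
  note \<Gamma>d = C1_near_deriv_op(1)[OF C1_near_\<Gamma>]
  note Rd = C1_near_deriv_op(1)[OF RC]
  have prz: "((\<lambda>z. (blinfun_apply pr (fst z), snd z)) \<longlongrightarrow> (sb, us)) (nhds (sb, us))"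
  proof -
    have "((\<lambda>z. (blinfun_apply pr (fst z), snd z)) \<longlongrightarrow> (blinfun_apply pr sb, us)) (nhds (sb, us))"
      by (intro tendsto_intros fst_tendsto snd_tendsto)
    then show ?thesis by (simp add: sb)
  qed
  have good2: "\<forall>\<^sub>F z in nhds (sb, us). \<forall>\<^sub>F z' in nhds z. dom (fst z') (snd z') \<and>
      riem_grad_x M g (\<phi> (fst z'), snd z') = R z' \<and>
      (\<forall>c. \<Gamma> z' \<bullet> c = R z' \<bullet> blinfun_apply (d\<phi> (fst z')) c)"
    using good by (simp add: eventually_eventually)
  have "\<forall>\<^sub>F z in nhds (sb, us). (\<forall>\<^sub>F z' in nhds z. dom (fst z') (snd z') \<and>
      riem_grad_x M g (\<phi> (fst z'), snd z') = R z' \<and>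
      (\<forall>c. \<Gamma> z' \<bullet> c = R z' \<bullet> blinfun_apply (d\<phi> (fst z')) c)) \<and>
      (R has_derivative blinfun_apply (deriv_op R z)) (at z)"
    using good2 Rd by eventually_elim simp
  \<comment> \<open>Coordinate curves \<Phi> (\<gamma> t) run in S and pass through the projection
    of s, so R is differentiated at the projected point; the good neighbourhood is transported
    there.\<close>
  with prz have good3: "\<forall>\<^sub>F z in nhds (sb, us). (\<forall>\<^sub>F z' in nhds (blinfun_apply pr (fst z), snd z).
      dom (fst z') (snd z') \<and> riem_grad_x M g (\<phi> (fst z'), snd z') = R z' \<and>
      (\<forall>c. \<Gamma> z' \<bullet> c = R z' \<bullet> blinfun_apply (d\<phi> (fst z')) c)) \<and>
      (R has_derivative blinfun_apply (deriv_op R (blinfun_apply pr (fst z), snd z))) (at (blinfun_apply pr (fst z), snd z))"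
    unfolding filterlim_iff by blast
  have formula_u: "\<forall>\<^sub>F z in nhds (sb, us). \<forall>w e. blinfun_apply (deriv_op \<Gamma> z) (0, w) \<bullet> e
      = blinfun_apply (Du_riem_grad_x M g (\<phi> (fst z), snd z)) w \<bullet> blinfun_apply (d\<phi> (fst z)) e"
    using good2 Rd \<Gamma>d
  proof eventually_elim
    case (elim z)
    obtain s u where z: "z = (s, u)" by (cases z)
    note e1 = eventually_nhds_snd_slice[OF elim(1)[unfolded z]]
    have R: "((\<lambda>u'. R (s, u')) has_derivative (\<lambda>w. blinfun_apply (deriv_op R z) (0, w))) (at u)"
      using has_derivative_snd_slice[OF elim(2)[unfolded z]] by (simp add: z)
    moreover have "\<forall>\<^sub>F u' in nhds u. R (s, u') = riem_grad_x M g (\<phi> s, u')" using e1 by eventually_elim simp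
    ultimately have "((\<lambda>u'. riem_grad_x M g (\<phi> s, u')) has_derivative (\<lambda>w. blinfun_apply (deriv_op R z) (0, w))) (at u)"
      by (rule has_derivative_transform_nhds)
    from deriv_op_apply[OF this]
    have Du: "blinfun_apply (Du_riem_grad_x M g (\<phi> s, u)) w = blinfun_apply (deriv_op R z) (0, w)" for w
      by (simp add: Du_riem_grad_x_def)
    have "blinfun_apply (deriv_op \<Gamma> z) (0, w) \<bullet> e = blinfun_apply (deriv_op R z) (0, w) \<bullet> blinfun_apply (d\<phi> s) e" for w e
    proof -
      have "((\<lambda>u'. R (s, u') \<bullet> blinfun_apply (d\<phi> s) e) has_derivative
          (\<lambda>w. blinfun_apply (deriv_op R z) (0, w) \<bullet> blinfun_apply (d\<phi> s) e)) (at u)"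
        by (rule bounded_linear.has_derivative[OF bounded_linear_inner_left R])
      moreover have "\<forall>\<^sub>F u' in nhds u. R (s, u') \<bullet> blinfun_apply (d\<phi> s) e = \<Gamma> (s, u') \<bullet> e"
        using e1 by eventually_elim simp
      ultimately have "((\<lambda>u'. \<Gamma> (s, u') \<bullet> e) has_derivative
          (\<lambda>w. blinfun_apply (deriv_op R z) (0, w) \<bullet> blinfun_apply (d\<phi> s) e)) (at u)"
        by (rule has_derivative_transform_nhds)
      moreover have "((\<lambda>u'. \<Gamma> (s, u') \<bullet> e) has_derivative (\<lambda>w. blinfun_apply (deriv_op \<Gamma> z) (0, w) \<bullet> e)) (at u)"
        using bounded_linear.has_derivative[OF bounded_linear_inner_left has_derivative_snd_slice[OF elim(3)[unfolded z]]]
        by (simp add: z)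
      ultimately show ?thesis using has_derivative_unique by metis
    qed
    then show ?case by (simp add: z Du)
  qed
  have formula_s: "\<forall>\<^sub>F z in nhds (sb, us). \<forall>v e. blinfun_apply (deriv_op \<Gamma> z) (v, 0) \<bullet> e
      = blinfun_apply (riem_hess_x M g (\<phi> (fst z), snd z)) (blinfun_apply (d\<phi> (fst z)) v) \<bullet> blinfun_apply (d\<phi> (fst z)) e
        + riem_grad_x M g (\<phi> (fst z), snd z) \<bullet> blinfun_apply (blinfun_apply (d\<phi>' (fst z)) v) e"
    using good2 good3 \<Gamma>d d\<phi>'z
  proof eventually_elim
    case (elim z)
    obtain s u where z: "z = (s, u)" by (cases z)
    let ?s = "blinfun_apply pr s"
    note g1 = eventually_nhds_x_imp_x[OF elim(1), unfolded z fst_conv snd_conv]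
    then have sV: "?s \<in> V" unfolding dom_def by auto
    \<comment> \<open>Extends the derivative of the Riemannian gradient along M to an operator on
      the ambient space, the form that \<open>riem_hess_property\<close> asks for.\<close>
    define D where "D = deriv_op R (?s, u) o\<^sub>L pair_op (deriv_op \<Phi> (\<phi> s)) 0"
    have Dcurve: "((\<lambda>t. riem_grad M (\<lambda>y. real_of_ereal (g (y, u))) (\<gamma> t)) has_vector_derivative blinfun_apply D v) (at 0)"
      if \<gamma>: "curve_at M (\<phi> s) v \<gamma>" for \<gamma> v
    proof -
      have ev: "\<forall>\<^sub>F t in nhds 0. \<gamma> t = \<phi> (\<Phi> (\<gamma> t)) \<and> \<Phi> (\<gamma> t) \<in> S \<inter> V"
        and d: "((\<lambda>t. \<Phi> (\<gamma> t)) has_vector_derivative blinfun_apply (deriv_op \<Phi> (\<phi> s)) v) (at 0)"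
        using tangent_space_chart(3)[OF sV \<gamma>] by blast+
      have \<gamma>0: "\<Phi> (\<gamma> 0) = ?s" using \<gamma> \<phi>_mem(3)[OF sV] unfolding curve_at_def by simp
      have "(R has_derivative blinfun_apply (deriv_op R (?s, u))) (at (?s, u))" using elim(2) by (simp add: z)
      from has_derivative_fst_slice[OF this]
      have "((\<lambda>s'. R (s', u)) has_derivative (\<lambda>c. blinfun_apply (deriv_op R (?s, u)) (c, 0))) (at (\<Phi> (\<gamma> 0)))"
        by (simp add: \<gamma>0)
      from curve_has_derivative[where \<gamma> = "\<lambda>t. \<Phi> (\<gamma> t)", OF this d]
      have "((\<lambda>t. R (\<Phi> (\<gamma> t), u)) has_vector_derivative blinfun_apply D v) (at 0)" by (simp add: D_def)
      moreover have "\<forall>\<^sub>F t in nhds 0. R (\<Phi> (\<gamma> t), u) = riem_grad M (\<lambda>y. real_of_ereal (g (y, u))) (\<gamma> t)"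
      proof -
        have "((\<lambda>t. \<Phi> (\<gamma> t)) \<longlongrightarrow> ?s) (nhds 0)"
          using tendsto_of_has_vector_derivative[OF d] \<gamma>0 by simp
        moreover have "\<forall>\<^sub>F s' in nhds ?s. riem_grad_x M g (\<phi> s', u) = R (s', u)"
          using eventually_nhds_fst_slice[OF conjunct1[OF elim(2), unfolded z fst_conv snd_conv]]
          by eventually_elim simp
        ultimately have "\<forall>\<^sub>F t in nhds 0. riem_grad_x M g (\<phi> (\<Phi> (\<gamma> t)), u) = R (\<Phi> (\<gamma> t), u)"
          unfolding filterlim_iff by blast
        with ev show ?thesis by eventually_elim (simp add: riem_grad_x_def)
      qed
      ultimately show ?thesis by (rule has_vector_derivative_transform_nhds)
    qed
    have "blinfun_apply (deriv_op \<Gamma> z) (v, 0) \<bullet> e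
      = blinfun_apply (riem_hess_x M g (\<phi> s, u)) (blinfun_apply (d\<phi> s) v) \<bullet> blinfun_apply (d\<phi> s) e
        + riem_grad_x M g (\<phi> s, u) \<bullet> blinfun_apply (blinfun_apply (d\<phi>' s) v) e" for v e
    proof -
      let ?\<gamma> = "\<lambda>t. \<phi> (s + t *\<^sub>R v)"
      let ?d = "blinfun_apply D (blinfun_apply (d\<phi> s) v)"
      note c = tangent_space_chart(2)[OF sV, of v]
      have "?d - blinfun_apply (riem_hess_x M g (\<phi> s, u)) (blinfun_apply (d\<phi> s) v) \<in> normal_space M (\<phi> s)"
        unfolding riem_hess_x_def
        using riem_hess_property[OF subspace_tangent_space[OF sV] Dcurve c] by simp
      then have "blinfun_apply (d\<phi> s) e \<bullet> (?d - blinfun_apply (riem_hess_x M g (\<phi> s, u)) (blinfun_apply (d\<phi> s) v)) = 0"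
        unfolding normal_space_chart[OF sV] by blast
      then have n: "?d \<bullet> blinfun_apply (d\<phi> s) e
          = blinfun_apply (riem_hess_x M g (\<phi> s, u)) (blinfun_apply (d\<phi> s) v) \<bullet> blinfun_apply (d\<phi> s) e"
        by (simp add: inner_diff_right inner_commute[of "blinfun_apply (d\<phi> s) e"])
      have r: "((\<lambda>t. riem_grad_x M g (?\<gamma> t, u)) has_vector_derivative ?d) (at 0)"
        using Dcurve[OF c] by (simp add: riem_grad_x_def)
      have p: "((\<lambda>t. blinfun_apply (d\<phi> (s + t *\<^sub>R v)) e) has_vector_derivative blinfun_apply (blinfun_apply (d\<phi>' s) v) e) (at 0)"
        by (rule bounded_linear.has_vector_derivative[OF blinfun.bounded_linear_left
              curve_has_derivative[OF _ line_has_derivative]]) (use elim(4) in \<open>simp add: z\<close>)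
      have "((\<lambda>t. riem_grad_x M g (?\<gamma> t, u) \<bullet> blinfun_apply (d\<phi> (s + t *\<^sub>R v)) e) has_vector_derivative
          riem_grad_x M g (?\<gamma> 0, u) \<bullet> blinfun_apply (blinfun_apply (d\<phi>' s) v) e
           + ?d \<bullet> blinfun_apply (d\<phi> (s + 0 *\<^sub>R v)) e) (at 0)"
        by (rule bounded_bilinear.has_vector_derivative[OF bounded_bilinear_inner r p])
      moreover have "\<forall>\<^sub>F t in nhds 0. riem_grad_x M g (?\<gamma> t, u) \<bullet> blinfun_apply (d\<phi> (s + t *\<^sub>R v)) e = \<Gamma> (s + t *\<^sub>R v, u) \<bullet> e"
      proof -
        have "((\<lambda>t. s + t *\<^sub>R v) \<longlongrightarrow> s + 0 *\<^sub>R v) (nhds 0)" by (intro tendsto_intros filterlim_ident)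
        then have t: "filterlim (\<lambda>t. s + t *\<^sub>R v) (nhds s) (nhds 0)" by simp
        have "\<forall>\<^sub>F s' in nhds s. riem_grad_x M g (\<phi> s', u) \<bullet> blinfun_apply (d\<phi> s') e = \<Gamma> (s', u) \<bullet> e"
          using eventually_nhds_fst_slice[OF elim(1)[unfolded z]] by eventually_elim simp
        from eventually_compose_filterlim[OF this t] show ?thesis .
      qed
      ultimately have "((\<lambda>t. \<Gamma> (s + t *\<^sub>R v, u) \<bullet> e) has_vector_derivative
          riem_grad_x M g (?\<gamma> 0, u) \<bullet> blinfun_apply (blinfun_apply (d\<phi>' s) v) e
           + ?d \<bullet> blinfun_apply (d\<phi> (s + 0 *\<^sub>R v)) e) (at 0)"
        by (rule has_vector_derivative_transform_nhds)
      moreover have "((\<lambda>t. \<Gamma> (s + t *\<^sub>R v, u) \<bullet> e) has_vector_derivative blinfun_apply (deriv_op \<Gamma> z) (v, 0) \<bullet> e) (at 0)"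
        by (rule bounded_linear.has_vector_derivative[OF bounded_linear_inner_left
              curve_has_derivative[where \<phi> = "\<lambda>s. \<Gamma> (s, u)", OF _ line_has_derivative]])
           (use has_derivative_fst_slice[OF elim(3)[unfolded z]] in \<open>simp add: z\<close>)
      ultimately have "blinfun_apply (deriv_op \<Gamma> z) (v, 0) \<bullet> e
          = riem_grad_x M g (?\<gamma> 0, u) \<bullet> blinfun_apply (blinfun_apply (d\<phi>' s) v) e + ?d \<bullet> blinfun_apply (d\<phi> (s + 0 *\<^sub>R v)) e"
        using vector_derivative_unique_at by blast
      then show ?thesis using n by simp
    qed
    then show ?case by (simp add: z)
  qed
  have ch: "loc_reg True (\<lambda>z::'x \<times> 'u. (\<phi> (fst z), snd z)) (sb, us)"
    by (rule C1_near_reg[of False], intro C1_near_Pair C1_near_fst C1_near_linear[OF bounded_linear_snd])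
       (simp add: C1_near_\<phi>)
  have ch0: "(\<phi> (fst (sb, us)), snd (sb, us)) = (xs, us)" by (simp add: sb)
  have chM: "\<forall>\<^sub>F z in nhds (sb, us). (\<phi> (fst z), snd z) \<in> M \<times> \<Omega>"
    using dom_eventually[OF dom_base] by eventually_elim (use \<phi>_mem(1) in \<open>auto simp: dom_def\<close>)
  note rg = loc_reg_lipschitz_near[OF Lg ch ch0 chM]
    and rh = loc_reg_lipschitz_near[OF Lh ch ch0 chM]
    and ru = loc_reg_lipschitz_near[OF Lu ch ch0 chM]
  have rd: "loc_reg True (\<lambda>z::'x \<times> 'u. d\<phi> (fst z)) (sb, us)"
    by (rule C1_near_reg[of False], rule C1_near_fst) (simp add: C1_near_d\<phi>_False)
  have rd': "loc_reg True (\<lambda>z::'x \<times> 'u. d\<phi>' (fst z)) (sb, us)"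
    by (rule loc_reg_compose[OF loc_reg_linear[OF bounded_linear_fst]]) (simp add: rd\<phi>')
  have app: "loc_reg True (\<lambda>z. blinfun_apply (A z) (c z)) (sb, us)"
    if "loc_reg True A (sb, us)" "loc_reg True c (sb, us)" for A :: "'x \<times> 'u \<Rightarrow> ('p::real_normed_vector \<Rightarrow>\<^sub>L 'q::real_normed_vector)" and c
    using that by (rule loc_reg_bilinear[OF bounded_bilinear_blinfun_apply])
  note inn = loc_reg_bilinear[OF bounded_bilinear_inner]
  have "loc_reg True (deriv_op \<Gamma>) (sb, us)"
  proof (rule loc_reg_blinfun, rule loc_reg_vector)
    fix i :: "'x \<times> 'u" and e :: 'x assume "i \<in> Basis"
    then show "loc_reg True (\<lambda>z. blinfun_apply (deriv_op \<Gamma> z) i \<bullet> e) (sb, us)"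
    proof (cases rule: Pair_zero_Basis_cases)
      case (1 v)
      have "loc_reg True (\<lambda>z. blinfun_apply (riem_hess_x M g (\<phi> (fst z), snd z)) (blinfun_apply (d\<phi> (fst z)) v) \<bullet> blinfun_apply (d\<phi> (fst z)) e
        + riem_grad_x M g (\<phi> (fst z), snd z) \<bullet> blinfun_apply (blinfun_apply (d\<phi>' (fst z)) v) e) (sb, us)"
        by (intro loc_reg_add inn loc_reg_bilinear[OF bounded_bilinear_blinfun_apply] rh rg rd rd' loc_reg_const)
      then show ?thesis unfolding 1
        by (rule loc_reg_cong) (use formula_s in eventually_elim, simp)
    next
      case (2 w)
      have "loc_reg True (\<lambda>z. blinfun_apply (Du_riem_grad_x M g (\<phi> (fst z), snd z)) w \<bullet> blinfun_apply (d\<phi> (fst z)) e) (sb, us)"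
        by (intro inn loc_reg_bilinear[OF bounded_bilinear_blinfun_apply] ru rd loc_reg_const)
      then show ?thesis unfolding 2
        by (rule loc_reg_cong) (use formula_u in eventually_elim, simp)
    qed
  qed
  with \<Gamma>d show ?thesis unfolding C1_near_def by (intro exI[of _ "deriv_op \<Gamma>"]) simp
qed

end

section \<open>Convergence of the derivatives\<close>

context partly_smooth_composite
begin

text \<open>Charts of class C^3 are in particular C^2 charts; the extra derivative is kept for
  \<Psi>, from which \<phi> and \<open>d\<phi>\<close> are built.\<close>

lemma chart_exists:
  assumes M: "Ck_submanifold k M" and k: "k = 2 \<or> k = 3"
  shows "\<exists>S W V \<Phi> \<Psi> pr Wg gt. chart f g M \<Omega> xs us S W V \<Phi> \<Psi> pr Wg gt \<and> Ck_on k \<Psi> V"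
proof -
  have k2: "Ck_on 2 h T" if "Ck_on k h T" for h :: "'x \<Rightarrow> 'x" and T
  proof (cases "k = 2")
    case False
    then have "k = Suc 2" using k by simp
    then show ?thesis using that Ck_on_Suc_imp by blast
  qed (use that in simp)
  obtain S where S: "subspace S" and charts: "\<forall>x\<in>M. \<exists>W V (\<Phi>::'x \<Rightarrow> 'x) \<Psi>. open W \<and> x \<in> W \<and> open V \<and>
      homeomorphism W V \<Phi> \<Psi> \<and> Ck_on k \<Phi> W \<and> Ck_on k \<Psi> V \<and> \<Phi> ` (M \<inter> W) = S \<inter> V"
    using M unfolding Ck_submanifold_def by (elim exE conjE) (rule that)
  obtain W V \<Phi> \<Psi> where c: "open W" "xs \<in> W" "open V" "homeomorphism W V \<Phi> \<Psi>"
      "Ck_on k \<Phi> W" "Ck_on k \<Psi> V" "\<Phi> ` (M \<inter> W) = S \<inter> V"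
    using bspec[OF charts xs] by (elim exE conjE) (rule that)
  obtain pr :: "'x \<Rightarrow>\<^sub>L 'x" where pr: "\<And>v. blinfun_apply pr v \<in> S" "\<And>v. v \<in> S \<Longrightarrow> blinfun_apply pr v = v"
    "\<And>v w. blinfun_apply pr v \<bullet> w = v \<bullet> blinfun_apply pr w"
    using orthogonal_projection_exists[OF S] by blast
  obtain Wg gt where g: "open Wg" "(xs, us) \<in> Wg" "Ck_on 2 gt Wg"
    "\<And>y. y \<in> (M \<times> \<Omega>) \<inter> Wg \<Longrightarrow> g y = ereal (gt y)"
    using g_C2[OF xs us] unfolding C2_along_def by blast
  have "chart f g M \<Omega> xs us S W V \<Phi> \<Psi> pr Wg gt"
    by unfold_locales (use S c pr g k2 in auto)
  with c(6) show ?thesis by blast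
qed

lemma C1_near_step:
  assumes M: "Ck_submanifold 2 M" and a: "a > 0"
  shows "C1_near False (\<lambda>(a, x, u). prox_grad_step f g a x u) (a, xs, us)"
proof -
  obtain S W V \<Phi> \<Psi> pr Wg gt where ch: "chart f g M \<Omega> xs us S W V \<Phi> \<Psi> pr Wg gt"
    using chart_exists[OF M disjI1[OF refl]] by blast
  interpret chart f g M \<Omega> xs us S W V \<Phi> \<Psi> pr Wg gt by (rule ch)
  show ?thesis
    by (rule C1_near_prox_grad_step[OF a C1_near_\<Gamma> Ck_on_2_imp_C1_near_deriv_op(1)[OF \<Psi>2 V sb(2)] C1_near_grad_f])
qed

lemma C1_near_step_lipschitz:
  assumes M: "Ck_submanifold 3 M" and a: "a > 0"
    and "lipschitz_near (M \<times> \<Omega>) (riem_grad_x M g) (xs, us)" "lipschitz_near UNIV (hess_x f) (xs, us)"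
      "lipschitz_near (M \<times> \<Omega>) (riem_hess_x M g) (xs, us)" "lipschitz_near UNIV (Du_grad_x f) (xs, us)"
      "lipschitz_near (M \<times> \<Omega>) (Du_riem_grad_x M g) (xs, us)"
  shows "C1_near True (\<lambda>(a, x, u). prox_grad_step f g a x u) (a, xs, us)"
proof -
  obtain S W V \<Phi> \<Psi> pr Wg gt where ch: "chart f g M \<Omega> xs us S W V \<Phi> \<Psi> pr Wg gt" and \<Psi>3: "Ck_on 3 \<Psi> V"
    using chart_exists[OF M disjI2[OF refl]] by blast
  interpret chart f g M \<Omega> xs us S W V \<Phi> \<Psi> pr Wg gt by (rule ch)
  have \<Psi>C: "C1_near True (deriv_op \<Psi>) sb"
    by (rule Ck_on_3_imp_C1_near_deriv_op[OF \<Psi>3 V sb(2)])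
  show ?thesis
    by (rule C1_near_prox_grad_step[OF a C1_near_\<Gamma>_lipschitz[OF \<Psi>C] \<Psi>C C1_near_grad_f_lipschitz]) fact+
qed

lemma step_fixed_point:
  assumes M: "Ck_submanifold 2 M" and "a > 0" and "(\<psi> \<longlongrightarrow> xs) (nhds us)"
    and "\<forall>\<^sub>F u in nhds us. \<psi> u \<in> M \<and> (\<forall>y\<in>M. ereal (f (\<psi> u, u)) + g (\<psi> u, u) \<le> ereal (f (y, u)) + g (y, u))"
  shows "\<forall>\<^sub>F u in nhds us. prox_grad_step f g a (\<psi> u) u = \<psi> u"
proof -
  obtain S W V \<Phi> \<Psi> pr Wg gt where ch: "chart f g M \<Omega> xs us S W V \<Phi> \<Psi> pr Wg gt"
    using chart_exists[OF M disjI1[OF refl]] by blast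
  interpret chart f g M \<Omega> xs us S W V \<Phi> \<Psi> pr Wg gt by (rule ch)
  show ?thesis by (rule prox_grad_step_fixed_point) fact+
qed

end

text \<open>At a diagonal pair (x, x) the extrapolation returns x for every c, so regularity of the
  plain step at (a, x, u) suffices; the extrapolation itself is bilinear in c and the difference of
  the pair.\<close>

lemma C1_near_accel_step:
  assumes "C1_near b (\<lambda>(a, x, u). prox_grad_step f g a x u) (a, x, u)"
  shows "C1_near b (\<lambda>(t, z, u). accel_step f g (fst t) (snd t) z u) ((a, c), (x, x), u)"
proof -
  let ?y = "((a, c), (x, x), u)"
  have 1: "C1_near b (\<lambda>y. fst (fst y)) ?y" "C1_near b (\<lambda>y. snd (fst y)) ?y"
    "C1_near b (\<lambda>y. fst (fst (snd y))) ?y" "C1_near b (\<lambda>y. snd (fst (snd y))) ?y" "C1_near b (\<lambda>y. snd (snd y)) ?y"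
    by (intro C1_near_linear bounded_linear_intros)+
  have "C1_near b (\<lambda>y. (fst (fst y), fst (fst (snd y)) + snd (fst y) *\<^sub>R (fst (fst (snd y)) - snd (fst (snd y))), snd (snd y))) ?y"
    by (intro C1_near_Pair C1_near_add C1_near_bilinear[OF bounded_bilinear_scaleR] C1_near_diff 1)
  from C1_near_compose[OF this, of "\<lambda>(a, x, u). prox_grad_step f g a x u"] assms
  have "C1_near b (\<lambda>y. prox_grad_step f g (fst (fst y))
      (fst (fst (snd y)) + snd (fst y) *\<^sub>R (fst (fst (snd y)) - snd (fst (snd y)))) (snd (snd y))) ?y"
    by simp
  from C1_near_Pair[OF this 1(3)] show ?thesis
    by (simp add: accel_step_def split_beta')
qed

lemma blinfun_tendsto_pointwise:
  fixes X :: "nat \<Rightarrow> 'a::euclidean_space \<Rightarrow>\<^sub>L 'b::real_normed_vector"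
  assumes "\<And>h. (\<lambda>k. blinfun_apply (X k) h) \<longlonglongrightarrow> blinfun_apply L h"
  shows "X \<longlonglongrightarrow> L"
  by (rule tendsto_componentwise1) (rule assms)

text \<open>The operator norm is at most the sum of the norms on finitely many basis vectors, so
  bounds with a separate constant in each direction add up.\<close>

lemma blinfun_geometric_pointwise:
  fixes X :: "nat \<Rightarrow> 'a::euclidean_space \<Rightarrow>\<^sub>L 'b::real_normed_vector"
  assumes "\<And>h. \<exists>E. \<forall>\<^sub>F k in sequentially. norm (blinfun_apply (X k) h - blinfun_apply L h) \<le> E * p ^ k"
  shows "\<exists>E. \<forall>\<^sub>F k in sequentially. norm (X k - L) \<le> E * p ^ k"
proof -
  obtain E where E: "\<And>h. \<forall>\<^sub>F k in sequentially. norm (blinfun_apply (X k) h - blinfun_apply L h) \<le> E h * p ^ k"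
    using assms by metis
  have "\<forall>\<^sub>F k in sequentially. \<forall>h\<in>Basis. norm (blinfun_apply (X k) h - blinfun_apply L h) \<le> E h * p ^ k"
    by (intro eventually_ball_finite finite_Basis ballI E)
  then have "\<forall>\<^sub>F k in sequentially. norm (X k - L) \<le> (\<Sum>h\<in>Basis. E h) * p ^ k"
  proof eventually_elim
    case (elim k)
    have "norm (X k - L) \<le> (\<Sum>h\<in>Basis. norm (blinfun_apply (X k - L) h))" by (rule norm_blinfun_euclidean_le)
    also have "\<dots> \<le> (\<Sum>h\<in>Basis. E h * p ^ k)"
      by (intro sum_mono) (use elim in \<open>simp add: blinfun.diff_left\<close>)
    finally show ?case by (simp add: sum_distrib_right)
  qed
  then show ?thesis by blast
qed

theorem theorem21:
  fixes f :: "'x::euclidean_space \<times> 'u::euclidean_space \<Rightarrow> real"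
    and g F :: "'x \<times> 'u \<Rightarrow> ereal"
    and M :: "'x set" and \<Omega> U :: "'u set"
    and xs :: 'x and us :: 'u and \<psi> :: "'u \<Rightarrow> 'x"
    and L \<alpha>_lo \<alpha>_hi \<alpha>s \<beta>s :: real and \<alpha> \<beta> :: "nat \<Rightarrow> real"
  assumes M: "Ck_submanifold 2 M" and \<Omega>: "open \<Omega>"
    and f_C2: "Ck_on 2 f UNIV"
    and g_proper: "proper_fun g" and g_lsc: "lsc_fun g"
    and g_ps: "partly_smooth g (M \<times> \<Omega>)"
    and f_convex: "\<And>u. u \<in> \<Omega> \<Longrightarrow> convex_on UNIV (\<lambda>x. f (x, u))"
    and g_convex: "\<And>u. u \<in> \<Omega> \<Longrightarrow> convex_fun (\<lambda>x. g (x, u))"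
    and L_pos: "L > 0"
    and f_lip: "\<And>u. u \<in> \<Omega> \<Longrightarrow> L-lipschitz_on UNIV (\<lambda>x. grad_x f (x, u))"
    and F: "F = (\<lambda>z. ereal (f z) + g z)"
    and xs: "xs \<in> M" and us: "us \<in> \<Omega>"
    and nondegenerate: "0 \<in> rel_interior (subdiff (\<lambda>x. F (x, us)) xs)"
    and psi: "solution_map F M \<Omega> xs us U \<psi>"
    and \<alpha>_bounds: "0 < \<alpha>_lo" "\<alpha>_lo \<le> \<alpha>_hi" "\<alpha>_hi < 2 / L"
    and \<alpha>: "\<And>k. \<alpha> k \<in> {\<alpha>_lo..\<alpha>_hi}" "\<alpha> \<longlonglongrightarrow> \<alpha>s"
    and \<beta>: "\<And>k. \<beta> k \<in> {0..1}" "\<beta> \<longlonglongrightarrow> \<beta>s"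
    and stable: "spectral_radius (deriv_op (\<lambda>z. accel_step f g \<alpha>s \<beta>s z us) (xs, xs)) < 1"
  shows "\<forall>\<^sub>F x0 in nhds xs.
    (\<lambda>k. iterate f g \<alpha> \<beta> x0 k us) \<longlonglongrightarrow> xs \<longrightarrow>
      (\<forall>k. iterate f g \<alpha> \<beta> x0 k differentiable (at us)) \<and>
      (\<lambda>k. deriv_op (iterate f g \<alpha> \<beta> x0 k) us) \<longlonglongrightarrow> deriv_op \<psi> us \<and>
      (\<forall>qx. Ck_submanifold 3 M \<and>
            lipschitz_near (M \<times> \<Omega>) (riem_grad_x M g) (xs, us) \<and>
            lipschitz_near UNIV (hess_x f) (xs, us) \<and>
            lipschitz_near (M \<times> \<Omega>) (riem_hess_x M g) (xs, us) \<and>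
            lipschitz_near UNIV (Du_grad_x f) (xs, us) \<and>
            lipschitz_near (M \<times> \<Omega>) (Du_riem_grad_x M g) (xs, us) \<and>
            converges_linearly (\<lambda>k. iterate f g \<alpha> \<beta> x0 k us) xs qx \<longrightarrow>
          converges_linearly (\<lambda>k. deriv_op (iterate f g \<alpha> \<beta> x0 k) us) (deriv_op \<psi> us)
            (max qx (spectral_radius (deriv_op (\<lambda>z. accel_step f g \<alpha>s \<beta>s z us) (xs, xs)))))"
proof -
  let ?\<rho> = "spectral_radius (deriv_op (\<lambda>z. accel_step f g \<alpha>s \<beta>s z us) (xs, xs))"
  let ?smooth = "Ck_submanifold 3 M \<and>
            lipschitz_near (M \<times> \<Omega>) (riem_grad_x M g) (xs, us) \<and>
            lipschitz_near UNIV (hess_x f) (xs, us) \<and>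
            lipschitz_near (M \<times> \<Omega>) (riem_hess_x M g) (xs, us) \<and>
            lipschitz_near UNIV (Du_grad_x f) (xs, us) \<and>
            lipschitz_near (M \<times> \<Omega>) (Du_riem_grad_x M g) (xs, us)"
  interpret partly_smooth_composite f g M \<Omega> xs us
    by unfold_locales
       (use \<Omega> f_C2 g_proper g_lsc g_ps f_convex g_convex xs us nondegenerate F in auto)
  have \<psi>: "open U" "us \<in> U" "Ck_on 1 \<psi> U" "\<psi> us = xs"
    and \<psi>min: "\<And>u y. u \<in> U \<Longrightarrow> y \<in> M \<Longrightarrow> y \<noteq> \<psi> u \<Longrightarrow> F (\<psi> u, u) < F (y, u)" "\<And>u. u \<in> U \<Longrightarrow> \<psi> u \<in> M"
    using psi unfolding solution_map_def by blast+
  have \<psi>C: "C1_near False \<psi> us" by (rule Ck_on_1_imp_C1_near[OF \<psi>(3,1,2)])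
  have "\<forall>\<^sub>F u in nhds us. \<psi> u \<in> M \<and> (\<forall>y\<in>M. ereal (f (\<psi> u, u)) + g (\<psi> u, u) \<le> ereal (f (y, u)) + g (y, u))"
    using eventually_nhds_in_open[OF \<psi>(1,2)]
  proof eventually_elim
    case (elim u)
    then show ?case using \<psi>min[of u] unfolding F by (metis less_imp_le order_refl)
  qed
  note fp = step_fixed_point[OF M _ C1_near_tendsto[OF \<psi>C, unfolded \<psi>(4)] this]
  have \<alpha>pos: "\<alpha> k > 0" for k using \<alpha>(1)[of k] \<alpha>_bounds(1) by auto
  have "\<alpha>_lo \<le> \<alpha>s" by (rule LIMSEQ_le_const[OF \<alpha>(2)]) (use \<alpha>(1) in auto)
  then have \<alpha>s: "\<alpha>s > 0" using \<alpha>_bounds(1) by simp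
  define A where "A = (\<lambda>(t :: real \<times> real, z, u). accel_step f g (fst t) (snd t) z u)"
  define \<theta> where "\<theta> = (\<lambda>k. (\<alpha> k, \<beta> k))"
  \<comment> \<open>The recursion from an arbitrary pair: \<open>derivative_iteration\<close> yields
    a neighbourhood in the product space, which is pulled back along x |-> (x, x)
    afterwards.\<close>
  define Z where "Z = (\<lambda>z k u. rec_nat z (\<lambda>k y. accel_step f g (\<alpha> k) (\<beta> k) y u) k)"
  define D where "D = pair_op (deriv_op \<psi> us) (deriv_op \<psi> us)"
  have Z: "Z (x0, x0) k u = iterate_pair f g \<alpha> \<beta> x0 k u" for x0 k u
    unfolding Z_def by (induction k) auto
  have D: "((\<lambda>u. (\<psi> u, \<psi> u)) has_derivative blinfun_apply D) (at us)"
    using has_derivative_deriv_op[OF C1_near_differentiable[OF \<psi>C]]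
    by (auto simp: D_def pair_op_apply[abs_def] intro!: has_derivative_Pair)
  have \<rho>: "deriv_op (\<lambda>z. A ((\<alpha>s, \<beta>s), z, us)) (xs, xs) = deriv_op (\<lambda>z. accel_step f g \<alpha>s \<beta>s z us) (xs, xs)"
    by (simp add: A_def)
  have main: "\<forall>\<^sub>F z in nhds (xs, xs).
     (\<forall>k. Z z k differentiable (at us)) \<and>
     (\<forall>h. (\<lambda>k. blinfun_apply (deriv_op (Z z k) us) h) \<longlonglongrightarrow> blinfun_apply D h) \<and>
     (b \<longrightarrow> (\<forall>p C. ?\<rho> < p \<longrightarrow> 0 < p \<longrightarrow>
        (\<forall>\<^sub>F k in sequentially. norm (Z z k us - (xs, xs)) \<le> C * p ^ k) \<longrightarrow>
        (\<forall>h. \<exists>E. \<forall>\<^sub>F k in sequentially.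
           norm (blinfun_apply (deriv_op (Z z k) us) h - blinfun_apply D h) \<le> E * p ^ k)))"
    if b: "C1_near b (\<lambda>(a, x, u). prox_grad_step f g a x u) (\<alpha>s, xs, us)" for b
    unfolding \<rho>[symmetric]
  proof (rule derivative_iteration[where A = A and \<theta> = \<theta> and \<psi> = "\<lambda>u. (\<psi> u, \<psi> u)"])
    show "\<theta> \<longlonglongrightarrow> (\<alpha>s, \<beta>s)" unfolding \<theta>_def by (intro tendsto_Pair \<alpha>(2) \<beta>(2))
    show "C1_near b A ((\<alpha>s, \<beta>s), (xs, xs), us)"
      unfolding A_def by (rule C1_near_accel_step[OF b])
    show "C1_near False A (\<theta> k, (xs, xs), us)" for k
      unfolding A_def \<theta>_def by (rule C1_near_accel_step[OF C1_near_step[OF M \<alpha>pos]])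
    show "\<forall>\<^sub>F u in nhds us. A (\<theta> k, (\<psi> u, \<psi> u), u) = (\<psi> u, \<psi> u)" for k
      using fp[OF \<alpha>pos[of k]] by eventually_elim (simp add: A_def \<theta>_def accel_step_def)
    show "spectral_radius (deriv_op (\<lambda>z. A ((\<alpha>s, \<beta>s), z, us)) (xs, xs)) < 1"
      using stable unfolding \<rho> .
    show "Z z 0 u = z" "Z z (Suc k) u = A (\<theta> k, Z z k u, u)" for z k u
      by (simp_all add: Z_def A_def \<theta>_def)
  qed (use D \<psi>(4) in auto)
  have diag: "((\<lambda>x. (x, x)) \<longlongrightarrow> (xs, xs)) (nhds xs)" by (intro tendsto_Pair filterlim_ident)
  \<comment> \<open>The flag is the proposition \<open>?smooth\<close> itself. One neighbourhood of
    starting points thus serves both claims, and the rate claim is vacuous when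
    \<open>?smooth\<close> fails.\<close>
  have C1s: "C1_near ?smooth (\<lambda>(a, x, u). prox_grad_step f g a x u) (\<alpha>s, xs, us)"
  proof (cases ?smooth)
    case True
    then show ?thesis using C1_near_step_lipschitz[OF _ \<alpha>s] by simp
  next
    case False
    then have "?smooth = False" by blast
    then show ?thesis using C1_near_step[OF M \<alpha>s] by (simp only:)
  qed
  from eventually_compose_filterlim[OF main[OF C1s] diag]
  show ?thesis
  proof eventually_elim
    case (elim x0)
    let ?I = "iterate f g \<alpha> \<beta> x0"
    have Zp: "Z (x0, x0) k = iterate_pair f g \<alpha> \<beta> x0 k" for k by (rule ext) (rule Z)
    have ZI: "?I k = (\<lambda>u. fst (Z (x0, x0) k u))" for k
      by (rule ext) (simp add: iterate_def Z)
    have diffZ: "Z (x0, x0) k differentiable (at us)" for k using elim by blast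
    have dI: "(?I k has_derivative (\<lambda>h. fst (blinfun_apply (deriv_op (Z (x0, x0) k) us) h))) (at us)" for k
      unfolding ZI by (rule has_derivative_fst[OF has_derivative_deriv_op[OF diffZ]])
    have dI': "blinfun_apply (deriv_op (?I k) us) h = fst (blinfun_apply (deriv_op (Z (x0, x0) k) us) h)" for k h
      by (simp add: deriv_op_apply[OF dI])
    have Dh: "fst (blinfun_apply D h) = blinfun_apply (deriv_op \<psi> us) h" for h by (simp add: D_def)
    have conv: "(\<lambda>k. deriv_op (?I k) us) \<longlonglongrightarrow> deriv_op \<psi> us"
    proof (rule blinfun_tendsto_pointwise)
      fix h
      have "(\<lambda>k. blinfun_apply (deriv_op (Z (x0, x0) k) us) h) \<longlonglongrightarrow> blinfun_apply D h" using elim by blast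
      from tendsto_fst[OF this] show "(\<lambda>k. blinfun_apply (deriv_op (?I k) us) h) \<longlonglongrightarrow> blinfun_apply (deriv_op \<psi> us) h"
        by (simp add: dI' Dh)
    qed
    have rate: "converges_linearly (\<lambda>k. deriv_op (?I k) us) (deriv_op \<psi> us) (max qx ?\<rho>)"
      if smooth: ?smooth and qx: "converges_linearly (\<lambda>k. ?I k us) xs qx" for qx
      unfolding converges_linearly_def
    proof (intro conjI ballI)
      show "0 \<le> max qx ?\<rho>" "max qx ?\<rho> < 1" using qx stable unfolding converges_linearly_def by auto
      fix p assume p: "p \<in> {max qx ?\<rho><..<1}"
      then have p0: "p > 0" and p\<rho>: "?\<rho> < p" using qx unfolding converges_linearly_def by auto
      have "(\<lambda>k. norm (?I k us - xs)) \<in> O(\<lambda>k. p ^ k)"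
        using qx p unfolding converges_linearly_def by auto
      then obtain C where C: "\<forall>\<^sub>F k in sequentially. norm (norm (?I k us - xs)) \<le> C * norm (p ^ k)"
        by (rule landau_o.bigE)
      then obtain k0 where k0: "\<And>k. k \<ge> k0 \<Longrightarrow> norm (?I k us - xs) \<le> C * p ^ k"
        using p0 unfolding eventually_sequentially by auto
      \<comment> \<open>The pair also contains the previous iterate: its bound C p^(k-1) equals (C /
        p) p^k, and the index k - 1 must still be at least k0.\<close>
      have "norm (Z (x0, x0) k us - (xs, xs)) \<le> (C + C / p) * p ^ k" if k: "k \<ge> Suc k0" for k
      proof -
        obtain j where j: "k = Suc j" "j \<ge> k0" using k by (cases k) auto
        have "Z (x0, x0) k us = (?I k us, ?I j us)"
          by (simp add: Z iterate_def j accel_step_def)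
        then have "norm (Z (x0, x0) k us - (xs, xs)) \<le> norm (?I k us - xs) + norm (?I j us - xs)"
          using norm_Pair_le[of "?I k us - xs" "?I j us - xs"] by simp
        also have "\<dots> \<le> C * p ^ k + C * p ^ j" using k0[of k] k0[of j] j by (intro add_mono) auto
        also have "\<dots> = (C + C / p) * p ^ k" using p0 by (simp add: j field_simps)
        finally show ?thesis .
      qed
      then have "\<forall>\<^sub>F k in sequentially. norm (Z (x0, x0) k us - (xs, xs)) \<le> (C + C / p) * p ^ k"
        unfolding eventually_sequentially by blast
      then have E: "\<exists>E. \<forall>\<^sub>F k in sequentially. norm (blinfun_apply (deriv_op (Z (x0, x0) k) us) h - blinfun_apply D h) \<le> E * p ^ k" for h
        using elim smooth p0 p\<rho> by blast
      have "\<exists>E. \<forall>\<^sub>F k in sequentially. norm (deriv_op (?I k) us - deriv_op \<psi> us) \<le> E * p ^ k"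
      proof (rule blinfun_geometric_pointwise)
        fix h
        obtain E where "\<forall>\<^sub>F k in sequentially. norm (blinfun_apply (deriv_op (Z (x0, x0) k) us) h - blinfun_apply D h) \<le> E * p ^ k"
          using E by blast
        then have "\<forall>\<^sub>F k in sequentially. norm (blinfun_apply (deriv_op (?I k) us) h - blinfun_apply (deriv_op \<psi> us) h) \<le> E * p ^ k"
        proof eventually_elim
          case (elim k)
          have "norm (fst (blinfun_apply (deriv_op (Z (x0, x0) k) us) h - blinfun_apply D h))
              \<le> norm (blinfun_apply (deriv_op (Z (x0, x0) k) us) h - blinfun_apply D h)"
            by (metis norm_fst_le prod.collapse)
          with elim show ?case unfolding dI' Dh[symmetric] fst_diff by linarith
        qed
        then show "\<exists>E. \<forall>\<^sub>F k in sequentially. norm (blinfun_apply (deriv_op (?I k) us) h - blinfun_apply (deriv_op \<psi> us) h) \<le> E * p ^ k"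
          by blast
      qed
      then obtain E where "\<forall>\<^sub>F k in sequentially. norm (deriv_op (?I k) us - deriv_op \<psi> us) \<le> E * p ^ k" by blast
      then show "(\<lambda>k. norm (deriv_op (?I k) us - deriv_op \<psi> us)) \<in> O(\<lambda>k. p ^ k)"
        using p0 by (intro bigoI[of _ E]) (auto elim!: eventually_mono)
    qed
    show ?case
      using dI conv rate unfolding differentiable_def by blast
  qed
qed

end
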